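(* For every connected paving matroid $M$, the polynomial $g_M(t)$ has nonnegative integer coefficients, i.e. $g_M(t)\in\mathbb{Z}_{\geq 0}[t]$.
   Context: All matroids are on finite ground sets. A matroid is connected if it is not the direct sum of two matroids with nonempty ground sets. A matroid of rank $r$ is paving if all of its circuits have at least $r$ elements. $U_{r,n}$ denotes the uniform matroid of rank $r$ on $n$ elements. The $g$-polynomial (Speyer, Fink--Speyer): there is a unique way of associating to each matroid $M$ a polynomial $g_M(t)\in\mathbb{Z}[t]$ (the same for isomorphic matroids) such that the following hold. (1) If $M$ has a loop or a coloop, then $g_M(t)=0$. (2) $g_M(t)$ is invariant under series and parallel extensions, excluding series extensions at loops and parallel extensions at coloops. Here, at a nonloop $e$, a parallel extension of $M$ at $e$ is a matroid $N$ with $N\setminus f=M$ for a new element $f$ such that $\{e,f\}$ is a circuit of $N$; at a non-coloop $e$, a series extension of $M$ at $e$ is a matroid $N$ with $N/f=M$ for a new element $f$ such that $\{e,f\}$ is a cocircuit of $N$. (3) If $M=M_1\oplus M_2$, then $g_M(t)=g_{M_1}(t)\,g_{M_2}(t)$. (4) $M\mapsto g_M(t)$ is covaluative: for every subdivision of the base polytope $P(M)$ (the convex hull of the indicator vectors of the bases of $M$) into matroid base polytopes, $g_M(t)=\sum_{N} g_N(t)$, where the sum is over all matroids $N$ whose base polytope is a cell (of any dimension) of the subdivision not contained in the boundary of $P(M)$. (5) $g_{U_{1,2}}(t)=t$. *)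

theory Defs
  imports
    "HOL-Analysis.Analysis"
    "HOL-Analysis.Finite_Function_Topology"
    "HOL-Computational_Algebra.Polynomial"
    "HOL-Library.Infinite_Typeclass"
begin

section \<open>Matroids\<close>

datatype 'a matroid = Matroid (ground: "'a set") (indep: "'a set set")

text \<open>Independent sets are required to lie in the ground set, so two matroids are equal as
  values iff they have the same ground set and the same independent sets.\<close>

definition is_matroid :: "'a matroid \<Rightarrow> bool" where
  "is_matroid M \<longleftrightarrow>
     finite (ground M) \<and>
     (\<forall>I\<in>indep M. I \<subseteq> ground M) \<and>
     {} \<in> indep M \<and>
     (\<forall>I\<in>indep M. \<forall>J. J \<subseteq> I \<longrightarrow> J \<in> indep M) \<and>
     (\<forall>I\<in>indep M. \<forall>J\<in>indep M. card I < card J \<longrightarrow> (\<exists>x\<in>J - I. insert x I \<in> indep M))"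

definition bases :: "'a matroid \<Rightarrow> 'a set set" where
  "bases M = {B \<in> indep M. \<forall>I\<in>indep M. B \<subseteq> I \<longrightarrow> I = B}"

definition matroid_rank :: "'a matroid \<Rightarrow> nat" where
  "matroid_rank M = Max (card ` indep M)"

definition circuits :: "'a matroid \<Rightarrow> 'a set set" where
  "circuits M = {C. C \<subseteq> ground M \<and> C \<notin> indep M \<and> (\<forall>D. D \<subset> C \<longrightarrow> D \<in> indep M)}"

text \<open>The bases of the dual are the complements of the bases.\<close>

definition dual :: "'a matroid \<Rightarrow> 'a matroid" where
  "dual M = Matroid (ground M) {I. \<exists>B\<in>bases M. I \<subseteq> ground M - B}"

definition cocircuits :: "'a matroid \<Rightarrow> 'a set set" where
  "cocircuits M = circuits (dual M)"

definition is_loop :: "'a matroid \<Rightarrow> 'a \<Rightarrow> bool" where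
  "is_loop M e \<longleftrightarrow> {e} \<in> circuits M"

definition is_coloop :: "'a matroid \<Rightarrow> 'a \<Rightarrow> bool" where
  "is_coloop M e \<longleftrightarrow> is_loop (dual M) e"

definition deletion :: "'a matroid \<Rightarrow> 'a \<Rightarrow> 'a matroid" where
  "deletion M f = Matroid (ground M - {f}) {I \<in> indep M. f \<notin> I}"

definition contraction :: "'a matroid \<Rightarrow> 'a \<Rightarrow> 'a matroid" where
  "contraction M f = dual (deletion (dual M) f)"

text \<open>This is the direct sum only when the two ground sets are disjoint; that is always
  required separately.\<close>

definition direct_sum :: "'a matroid \<Rightarrow> 'a matroid \<Rightarrow> 'a matroid" where
  "direct_sum M N = Matroid (ground M \<union> ground N) {I \<union> J | I J. I \<in> indep M \<and> J \<in> indep N}"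

definition uniform_matroid :: "nat \<Rightarrow> 'a set \<Rightarrow> 'a matroid" where
  "uniform_matroid r E = Matroid E {I. I \<subseteq> E \<and> card I \<le> r}"

definition matroid_isomorphic :: "'a matroid \<Rightarrow> 'b matroid \<Rightarrow> bool" where
  "matroid_isomorphic M N \<longleftrightarrow>
     (\<exists>\<phi>. bij_betw \<phi> (ground M) (ground N) \<and>
          (\<forall>I. I \<subseteq> ground M \<longrightarrow> (I \<in> indep M \<longleftrightarrow> \<phi> ` I \<in> indep N)))"

definition connected_matroid :: "'a matroid \<Rightarrow> bool" where
  "connected_matroid M \<longleftrightarrow>
     \<not> (\<exists>M1 M2. is_matroid M1 \<and> is_matroid M2 \<and> ground M1 \<noteq> {} \<and> ground M2 \<noteq> {} \<and>
               ground M1 \<inter> ground M2 = {} \<and> M = direct_sum M1 M2)"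

definition paving :: "'a matroid \<Rightarrow> bool" where
  "paving M \<longleftrightarrow> (\<forall>C\<in>circuits M. matroid_rank M \<le> card C)"

definition parallel_extension :: "'a matroid \<Rightarrow> 'a \<Rightarrow> 'a matroid \<Rightarrow> bool" where
  "parallel_extension M e N \<longleftrightarrow>
     is_matroid M \<and> is_matroid N \<and> e \<in> ground M \<and> \<not> is_loop M e \<and>
     (\<exists>f. f \<notin> ground M \<and> deletion N f = M \<and> {e, f} \<in> circuits N)"

definition series_extension :: "'a matroid \<Rightarrow> 'a \<Rightarrow> 'a matroid \<Rightarrow> bool" where
  "series_extension M e N \<longleftrightarrow>
     is_matroid M \<and> is_matroid N \<and> e \<in> ground M \<and> \<not> is_coloop M e \<and>
     (\<exists>f. f \<notin> ground M \<and> contraction N f = M \<and> {e, f} \<in> cocircuits N)"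

section \<open>Base polytopes and their subdivisions\<close>

text \<open>Ground sets vary, so base polytopes are placed in the space of finitely supported
  functions; the space \<open>\<real>\<^sup>E\<close> is the subspace of functions supported on \<open>E\<close>, on which the
  norm of the library induces the usual topology.\<close>

definition indicator_vector :: "'a set \<Rightarrow> ('a \<Rightarrow>\<^sub>0 real)" where
  "indicator_vector B = (\<Sum>i\<in>B. Poly_Mapping.single i 1)"

definition base_polytope :: "'a matroid \<Rightarrow> ('a \<Rightarrow>\<^sub>0 real) set" where
  "base_polytope M = convex hull (indicator_vector ` bases M)"

text \<open>The cells of a subdivision are its nonempty faces of all dimensions; the empty face is
  left out.\<close>

definition polytope_subdivision :: "'v::real_vector set set \<Rightarrow> 'v set \<Rightarrow> bool" where
  "polytope_subdivision \<C> P \<longleftrightarrow>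
     finite \<C> \<and>
     (\<forall>Q\<in>\<C>. polytope Q \<and> Q \<noteq> {}) \<and>
     (\<forall>Q\<in>\<C>. \<forall>F. F face_of Q \<and> F \<noteq> {} \<longrightarrow> F \<in> \<C>) \<and>
     (\<forall>Q\<in>\<C>. \<forall>R\<in>\<C>. Q \<inter> R face_of Q \<and> Q \<inter> R face_of R) \<and>
     \<Union>\<C> = P"

definition matroid_subdivision :: "('a \<Rightarrow>\<^sub>0 real) set set \<Rightarrow> 'a matroid \<Rightarrow> bool" where
  "matroid_subdivision \<C> M \<longleftrightarrow>
     polytope_subdivision \<C> (base_polytope M) \<and>
     (\<forall>Q\<in>\<C>. \<exists>N. is_matroid N \<and> ground N = ground M \<and> Q = base_polytope N)"

text \<open>The condition on the ground set is needed: adding loops to a matroid does not change its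
  base polytope as a set of finitely supported functions. The relative frontier is the boundary
  of the polytope within its affine hull.\<close>

definition interior_cells :: "('a \<Rightarrow>\<^sub>0 real) set set \<Rightarrow> 'a matroid \<Rightarrow> 'a matroid set" where
  "interior_cells \<C> M =
     {N. is_matroid N \<and> ground N = ground M \<and> base_polytope N \<in> \<C> \<and>
         \<not> base_polytope N \<subseteq> rel_frontier (base_polytope M)}"

lemma finite_interior_cells:
  assumes "is_matroid M"
  shows "finite (interior_cells \<C> M)"
proof (rule finite_subset)
  show "interior_cells \<C> M \<subseteq> Matroid (ground M) ` Pow (Pow (ground M))"
  proof
    fix N assume "N \<in> interior_cells \<C> M"
    then have "ground N = ground M" and "is_matroid N"
      by (simp_all add: interior_cells_def)
    then have "ground N = ground M" "indep N \<in> Pow (Pow (ground M))"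
      by (auto simp: is_matroid_def)
    then show "N \<in> Matroid (ground M) ` Pow (Pow (ground M))"
      by (metis image_eqI matroid.collapse)
  qed
  show "finite (Matroid (ground M) ` Pow (Pow (ground M)))"
    using assms by (simp add: is_matroid_def)
qed

section \<open>The g-polynomial\<close>

text \<open>The polynomial \<open>g\<^sub>M\<close> is characterised by the properties below. Ground sets are finite
  subsets of an arbitrary infinite type, so every finite matroid occurs up to isomorphism and
  new elements for extensions and direct sums are always available. Values of \<open>g\<close> outside
  \<^const>\<open>is_matroid\<close> are unconstrained.\<close>

locale g_polynomial =
  fixes g :: "'a::infinite matroid \<Rightarrow> int poly"
  assumes isomorphic:
    "\<And>M N. is_matroid M \<Longrightarrow> is_matroid N \<Longrightarrow> matroid_isomorphic M N \<Longrightarrow> g M = g N"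
  and loop_coloop:
    "\<And>M e. is_matroid M \<Longrightarrow> is_loop M e \<or> is_coloop M e \<Longrightarrow> g M = 0"
  and parallel:
    "\<And>M e N. parallel_extension M e N \<Longrightarrow> \<not> is_coloop M e \<Longrightarrow> g N = g M"
  and series:
    "\<And>M e N. series_extension M e N \<Longrightarrow> \<not> is_loop M e \<Longrightarrow> g N = g M"
  and direct_sum:
    "\<And>M N. is_matroid M \<Longrightarrow> is_matroid N \<Longrightarrow> ground M \<inter> ground N = {} \<Longrightarrow>
       g (direct_sum M N) = g M * g N"
  and covaluative:
    "\<And>M \<C>. is_matroid M \<Longrightarrow> matroid_subdivision \<C> M \<Longrightarrow>
       g M = (\<Sum>N\<in>interior_cells \<C> M. g N)"
  and uniform_1_2:
    "\<And>E. card E = 2 \<Longrightarrow> g (uniform_matroid 1 E) = [:0, 1:]"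

end

theory Submission
  imports Defs
begin

text \<open>A paving matroid of rank \<open>k \<ge> 2\<close> without coloops on \<open>n\<close> elements is obtained from \<open>U\<^sub>k\<^sub>,\<^sub>n\<close> by
  declaring the \<open>k\<close>-subsets of certain blocks \<open>H\<close> dependent, where two blocks share at most \<open>k - 2\<close>
  elements. Relaxing one block of size \<open>h\<close> cuts the base polytope along the hyperplane
  \<open>x(H) = k - 1\<close>. The interior cells of this subdivision are the two halves and their common facet.
  The half \<open>x(H) \<ge> k - 1\<close> is a parallel extension of \<open>U\<^sub>k\<^sub>,\<^sub>h\<^sub>+\<^sub>1\<close>, and the facet is the sum of
  \<open>U\<^sub>k\<^sub>-\<^sub>1\<^sub>,\<^sub>h\<close> and a rank-one uniform matroid. Hence \<open>g\<close> drops by \<open>g(U\<^sub>k\<^sub>,\<^sub>h\<^sub>+\<^sub>1) + t g(U\<^sub>k\<^sub>-\<^sub>1\<^sub>,\<^sub>h)\<close> for each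
  block.

  A single block of size \<open>n - 2\<close> gives a series extension of \<open>U\<^sub>k\<^sub>-\<^sub>1\<^sub>,\<^sub>n\<^sub>-\<^sub>1\<close>, and hence the recursion
  \<open>g(U\<^sub>k\<^sub>,\<^sub>n) = g(U\<^sub>k\<^sub>-\<^sub>1\<^sub>,\<^sub>n\<^sub>-\<^sub>1) + g(U\<^sub>k\<^sub>,\<^sub>n\<^sub>-\<^sub>1) + t g(U\<^sub>k\<^sub>-\<^sub>1\<^sub>,\<^sub>n\<^sub>-\<^sub>2)\<close>, whose solution has the coefficients
  \<open>(k-1 choose i-1) (n-i-1 choose k-1)\<close>. Nonnegativity thus becomes an inequality for the block sizes,
  which is proved by deleting and contracting a point.\<close>

text \<open>Cutting at x(H) = k - 1 creates no new vertex: if two bases lie strictly on opposite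
  sides, the sum of their indicator vectors is also the sum of those of two bases, one of them on
  the hyperplane. This exchange is why both halves are again base polytopes. The half beyond the
  hyperplane involves H alone, since the other blocks meet H in at most k - 2 elements; so the drop
  of g depends only on k and |H|. All three cells are interior only if the hyperplane contains a
  relative interior point of the larger polytope. For k = 2 there is none if another block is the
  complement of H, and this is where connectedness enters. The block of size n - 2 is the largest
  allowed. Its bases are the k-sets meeting the two remaining points, which are therefore in series.
  The delicate coefficient is that of t^2. From t^3 on, the two points that every block leaves
  uncovered absorb the terms coming from the facets; for t^2 both kinds of terms have to be
  estimated together. Base polytopes live in an infinite-dimensional normed space, so the geometric
  part assumes no finite dimension.\<close>

section \<open>Inequalities for the block sizes\<close>

text \<open>Deleting and contracting a point \<open>e\<close>: Pascal's rule splits the summand of a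
  block through \<open>e\<close> into that of the deleted block for \<open>k\<close> and that of the
  contracted block for \<open>k - 1\<close>, and the right-hand side splits alike. All blocks must
  keep the distance \<open>s\<close> from the ground set, so the induction stops at a block with
  exactly \<open>card E - s\<close> elements. Any other block has at most \<open>k - 2\<close>
  elements inside it and at most \<open>s \<le> j\<close> outside, so its binomial coefficient
  vanishes.\<close>

lemma sum_binomial_le:
  fixes H :: "'i \<Rightarrow> 'a set"
  assumes "finite E" "finite I" "k \<ge> 1" "s \<le> j"
    and "\<And>i. i \<in> I \<Longrightarrow> H i \<subseteq> E" "\<And>i. i \<in> I \<Longrightarrow> card (H i) + s \<le> card E"
    and "\<And>i i'. i \<in> I \<Longrightarrow> i' \<in> I \<Longrightarrow> i \<noteq> i' \<Longrightarrow> card (H i \<inter> H i') + 2 \<le> k"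
  shows "(\<Sum>i\<in>I. (card (H i) - j) choose (k - 1)) \<le> (card E - j - s) choose (k - 1)"
  using assms
proof (induction "card E" arbitrary: E H I k rule: less_induct)
  case less
  note fin = less.prems(1,2) and sub = less.prems(5) and le = less.prems(6) and pw = less.prems(7)
  have finH: "finite (H i)" if "i \<in> I" for i
    using sub[OF that] fin(1) finite_subset by blast
  consider "I = {}" | "I \<noteq> {}" "k = 1" | "k \<ge> 2" "\<exists>i\<in>I. card (H i) + s = card E"
    | "I \<noteq> {}" "k \<ge> 2" "\<forall>i\<in>I. card (H i) + s < card E"
    using le less.prems(3) by (metis le_neq_implies_less One_nat_def Suc_1 Suc_leI le_eq_less_or_eq)
  then show ?case
  proof cases
    case 1
    then show ?thesis by simp
  next
    case 2
    then obtain a where "a \<in> I" by blast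
    then have "I = {a}" using pw[of a] 2(2) by fastforce
    then show ?thesis using 2 by simp
  next
    case 3
    then obtain a where a: "a \<in> I" "card (H a) + s = card E" by blast
    have zero: "(card (H i) - j) choose (k - 1) = 0" if i: "i \<in> I - {a}" for i
    proof -
      have "card (H i - H a) \<le> card (E - H a)"
        using sub[of i] i fin by (intro card_mono) auto
      also have "\<dots> = s" using a sub[OF a(1)] finH[OF a(1)] by (simp add: card_Diff_subset)
      finally have "card (H i) \<le> card (H i \<inter> H a) + s"
        using card_Int_Diff[of "H i" "H a"] finH i by simp
      then show ?thesis using pw[of i a] i a(1) less.prems(4) 3(1) by (intro binomial_eq_0) auto
    qed
    have "(\<Sum>i\<in>I. (card (H i) - j) choose (k - 1)) = (card (H a) - j) choose (k - 1)"
      using zero a(1) fin(2) by (simp add: sum.remove)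
    moreover have "card (H a) = card E - s" using a by simp
    ultimately show ?thesis by (simp add: diff_diff_eq add.commute)
  next
    case 4
    then obtain a where "a \<in> I" by blast
    then have "card E > 0" using 4(3) by fastforce
    then obtain e where e: "e \<in> E" by fastforce
    let ?I = "{i\<in>I. e \<in> H i}" and ?E = "E - {e}" and ?H = "\<lambda>i. H i - {e}"
    have cE: "card ?E = card E - 1" using e fin by simp
    have cH: "card (?H i) = (if e \<in> H i then card (H i) - 1 else card (H i))" if "i \<in> I" for i
      by simp
    have le': "card (?H i) + s \<le> card ?E" if "i \<in> I" for i
      using 4(3) that cE by (auto simp: cH[OF that])
    show ?thesis
    proof (cases "card E > j + s")
      \<comment> \<open>Truncated subtraction would spoil Pascal's rule on the right here. But
        \<open>card (H i) + s < card E \<le> j + s\<close> makes every top entry 0, while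
        \<open>k - 1\<close> is positive.\<close>
      case False
      have "(card (H i) - j) choose (k - 1) = 0" if "i \<in> I" for i
        using False 4 that by (intro binomial_eq_0) fastforce
      then have "(\<Sum>i\<in>I. (card (H i) - j) choose (k - 1)) = 0" by (intro sum.neutral ballI)
      then show ?thesis by simp
    next
      case True
      have del: "(\<Sum>i\<in>I. (card (?H i) - j) choose (k - 1)) \<le> (card ?E - j - s) choose (k - 1)"
      proof (rule less.hyps)
        show "card (?H i \<inter> ?H i') + 2 \<le> k" if "i \<in> I" "i' \<in> I" "i \<noteq> i'" for i i'
        proof -
          have "card (?H i \<inter> ?H i') \<le> card (H i \<inter> H i')"
            using finH that by (intro card_mono) auto
          then show ?thesis using pw[OF that] by simp
        qed
        show "card ?E < card E" using cE \<open>card E > 0\<close> by simp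
      qed (use le' fin sub less.prems(3,4) in auto)
      have con: "(\<Sum>i\<in>?I. (card (?H i) - j) choose (k - 1 - 1)) \<le> (card ?E - j - s) choose (k - 1 - 1)"
      proof (rule less.hyps)
        show "card (?H i \<inter> ?H i') + 2 \<le> k - 1" if "i \<in> ?I" "i' \<in> ?I" "i \<noteq> i'" for i i'
        proof -
          have "?H i \<inter> ?H i' = (H i \<inter> H i') - {e}" by auto
          moreover have "card (H i \<inter> H i') > 0" using that finH[of i] by (auto simp: card_gt_0_iff)
          ultimately have "card (?H i \<inter> ?H i') + 1 = card (H i \<inter> H i')" using that by simp
          then show ?thesis using pw[of i i'] that by simp
        qed
        show "card ?E < card E" using cE \<open>card E > 0\<close> by simp
      show "card (?H i) + s \<le> card ?E" if "i \<in> ?I" for i using le' that by blast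
      qed (use fin sub less.prems(3,4) 4 in auto)
      have "(card (H i) - j) choose (k - 1) \<le> ((card (?H i) - j) choose (k - 1))
           + (if e \<in> H i then (card (?H i) - j) choose (k - 1 - 1) else 0)" if "i \<in> I" for i
      proof (cases "e \<in> H i \<and> card (H i) > j")
        case True
        then have "card (H i) - j = Suc (card (?H i) - j)" using cH[OF that] by auto
        moreover have "k - 1 = Suc (k - 1 - 1)" using 4 by simp
        ultimately have "(card (H i) - j) choose (k - 1)
            = ((card (?H i) - j) choose (k - 1 - 1)) + ((card (?H i) - j) choose (k - 1))"
          by (metis binomial_Suc_Suc)
        then show ?thesis using True by simp
      next
        case False
        then show ?thesis using cH[OF that] 4(2) by auto
      qed
      then have "(\<Sum>i\<in>I. (card (H i) - j) choose (k - 1)) \<le> (\<Sum>i\<in>I. ((card (?H i) - j) choose (k - 1))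
           + (if e \<in> H i then (card (?H i) - j) choose (k - 1 - 1) else 0))"
        by (rule sum_mono)
      also have "\<dots> = (\<Sum>i\<in>I. (card (?H i) - j) choose (k - 1))
            + (\<Sum>i\<in>?I. (card (?H i) - j) choose (k - 1 - 1))"
        using fin by (simp add: sum.distrib sum.If_cases Int_def)
      also have "\<dots> \<le> ((card ?E - j - s) choose (k - 1)) + ((card ?E - j - s) choose (k - 1 - 1))"
        using del con by simp
      also have "\<dots> = (card E - j - s) choose (k - 1)"
      proof -
        have "card E - j - s = Suc (card ?E - j - s)" using cE True by simp
        moreover have "k - 1 = Suc (k - 1 - 1)" using 4 by simp
        ultimately show ?thesis by (metis add.commute binomial_Suc_Suc)
      qed
      finally show ?thesis .
    qed
  qed
qed

text \<open>This serves the coefficient of t^2, with \<open>K = k - 1\<close>. The factor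
  \<open>K\<close> is a separate variable because contracting a point lowers \<open>k\<close> but
  has to leave the factor alone; \<open>K \<ge> k - 1\<close> survives. Deletion and contraction
  work as before, and the effort goes into the ends of the induction: \<open>k = 2\<close>, and a
  block with \<open>card E - 2\<close> elements.\<close>

lemma sum_binomial_pair_le:
  fixes H :: "'i \<Rightarrow> 'a set"
  assumes "finite E" "finite I" "k \<ge> 2" "K \<ge> 2" "K \<ge> k - 1"
    and "\<And>i. i \<in> I \<Longrightarrow> H i \<subseteq> E" "\<And>i. i \<in> I \<Longrightarrow> card (H i) + 2 \<le> card E"
    and "\<And>i. i \<in> I \<Longrightarrow> k \<le> card (H i)"
    and "\<And>i i'. i \<in> I \<Longrightarrow> i' \<in> I \<Longrightarrow> i \<noteq> i' \<Longrightarrow> card (H i \<inter> H i') + 2 \<le> k"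
  shows "(\<Sum>i\<in>I. K * ((card (H i) - 2) choose (k - 1)) + ((card (H i) - 2) choose (k - 2)))
           \<le> K * ((card E - 3) choose (k - 1))"
  using assms
proof (induction "card E" arbitrary: E H I k rule: less_induct)
  case less
  note fin = less.prems(1,2) and sub = less.prems(6) and le = less.prems(7)
    and ge = less.prems(8) and pw = less.prems(9)
  have finH: "finite (H i)" if "i \<in> I" for i
    using sub[OF that] fin(1) finite_subset by blast
  consider "I = {}" | "I \<noteq> {}" "k = 2" | "k \<ge> 3" "\<exists>i\<in>I. card (H i) + 2 = card E"
    | "I \<noteq> {}" "k \<ge> 3" "\<forall>i\<in>I. card (H i) + 2 < card E"
    using le less.prems(3) by (metis le_neq_implies_less Suc_leI eval_nat_numeral(3))
  then show ?case
  proof cases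
    case 1
    then show ?thesis by simp
  next
    case 2
    have disj: "disjoint_family_on H I"
      using pw finH 2 by (fastforce simp: disjoint_family_on_def)
    have "(\<Sum>i\<in>I. card (H i)) = card (\<Union>i\<in>I. H i)"
      using disj fin finH by (intro card_UN_disjoint[symmetric]) (auto simp: disjoint_family_on_def)
    also have "\<dots> \<le> card E" using sub fin by (intro card_mono) auto
    finally have tot: "(\<Sum>i\<in>I. card (H i)) \<le> card E" .
    have "(\<Sum>i\<in>I. K * (card (H i) - 2) + 1) + 2 * K * card I = K * (\<Sum>i\<in>I. card (H i)) + card I"
    proof -
      have "(\<Sum>i\<in>I. K * (card (H i) - 2) + 1) + (\<Sum>i\<in>I. 2 * K) = (\<Sum>i\<in>I. K * card (H i) + 1)"
        unfolding sum.distrib[symmetric]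
      proof (rule sum.cong)
        fix i assume "i \<in> I"
        then obtain d where "card (H i) = d + 2" using ge[of i] 2 by (metis add.commute le_Suc_ex)
        then show "K * (card (H i) - 2) + 1 + 2 * K = K * card (H i) + 1"
          by (simp add: algebra_simps)
      qed simp
      moreover have "(\<Sum>i\<in>I. K * card (H i) + 1) = K * (\<Sum>i\<in>I. card (H i)) + card I"
        by (simp add: sum_Suc sum_distrib_left)
      moreover have "(\<Sum>i\<in>I. 2 * K) = 2 * K * card I" by simp
      ultimately show ?thesis by linarith
    qed
    moreover have "K * (\<Sum>i\<in>I. card (H i)) + card I + 3 * K \<le> K * card E + 2 * K * card I"
    \<comment> \<open>With the total size bounded by \<open>card E\<close>, it suffices that
      \<open>card I + 3 * K \<le> 2 * K * card I\<close>. For two blocks this is 2 + 3K \<le> 4K,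
      hence the assumption \<open>K \<ge> 2\<close>. For one block it fails, and the two points
      missing from the block are used instead.\<close>
    proof (cases "card I \<ge> 2")
      case True
      have "card I + 3 * K \<le> 2 * K * card I"
      proof -
        obtain m where m: "card I = m + 2" using True by (metis add.commute le_Suc_ex)
        obtain l where l: "K = l + 2" using less.prems(4) by (metis add.commute le_Suc_ex)
        show ?thesis unfolding m l by (simp add: algebra_simps)
      qed
      then show ?thesis using mult_le_mono2[OF tot, of K] by linarith
    next
      case False
      then have "card I = 1" using 2 fin by (metis One_nat_def Suc_1 Suc_leI card_gt_0_iff not_less_eq_eq le_antisym)
      then obtain a where a: "I = {a}" by (metis card_1_singletonE)
      then obtain d where "card E = card (H a) + 2 + d" using le[of a] by (auto simp: le_iff_add)
      then show ?thesis using a less.prems(4) by (simp add: algebra_simps)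
    qed
    ultimately have "(\<Sum>i\<in>I. K * (card (H i) - 2) + 1) + 3 * K \<le> K * card E" by linarith
    moreover have "card E \<ge> 3" using 2 le ge by fastforce
    ultimately show ?thesis using 2(2) by (simp add: diff_mult_distrib2 mult.commute)
  next
    case 3
    then obtain a where a: "a \<in> I" "card (H a) + 2 = card E" by blast
    have cEa: "card (E - H a) = 2" using a sub[OF a(1)] finH[OF a(1)] by (simp add: card_Diff_subset)
    \<comment> \<open>At most \<open>k - 2\<close> elements lie in \<open>H a\<close> and at most 2
      outside, but there are at least \<open>k\<close> in total, so both bounds are
      attained.\<close>
    have other: "card (H i) = k \<and> E - H a \<subseteq> H i \<and> card (H i \<inter> H a) = k - 2" if i: "i \<in> I - {a}" for i
    proof -
      have s: "H i - H a \<subseteq> E - H a" using sub[of i] i by blast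
      then have c: "card (H i - H a) \<le> 2"
        using card_mono[OF _ s] fin cEa by simp
      have "card (H i) = card (H i \<inter> H a) + card (H i - H a)"
        using card_Int_Diff[of "H i" "H a"] finH i by simp
      then have *: "card (H i) = k" "card (H i - H a) = 2" "card (H i \<inter> H a) = k - 2"
        using c pw[of i a] ge[of i] i a(1) by auto
      then have "H i - H a = E - H a" using s cEa fin by (intro card_subset_eq) auto
      then show ?thesis using * by blast
    qed
    \<comment> \<open>All other blocks contain \<open>E - H a\<close>, so their traces on
      \<open>H a\<close> satisfy the intersection bound with \<open>k - 2\<close> in place of
      \<open>k\<close>. Then \<open>sum_binomial_le\<close> with \<open>j = s = 1\<close> counts
      them, because a trace has \<open>k - 2\<close> elements and contributes
      \<open>(k - 3) choose (k - 3)\<close>.\<close>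
    have cnt: "card (I - {a}) \<le> (card E - 4) choose (k - 3)"
    proof -
      have "(\<Sum>i\<in>I-{a}. (card (H i \<inter> H a) - 1) choose (k - 2 - 1)) \<le> (card (H a) - 1 - 1) choose (k - 2 - 1)"
      proof (rule sum_binomial_le)
        show "card (H i \<inter> H a) + 1 \<le> card (H a)" if "i \<in> I - {a}" for i
          using other[OF that] ge[OF a(1)] 3 by simp
        show "card (H i \<inter> H a \<inter> (H i' \<inter> H a)) + 2 \<le> k - 2"
          if "i \<in> I - {a}" "i' \<in> I - {a}" "i \<noteq> i'" for i i'
        proof -
          have "H i \<inter> H i' = (H i \<inter> H a \<inter> (H i' \<inter> H a)) \<union> (E - H a)"
            using other[OF that(1)] other[OF that(2)] sub[of i] that by blast
          then have "card (H i \<inter> H i') = card (H i \<inter> H a \<inter> (H i' \<inter> H a)) + 2"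
            using cEa fin finH[of i] that by (simp add: card_Un_disjoint Int_assoc disjoint_iff)
          then show ?thesis using pw[of i i'] that by simp
        qed
      qed (use fin finH a 3 in auto)
      moreover have "(card (H i \<inter> H a) - 1) choose (k - 2 - 1) = 1" if "i \<in> I - {a}" for i
        using other[OF that] by simp
      moreover have "card (H a) - 1 - 1 = card E - 4" "k - 2 - 1 = k - 3" using a by auto
      ultimately show ?thesis by simp
    qed
    have kE: "k + 2 \<le> card E" using ge[OF a(1)] a by simp
    \<comment> \<open>Absorption turns the count into a multiple of
      \<open>(card E - 4) choose (k - 2)\<close>. Adding the second term of \<open>H a\<close>
      itself gives the factor \<open>k - 1\<close>, which \<open>K\<close> dominates.\<close>
    have "(k - 2) * ((card E - 4) choose (k - 2)) = (card E - 4 - (k - 3)) * ((card E - 4) choose (k - 3))"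
    proof -
      have "k - 2 = Suc (k - 3)" using 3 by simp
      then show ?thesis by (metis binomial_absorption binomial_absorb_comp mult.commute)
    qed
    moreover have "card E - 4 - (k - 3) \<ge> 1" using kE 3 by simp
    ultimately have cnt': "card (I - {a}) \<le> (k - 2) * ((card E - 4) choose (k - 2))"
      using cnt mult_le_mono1[of 1 "card E - 4 - (k - 3)" "(card E - 4) choose (k - 3)"] by linarith
    have "(\<Sum>i\<in>I. K * ((card (H i) - 2) choose (k - 1)) + ((card (H i) - 2) choose (k - 2)))
       = K * ((card E - 4) choose (k - 1)) + ((card E - 4) choose (k - 2)) + card (I - {a})"
    proof -
      have "(\<Sum>i\<in>I-{a}. K * ((card (H i) - 2) choose (k - 1)) + ((card (H i) - 2) choose (k - 2)))
          = (\<Sum>i\<in>I-{a}. 1)"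
      proof (rule sum.cong)
        fix i assume "i \<in> I - {a}"
        then have "card (H i) = k" using other by blast
        moreover have "(k - 2) choose (k - 1) = 0" using 3 by (intro binomial_eq_0) simp
        ultimately show "K * ((card (H i) - 2) choose (k - 1)) + ((card (H i) - 2) choose (k - 2)) = 1"
          by simp
      qed simp
      moreover have "card (H a) - 2 = card E - 4" using a by simp
      ultimately show ?thesis using a(1) fin by (simp add: sum.remove)
    qed
    also have "\<dots> \<le> K * ((card E - 4) choose (k - 1)) + (k - 1) * ((card E - 4) choose (k - 2))"
    proof -
      have "k - 1 = Suc (k - 2)" using 3 by simp
      then show ?thesis using cnt' by simp
    qed
    also have "\<dots> \<le> K * ((card E - 4) choose (k - 1)) + K * ((card E - 4) choose (k - 2))"
      using less.prems(5) by simp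
    also have "\<dots> = K * ((card E - 3) choose (k - 1))"
    proof -
      have "card E - 3 = Suc (card E - 4)" "k - 1 = Suc (k - 2)" using kE 3 by auto
      then show ?thesis by (simp add: algebra_simps)
    qed
    finally show ?thesis .
  next
    case 4
    then obtain a where "a \<in> I" by blast
    then have big: "card E \<ge> 6" using 4(2,3) ge[of a] by fastforce
    then have "card E > 0" by simp
    then obtain e where e: "e \<in> E" by fastforce
    let ?I = "{i\<in>I. e \<in> H i}" and ?E = "E - {e}" and ?H = "\<lambda>i. H i - {e}"
    \<comment> \<open>Deleting \<open>e\<close> can shrink a block to \<open>k - 1\<close> elements,
      which violates the size hypothesis of the induction. As \<open>k \<ge> 3\<close>, such a block
      contributes 0 and may be dropped.\<close>
    let ?J = "{i\<in>I. k \<le> card (?H i)}"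
    let ?T = "\<lambda>h k. K * ((h - 2) choose (k - 1)) + ((h - 2) choose (k - 2))"
    have cE: "card ?E = card E - 1" using e fin by simp
    have cH: "card (?H i) = (if e \<in> H i then card (H i) - 1 else card (H i))" if "i \<in> I" for i
      by simp
    have le': "card (?H i) + 2 \<le> card ?E" if "i \<in> I" for i
      using 4(3) that cE by (auto simp: cH[OF that])
    have del: "(\<Sum>i\<in>?J. ?T (card (?H i)) k) \<le> K * ((card ?E - 3) choose (k - 1))"
    proof (rule less.hyps)
      show "card (?H i \<inter> ?H i') + 2 \<le> k" if "i \<in> ?J" "i' \<in> ?J" "i \<noteq> i'" for i i'
      proof -
        have "card (?H i \<inter> ?H i') \<le> card (H i \<inter> H i')"
          using finH that by (intro card_mono) auto
        then show ?thesis using pw[of i i'] that by simp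
      qed
      show "card ?E < card E" using cE \<open>card E > 0\<close> by simp
      show "card (?H i) + 2 \<le> card ?E" if "i \<in> ?J" for i using le' that by blast
    qed (use fin sub less.prems(3-5) in auto)
    have del': "(\<Sum>i\<in>I. ?T (card (?H i)) k) = (\<Sum>i\<in>?J. ?T (card (?H i)) k)"
    proof (rule sum.mono_neutral_right)
      show "\<forall>i\<in>I - ?J. ?T (card (?H i)) k = 0"
        using 4(2) by (auto simp: binomial_eq_0)
    qed (use fin in auto)
    have con: "(\<Sum>i\<in>?I. ?T (card (?H i)) (k - 1)) \<le> K * ((card ?E - 3) choose (k - 1 - 1))"
    proof (rule less.hyps)
      show "card (?H i \<inter> ?H i') + 2 \<le> k - 1" if "i \<in> ?I" "i' \<in> ?I" "i \<noteq> i'" for i i'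
      proof -
        have "?H i \<inter> ?H i' = (H i \<inter> H i') - {e}" by auto
        moreover have "card (H i \<inter> H i') > 0" using that finH[of i] by (auto simp: card_gt_0_iff)
        ultimately have "card (?H i \<inter> ?H i') + 1 = card (H i \<inter> H i')" using that by simp
        then show ?thesis using pw[of i i'] that by simp
      qed
      show "card ?E < card E" using cE \<open>card E > 0\<close> by simp
      show "card (?H i) + 2 \<le> card ?E" if "i \<in> ?I" for i using le' that by blast
      show "k - 1 \<le> card (?H i)" if "i \<in> ?I" for i using ge[of i] cH[of i] that by auto
    qed (use fin sub less.prems(3-5) 4 in auto)
    have step: "?T (card (H i)) k = ?T (card (?H i)) k + (if e \<in> H i then ?T (card (?H i)) (k - 1) else 0)"
      if "i \<in> I" for i
    proof (cases "e \<in> H i")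
      case True
      have "card (H i) - 2 = Suc (card (?H i) - 2)" using cH[OF that] ge[OF that] True 4(2) by auto
      moreover have "k - 1 = Suc (k - 2)" "k - 2 = Suc (k - 3)" "k - 1 - 1 = k - 2" "k - 1 - 2 = k - 3"
        using 4 by auto
      ultimately show ?thesis using True by (simp add: algebra_simps)
    next
      case False
      then show ?thesis by simp
    qed
    have "(\<Sum>i\<in>I. ?T (card (H i)) k) = (\<Sum>i\<in>I. ?T (card (?H i)) k + (if e \<in> H i then ?T (card (?H i)) (k - 1) else 0))"
      using step by (rule sum.cong[OF refl])
    also have "\<dots> = (\<Sum>i\<in>I. ?T (card (?H i)) k) + (\<Sum>i\<in>?I. ?T (card (?H i)) (k - 1))"
      unfolding sum.distrib[of "\<lambda>i. ?T (card (?H i)) k"] using fin by (simp add: sum.If_cases Int_def)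
    also have "\<dots> \<le> K * ((card ?E - 3) choose (k - 1)) + K * ((card ?E - 3) choose (k - 1 - 1))"
      using del del' con by linarith
    also have "\<dots> = K * ((card E - 3) choose (k - 1))"
    proof -
      have "card E - 3 = Suc (card ?E - 3)" using cE big by simp
      moreover have "k - 1 = Suc (k - 1 - 1)" using 4 by simp
      ultimately show ?thesis by (metis add.commute binomial_Suc_Suc distrib_left)
    qed
    finally show ?thesis .
  qed
qed

text \<open>The coefficient of \<open>t\<^sup>i\<close> in \<open>g(U\<^sub>k\<^sub>,\<^sub>n)\<close> for \<open>1 \<le> k < n\<close>.\<close>

definition uniform_coeff :: "nat \<Rightarrow> nat \<Rightarrow> nat \<Rightarrow> nat" where
  "uniform_coeff k n i = (if i = 0 then 0 else ((k - 1) choose (i - 1)) * ((n - i - 1) choose (k - 1)))"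

lemma uniform_coeff_eq_0: "k \<ge> 1 \<Longrightarrow> i > k \<Longrightarrow> uniform_coeff k n i = 0"
  by (simp add: uniform_coeff_def binomial_eq_0)

text \<open>Pascal's rule twice: for the factor with top entry \<open>k - 1\<close> it merges the
  first and the third term, whose other factors agree; for the factor with top entry
  \<open>n - i - 1\<close> it then merges the result with the second term.\<close>

lemma uniform_coeff_recursion:
  assumes "k \<ge> 2" "n \<ge> k + 2" "i \<ge> 1"
  shows "uniform_coeff k n i =
    uniform_coeff (k - 1) (n - 1) i + uniform_coeff k (n - 1) i + uniform_coeff (k - 1) (n - 2) (i - 1)"
proof (cases "i > k")
  case True
  then show ?thesis using assms by (simp add: uniform_coeff_eq_0)
next
  case False
  obtain l where l: "k = l + 2" using assms by (metis add.commute le_Suc_ex)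
  obtain j where j: "i = Suc j" using assms by (cases i) auto
  show ?thesis
  proof (cases "n - i - 1")
    case 0
    then show ?thesis using False assms l j by (auto simp: uniform_coeff_def)
  next
    case (Suc m)
    then have n: "n = m + i + 2" by simp
    show ?thesis unfolding uniform_coeff_def l n j
      by (cases j) (simp_all add: algebra_simps)
  qed
qed

text \<open>For \<open>i = 1\<close> the second summand is 0 and \<open>sum_binomial_le\<close>
  applies with \<open>j = s = 1\<close>. For \<open>i \<ge> 3\<close> the smaller factor
  \<open>(k - 2) choose (i - 2)\<close> is enlarged to \<open>(k - 1) choose (i - 1)\<close>,
  Pascal's rule joins the two summands, and \<open>sum_binomial_le\<close> applies with
  \<open>j = i - 1\<close> and \<open>s = 2\<close>. For \<open>i = 2\<close> this choice violates
  \<open>s \<le> j\<close>, hence \<open>sum_binomial_pair_le\<close>; its condition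
  \<open>K \<ge> 2\<close> excludes \<open>k = 2\<close>, which is settled by counting.\<close>

lemma sum_uniform_coeff_le:
  fixes H :: "'i \<Rightarrow> 'a set"
  assumes "finite E" "finite I" "k \<ge> 2"
    and sub: "\<And>j. j \<in> I \<Longrightarrow> H j \<subseteq> E" and le: "\<And>j. j \<in> I \<Longrightarrow> card (H j) + 2 \<le> card E"
    and ge: "\<And>j. j \<in> I \<Longrightarrow> k \<le> card (H j)"
    and pw: "\<And>j j'. j \<in> I \<Longrightarrow> j' \<in> I \<Longrightarrow> j \<noteq> j' \<Longrightarrow> card (H j \<inter> H j') + 2 \<le> k"
    and two: "\<And>j j'. k = 2 \<Longrightarrow> j \<in> I \<Longrightarrow> j' \<in> I \<Longrightarrow> H j \<union> H j' \<noteq> E"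
    and "i \<ge> 1"
  shows "(\<Sum>j\<in>I. uniform_coeff k (card (H j) + 1) i + uniform_coeff (k - 1) (card (H j)) (i - 1))
          \<le> uniform_coeff k (card E) i"
proof -
  let ?n = "card E"
  have nondeg: "(\<Sum>j\<in>I. (card (H j) - i) choose (k - 1)) \<le> (?n - i - 1) choose (k - 1)"
    by (rule sum_binomial_le) (use assms(1-3) sub le pw \<open>i \<ge> 1\<close> in \<open>fastforce+\<close>)
  consider "i > k" | "i = 1" | "i = 2" "k = 2" | "i = 2" "k \<ge> 3" | "3 \<le> i" "i \<le> k"
    using assms(3) \<open>i \<ge> 1\<close> by linarith
  then show ?thesis
  proof cases
    case 1
    then show ?thesis using assms(3) by (simp add: uniform_coeff_eq_0)
  next
    case 2
    then show ?thesis using nondeg by (simp add: uniform_coeff_def)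
  next
    case 3
    have finH: "finite (H j)" if "j \<in> I" for j
      using sub[OF that] assms(1) finite_subset by blast
    have disj: "H j \<inter> H j' = {}" if "j \<in> I" "j' \<in> I" "j \<noteq> j'" for j j'
      using pw[OF that] finH that 3 by simp
    have tot: "(\<Sum>j\<in>I. card (H j)) = card (\<Union>j\<in>I. H j)"
      using disj assms(2) finH by (intro card_UN_disjoint[symmetric]) auto
    have UE: "(\<Union>j\<in>I. H j) \<subseteq> E" using sub by blast
    have tot': "card (\<Union>j\<in>I. H j) \<le> ?n" using assms(1) UE by (rule card_mono)
    have "(\<Sum>j\<in>I. card (H j) - 2 + 1) + card I = (\<Sum>j\<in>I. card (H j))"
    proof -
      have "(\<Sum>j\<in>I. card (H j) - 2 + 1) + (\<Sum>j\<in>I. 1) = (\<Sum>j\<in>I. card (H j))"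
        unfolding sum.distrib[symmetric]
      proof (rule sum.cong)
        fix j assume "j \<in> I"
        then show "card (H j) - 2 + 1 + 1 = card (H j)" using ge[of j] 3 by simp
      qed simp
      then show ?thesis by simp
    qed
    \<comment> \<open>One block misses two points of \<open>E\<close>, two blocks miss at least one
      by \<open>two\<close>, and for three or more blocks the number of blocks itself makes up for
      the 3.\<close>
    moreover have "(\<Sum>j\<in>I. card (H j)) + 3 \<le> ?n + card I" if I0: "I \<noteq> {}"
    proof -
      consider "card I = 1" | "card I = 2" | "card I \<ge> 3"
        proof -
        have "card I > 0" using I0 assms(2) by (simp add: card_gt_0_iff)
        then have "card I = 1 \<or> card I = 2 \<or> card I \<ge> 3" by linarith
        then show ?thesis using that by blast
      qed
      then show ?thesis
      proof cases
        case 1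
        then obtain a where a: "I = {a}" by (metis card_1_singletonE)
        then show ?thesis using le[of a] by simp
      next
        case 2
        then obtain a b where ab: "I = {a, b}" "a \<noteq> b" by (meson card_2_iff)
        then have "(\<Union>j\<in>I. H j) \<subset> E" using two[of a b] 3 UE by auto
        then have "card (\<Union>j\<in>I. H j) < ?n" using assms(1) by (intro psubset_card_mono)
        then show ?thesis using tot 2 by simp
      next
        case 3
        then show ?thesis using tot tot' by simp
      qed
    qed
    ultimately have "(\<Sum>j\<in>I. card (H j) - 2 + 1) \<le> ?n - 3" by (cases "I = {}") auto
    then show ?thesis using 3 by (simp add: uniform_coeff_def numeral_2_eq_2)
  next
    case 4
    have "(\<Sum>j\<in>I. (k - 1) * ((card (H j) - 2) choose (k - 1)) + ((card (H j) - 2) choose (k - 2)))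
        \<le> (k - 1) * ((?n - 3) choose (k - 1))"
      by (rule sum_binomial_pair_le) (use assms(1-3) sub le ge pw 4 in auto)
    moreover have "uniform_coeff k (h + 1) 2 = (k - 1) * ((h - 2) choose (k - 1))" for h
      by (simp add: uniform_coeff_def numeral_2_eq_2)
    moreover have "uniform_coeff (k - 1) h 1 = (h - 2) choose (k - 2)" for h
      by (simp add: uniform_coeff_def numeral_2_eq_2)
    moreover have "uniform_coeff k h 2 = (k - 1) * ((h - 3) choose (k - 1))" for h
      by (simp add: uniform_coeff_def numeral_3_eq_3)
    ultimately show ?thesis using 4 by simp
  next
    case 5
    let ?A = "(k - 1) choose (i - 1)"
    have AB: "(k - 2) choose (i - 2) \<le> ?A"
    proof -
      have "k - 1 = Suc (k - 2)" "i - 1 = Suc (i - 2)" using 5 by auto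
      then show ?thesis by simp
    qed
    have "(\<Sum>j\<in>I. uniform_coeff k (card (H j) + 1) i + uniform_coeff (k - 1) (card (H j)) (i - 1))
       \<le> (\<Sum>j\<in>I. ?A * ((card (H j) - (i - 1)) choose (k - 1)))"
    proof (rule sum_mono)
      fix j assume "j \<in> I"
      then have "card (H j) \<ge> i" using ge[of j] 5 by simp
      then have "card (H j) - (i - 1) = Suc (card (H j) - i)" "k - 1 = Suc (k - 2)" using 5 by auto
      then have "(card (H j) - (i - 1)) choose (k - 1)
          = ((card (H j) - i) choose (k - 1)) + ((card (H j) - i) choose (k - 2))" by simp
      moreover have "uniform_coeff k (card (H j) + 1) i = ?A * ((card (H j) - i) choose (k - 1))"
        using 5 by (simp add: uniform_coeff_def)
      moreover have "uniform_coeff (k - 1) (card (H j)) (i - 1)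
          = ((k - 2) choose (i - 2)) * ((card (H j) - i) choose (k - 2))"
        using 5 by (simp add: uniform_coeff_def numeral_2_eq_2)
      ultimately show "uniform_coeff k (card (H j) + 1) i + uniform_coeff (k - 1) (card (H j)) (i - 1)
          \<le> ?A * ((card (H j) - (i - 1)) choose (k - 1))"
        using AB by (simp add: distrib_left)
    qed
    also have "\<dots> = ?A * (\<Sum>j\<in>I. (card (H j) - (i - 1)) choose (k - 1))"
      by (simp add: sum_distrib_left)
    also have "\<dots> \<le> ?A * ((?n - (i - 1) - 2) choose (k - 1))"
      by (rule mult_le_mono2, rule sum_binomial_le) (use assms(1-3) sub le ge pw 5 in auto)
    also have "?n - (i - 1) - 2 = ?n - i - 1" using 5 by simp
    finally show ?thesis using 5 by (simp add: uniform_coeff_def)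
  qed
qed

section \<open>Cutting polytopes by a hyperplane\<close>

text \<open>Minimising \<open>\<Sum>s. \<lambda> s * \<bar>f s - c\<bar>\<close> over all convex representations of \<open>x\<close> rules out a pair of
  points on different sides, since an exchange would decrease the sum. The minimum exists by
  compactness of the hull of the lifted points \<open>(s, \<bar>f s - c\<bar>)\<close>.\<close>

lemma one_sided_convex_combination:
  fixes f :: "'v::real_normed_vector \<Rightarrow> real"
  assumes fin: "finite S" and "linear f"
    and exch: "\<And>s s'. s \<in> S \<Longrightarrow> s' \<in> S \<Longrightarrow> f s' < c \<Longrightarrow> c < f s \<Longrightarrow>
      \<exists>t\<in>S. \<exists>t'\<in>S. s + s' = t + t' \<and> f s' < f t \<and> f t < f s"
    and x: "x \<in> convex hull S"
  obtains l where "\<And>s. s \<in> S \<Longrightarrow> 0 \<le> l s" "sum l S = 1" "(\<Sum>s\<in>S. l s *\<^sub>R s) = x"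
    "\<And>s s'. s \<in> S \<Longrightarrow> s' \<in> S \<Longrightarrow> l s > 0 \<Longrightarrow> l s' > 0 \<Longrightarrow> f s' < c \<Longrightarrow> f s \<le> c"
proof -
  define L where "L s = (s, \<bar>f s - c\<bar>)" for s
  have inj: "inj_on L S" by (auto simp: L_def inj_on_def)
  have mem: "z \<in> convex hull (L ` S) \<longleftrightarrow>
      (\<exists>l. (\<forall>s\<in>S. 0 \<le> l s) \<and> sum l S = 1 \<and> (\<Sum>s\<in>S. l s *\<^sub>R L s) = z)" for z
  proof
    assume "z \<in> convex hull (L ` S)"
    then obtain u where u: "\<forall>y\<in>L ` S. 0 \<le> u y" "sum u (L ` S) = 1" "(\<Sum>y\<in>L ` S. u y *\<^sub>R y) = z"
      using fin by (auto simp: convex_hull_finite)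
    then show "\<exists>l. (\<forall>s\<in>S. 0 \<le> l s) \<and> sum l S = 1 \<and> (\<Sum>s\<in>S. l s *\<^sub>R L s) = z"
      using inj by (intro exI[of _ "u \<circ> L"]) (simp add: sum.reindex o_def)
  next
    assume "\<exists>l. (\<forall>s\<in>S. 0 \<le> l s) \<and> sum l S = 1 \<and> (\<Sum>s\<in>S. l s *\<^sub>R L s) = z"
    then obtain l where l: "\<forall>s\<in>S. 0 \<le> l s" "sum l S = 1" "(\<Sum>s\<in>S. l s *\<^sub>R L s) = z" by blast
    have "(\<Sum>s\<in>S. l s *\<^sub>R L s) \<in> convex hull (L ` S)"
      using l fin by (intro convex_sum) (auto intro: hull_inc)
    then show "z \<in> convex hull (L ` S)" using l by simp
  qed
  define K where "K = convex hull (L ` S) \<inter> ({x} \<times> UNIV)"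
  obtain l0 where l0: "\<forall>s\<in>S. 0 \<le> l0 s" "sum l0 S = 1" "(\<Sum>s\<in>S. l0 s *\<^sub>R s) = x"
    using x fin by (auto simp: convex_hull_finite)
  have "(\<Sum>s\<in>S. l0 s *\<^sub>R L s) \<in> convex hull (L ` S)" unfolding mem using l0 by blast
  moreover have "fst (\<Sum>s\<in>S. l0 s *\<^sub>R L s) = x" using l0 by (simp add: fst_sum L_def)
  ultimately have "(\<Sum>s\<in>S. l0 s *\<^sub>R L s) \<in> K" by (simp add: K_def mem_Times_iff)
  then have ne: "K \<noteq> {}" by blast
  have "compact K"
    unfolding K_def using fin by (intro compact_Int_closed finite_imp_compact_convex_hull) (auto intro: closed_Times)
  from continuous_attains_inf[OF this ne continuous_on_snd[OF continuous_on_id]]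
  obtain z where z: "z \<in> K" and min: "\<And>w. w \<in> K \<Longrightarrow> snd z \<le> snd w"
    by blast
  obtain l where l: "\<forall>s\<in>S. 0 \<le> l s" "sum l S = 1" "(\<Sum>s\<in>S. l s *\<^sub>R L s) = z"
    using z mem unfolding K_def by blast
  show ?thesis
  proof
    show "(\<Sum>s\<in>S. l s *\<^sub>R s) = x"
      using l(3) z by (auto simp: fst_sum L_def K_def mem_Times_iff)
    show "f s \<le> c" if s: "s \<in> S" "s' \<in> S" "l s > 0" "l s' > 0" "f s' < c" for s s'
    proof (rule ccontr)
      assume "\<not> f s \<le> c"
      then obtain t t' where t: "t \<in> S" "t' \<in> S" "s + s' = t + t'" "f s' < f t" "f t < f s"
        using exch[of s s'] s by (meson not_le)
      have ne: "s \<noteq> s'" using s \<open>\<not> f s \<le> c\<close> by auto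
      define d where "d = min (l s) (l s')"
      have d: "d > 0" "d \<le> l s" "d \<le> l s'" using s by (auto simp: d_def)
      \<comment> \<open>The weight \<open>d\<close> moves from \<open>s\<close> and
        \<open>s'\<close> to \<open>t\<close> and \<open>t'\<close>. Separate corrections are added
        up because \<open>t = t'\<close> is possible.\<close>
      define m where "m r = l r - (if r = s then d else 0) - (if r = s' then d else 0)
         + (if r = t then d else 0) + (if r = t' then d else 0)" for r
      have "0 \<le> m r" if "r \<in> S" for r
        using d l(1) that ne by (auto simp: m_def)
      moreover have "sum m S = 1"
        using l(2) s t fin by (simp add: m_def sum.distrib sum_subtractf)
      moreover have e: "(\<Sum>r\<in>S. m r *\<^sub>R L r) = z - d *\<^sub>R L s - d *\<^sub>R L s' + d *\<^sub>R L t + d *\<^sub>R L t'"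
      proof -
        have D: "(\<Sum>r\<in>S. (if r = a then d else 0) *\<^sub>R L r) = d *\<^sub>R L a" if "a \<in> S" for a
          using that fin by (simp add: if_distrib[of "\<lambda>k. k *\<^sub>R _"] cong: if_cong)
        show ?thesis
          using l(3) s t by (simp add: m_def scaleR_add_left scaleR_diff_left sum.distrib sum_subtractf D)
      qed
      ultimately have hull: "z - d *\<^sub>R L s - d *\<^sub>R L s' + d *\<^sub>R L t + d *\<^sub>R L t' \<in> convex hull (L ` S)"
        using mem by blast
      have "fst (z - d *\<^sub>R L s - d *\<^sub>R L s' + d *\<^sub>R L t + d *\<^sub>R L t') = x + d *\<^sub>R (t + t') - d *\<^sub>R (s + s')"
        using z by (simp add: L_def K_def mem_Times_iff algebra_simps)
      then have "fst (z - d *\<^sub>R L s - d *\<^sub>R L s' + d *\<^sub>R L t + d *\<^sub>R L t') = x" using t(3) by simp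
      then have "snd z \<le> snd (z - d *\<^sub>R L s - d *\<^sub>R L s' + d *\<^sub>R L t + d *\<^sub>R L t')"
        using hull by (intro min) (simp add: K_def mem_Times_iff)
      then have "d * (\<bar>f s - c\<bar> + \<bar>f s' - c\<bar>) \<le> d * (\<bar>f t - c\<bar> + \<bar>f t' - c\<bar>)"
        by (simp add: L_def algebra_simps)
      then have "\<bar>f s - c\<bar> + \<bar>f s' - c\<bar> \<le> \<bar>f t - c\<bar> + \<bar>f t' - c\<bar>" using d(1) by simp
      moreover have "f s + f s' = f t + f t'" using t(3) \<open>linear f\<close> by (metis linear_add)
      ultimately show False using t(4,5) s(5) \<open>\<not> f s \<le> c\<close> by linarith
    qed
  qed (use l in auto)
qed

text \<open>In general the hyperplane would cut edges and create new vertices. With the exchange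
  property, \<open>x\<close> has a representation whose weights do not lie strictly on both sides of
  \<open>c\<close>. A positive weight beyond \<open>c\<close> would then force all weighted points
  to satisfy \<open>f s \<ge> c\<close>, and averaging would give \<open>f x > c\<close>.\<close>

lemma convex_hull_Int_halfspace_le:
  fixes f :: "'v::real_normed_vector \<Rightarrow> real"
  assumes fin: "finite S" and lin: "linear f"
    and exch: "\<And>s s'. s \<in> S \<Longrightarrow> s' \<in> S \<Longrightarrow> f s' < c \<Longrightarrow> c < f s \<Longrightarrow>
      \<exists>t\<in>S. \<exists>t'\<in>S. s + s' = t + t' \<and> f s' < f t \<and> f t < f s"
  shows "convex hull S \<inter> {x. f x \<le> c} = convex hull (S \<inter> {x. f x \<le> c})"
proof
  have "convex {x. f x \<le> c}"
    using convex_linear_vimage[OF lin, of "{..c}"] by (simp add: vimage_def)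
  then show "convex hull (S \<inter> {x. f x \<le> c}) \<subseteq> convex hull S \<inter> {x. f x \<le> c}"
    by (metis hull_minimal hull_mono Int_lower1 Int_lower2 le_inf_iff)
  show "convex hull S \<inter> {x. f x \<le> c} \<subseteq> convex hull (S \<inter> {x. f x \<le> c})"
  proof
    fix x assume x: "x \<in> convex hull S \<inter> {x. f x \<le> c}"
    obtain l where l: "\<And>s. s \<in> S \<Longrightarrow> 0 \<le> l s" "sum l S = 1" "(\<Sum>s\<in>S. l s *\<^sub>R s) = x"
      and sep: "\<And>s s'. s \<in> S \<Longrightarrow> s' \<in> S \<Longrightarrow> l s > 0 \<Longrightarrow> l s' > 0 \<Longrightarrow> f s' < c \<Longrightarrow> f s \<le> c"
      using one_sided_convex_combination[where x = x, OF fin lin exch] x by blast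
    have zero: "l r = 0" if r': "r \<in> S" "\<not> f r \<le> c" for r
    proof (rule ccontr)
      have r: "r \<in> S" "c < f r" using r' by auto
      assume "l r \<noteq> 0"
      then have pos: "l r > 0" using l(1)[OF r(1)] by simp
      have ge: "l s * c \<le> l s * f s" if "s \<in> S" for s
        using sep[OF r(1) that pos] r l(1)[OF that] by (cases "l s = 0") (force intro: mult_left_mono)+
      have "c = (\<Sum>s\<in>S. l s * c)" using l(2) by (simp add: sum_distrib_right[symmetric])
      also have "\<dots> < (\<Sum>s\<in>S. l s * f s)"
        using ge r(2) mult_strict_left_mono[OF r(2) pos]
        by (intro sum_strict_mono_ex1[OF fin] ballI bexI[OF _ r(1)])
      also have "\<dots> = f x" unfolding l(3)[symmetric]
        using lin by (simp add: linear_sum linear_cmul)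
      finally show False using x by simp
    qed
    let ?T = "S \<inter> {x. f x \<le> c}"
    have "sum l ?T = 1" using l(2) zero fin by (subst sum.mono_neutral_left[of S]) auto
    moreover have "(\<Sum>s\<in>?T. l s *\<^sub>R s) = x"
      using l(3) zero fin by (subst sum.mono_neutral_left[of S]) auto
    ultimately show "x \<in> convex hull ?T"
      using l(1) fin by (auto simp: convex_hull_finite)
  qed
qed

lemma convex_hull_Int_halfspace_ge:
  fixes f :: "'v::real_normed_vector \<Rightarrow> real"
  assumes fin: "finite S" and lin: "linear f"
    and exch: "\<And>s s'. s \<in> S \<Longrightarrow> s' \<in> S \<Longrightarrow> f s' < c \<Longrightarrow> c < f s \<Longrightarrow>
      \<exists>t\<in>S. \<exists>t'\<in>S. s + s' = t + t' \<and> f s' < f t \<and> f t < f s"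
  shows "convex hull S \<inter> {x. c \<le> f x} = convex hull (S \<inter> {x. c \<le> f x})"
proof -
  have "convex hull S \<inter> {x. - f x \<le> - c} = convex hull (S \<inter> {x. - f x \<le> - c})"
  proof (rule convex_hull_Int_halfspace_le[OF fin])
    show "linear (\<lambda>x. - f x)" using lin by (rule linear_compose_neg)
    show "\<exists>t\<in>S. \<exists>t'\<in>S. s + s' = t + t' \<and> - f s' < - f t \<and> - f t < - f s"
      if "s \<in> S" "s' \<in> S" "- f s' < - c" "- c < - f s" for s s'
      using exch[of s' s] that by (simp add: add.commute) blast
  qed
  then show ?thesis by simp
qed

text \<open>Every point \<open>s\<close> with positive weight in a representation of a point
  \<open>x\<close> of the face lies in the face itself: unless the case is degenerate,
  \<open>x\<close> is inside the open segment from \<open>s\<close> to the normalised remainder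
  \<open>y\<close> of the combination.\<close>

lemma face_of_convex_hull_finite:
  fixes S :: "'v::real_vector set"
  assumes fin: "finite S" and F: "F face_of convex hull S"
  shows "F = convex hull (S \<inter> F)"
proof
  show "convex hull (S \<inter> F) \<subseteq> F"
    using F by (intro hull_minimal) (auto simp: face_of_imp_convex)
  show "F \<subseteq> convex hull (S \<inter> F)"
  proof
    fix x assume "x \<in> F"
    then have "x \<in> convex hull S" using F face_of_imp_subset by blast
    then obtain l where l: "\<forall>s\<in>S. 0 \<le> l s" "sum l S = 1" "(\<Sum>s\<in>S. l s *\<^sub>R s) = x"
      using fin by (auto simp: convex_hull_finite)
    have inF: "s \<in> F" if s: "s \<in> S" "l s > 0" for s
    proof -
      have rest: "sum l (S - {s}) = 1 - l s" using l(2) s fin by (simp add: sum_diff1)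
      have xs: "x = l s *\<^sub>R s + (\<Sum>r\<in>S - {s}. l r *\<^sub>R r)"
        using l(3) s fin by (simp add: sum.remove)
      have nn: "\<forall>r\<in>S - {s}. 0 \<le> l r" using l(1) by blast
      show ?thesis
      proof (cases "l s = 1")
        case True
        then have "\<forall>r\<in>S - {s}. l r = 0"
          using rest nn fin sum_nonneg_eq_0_iff[of "S - {s}" l] by auto
        then show ?thesis using xs True \<open>x \<in> F\<close> by simp
      next
        case False
        have "sum l (S - {s}) \<ge> 0" using nn by (intro sum_nonneg) blast
        then have lt: "l s < 1" using rest False by simp
        define y where "y = (\<Sum>r\<in>S - {s}. (l r / (1 - l s)) *\<^sub>R r)"
        have "y \<in> convex hull S" unfolding y_def
        proof (rule convex_sum)
          show "(\<Sum>r\<in>S - {s}. l r / (1 - l s)) = 1"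
            using rest lt by (simp add: sum_divide_distrib[symmetric])
        qed (use fin nn lt in \<open>auto intro: hull_inc\<close>)
        moreover have "x = l s *\<^sub>R s + (1 - l s) *\<^sub>R y"
          using xs lt by (simp add: y_def scaleR_sum_right)
        ultimately show ?thesis
        proof (cases "s = y")
          case True
          then have "x = s" using \<open>x = l s *\<^sub>R s + (1 - l s) *\<^sub>R y\<close>
            by (metis scaleR_left_distrib add.commute diff_add_cancel scaleR_one)
          then show ?thesis using \<open>x \<in> F\<close> by simp
        next
          case False
          have "x \<in> open_segment y s"
            unfolding in_segment using False \<open>x = l s *\<^sub>R s + (1 - l s) *\<^sub>R y\<close> s lt
            by (auto intro!: exI[of _ "l s"])
          then show ?thesis
            using face_ofD[OF F] \<open>y \<in> convex hull S\<close> \<open>x \<in> F\<close> s(1) by (meson hull_inc)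
        qed
      qed
    qed
    have zero: "l s = 0" if "s \<in> S" "s \<notin> F" for s
      using inF[of s] l(1) that by force
    have "sum l (S \<inter> F) = 1" using l(2) zero fin by (subst sum.mono_neutral_left[of S]) auto
    moreover have "(\<Sum>s\<in>S \<inter> F. l s *\<^sub>R s) = x"
      using l(3) zero fin by (subst sum.mono_neutral_left[of S]) auto
    ultimately show "x \<in> convex hull (S \<inter> F)"
      using l(1) fin by (auto simp: convex_hull_finite)
  qed
qed

lemma linear_convex_combination:
  assumes "linear f"
  shows "f ((1 - u) *\<^sub>R a + u *\<^sub>R b) = (1 - u) * f a + u * (f b :: real)"
  using assms by (simp add: linear_add linear_cmul)

lemma hyperplane_face_of_le:
  fixes f :: "'v::real_vector \<Rightarrow> real"
  assumes "convex P" "linear f"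
  shows "P \<inter> {x. f x = c} face_of P \<inter> {x. f x \<le> c}"
  unfolding face_of_def
proof (intro conjI ballI impI)
  have "convex {x. f x = c}"
    using convex_linear_vimage[OF assms(2), of "{c}"] by (simp add: vimage_def)
  then show "convex (P \<inter> {x. f x = c})" using assms(1) by (intro convex_Int)
  fix a b x assume *: "a \<in> P \<inter> {x. f x \<le> c}" "b \<in> P \<inter> {x. f x \<le> c}" "x \<in> P \<inter> {x. f x = c}"
    "x \<in> open_segment a b"
  then obtain u where u: "0 < u" "u < 1" "x = (1 - u) *\<^sub>R a + u *\<^sub>R b" by (auto simp: in_segment)
  then have e: "(1 - u) * f a + u * f b = c"
    using * linear_convex_combination[OF assms(2)] by simp
  have "(1 - u) * (c - f a) + u * (c - f b) = 0" using e by (simp add: algebra_simps)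
  moreover have "(1 - u) * (c - f a) \<ge> 0" "u * (c - f b) \<ge> 0" using * u by auto
  ultimately have "(1 - u) * (c - f a) = 0" "u * (c - f b) = 0" by linarith+
  then show "a \<in> P \<inter> {x. f x = c}" "b \<in> P \<inter> {x. f x = c}" using * u by auto
qed auto

lemma rel_interior_prolong:
  fixes P :: "'v::real_normed_vector set"
  assumes "q \<in> rel_interior P" "p \<in> P"
  obtains e where "e > 0" "\<And>d. 0 \<le> d \<Longrightarrow> d \<le> e \<Longrightarrow> q + d *\<^sub>R (q - p) \<in> P"
proof -
  obtain e where e: "q \<in> P" "e > 0" "ball q e \<inter> affine hull P \<subseteq> P"
    using assms(1) by (auto simp: mem_rel_interior_ball)
  show ?thesis
  proof
    show "e / (norm (q - p) + 1) > 0" using e by (simp add: add_nonneg_pos)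
    fix d assume d: "0 \<le> d" "d \<le> e / (norm (q - p) + 1)"
    have "q + d *\<^sub>R (q - p) = (1 + d) *\<^sub>R q + (- d) *\<^sub>R p" by (simp add: algebra_simps)
    also have "\<dots> \<in> affine hull P"
      using e(1) assms(2) by (intro mem_affine) (auto simp: affine_affine_hull intro: hull_inc)
    finally have "q + d *\<^sub>R (q - p) \<in> affine hull P" .
    moreover have "d * norm (q - p) < e"
    proof -
      have "d * (norm (q - p) + 1) \<le> e" using d by (simp add: pos_le_divide_eq add_nonneg_pos)
      moreover have "d = 0 \<Longrightarrow> ?thesis" using e by simp
      ultimately show ?thesis using d(1) by (cases "d = 0") (auto simp: algebra_simps)
    qed
    then have "q + d *\<^sub>R (q - p) \<in> ball q e" using d by (simp add: dist_norm)
    ultimately show "q + d *\<^sub>R (q - p) \<in> P" using e by blast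
  qed
qed

text \<open>This bounds the number of interior cells of a cut. If the segment from \<open>p\<close>
  to \<open>q\<close> can be prolonged within the half beyond \<open>q\<close>, then
  \<open>p\<close> lies in \<open>Q\<close>. For \<open>f q < c\<close> this applies to every
  \<open>p\<close> of the half. For \<open>f q = c\<close> it applies to the section, so
  \<open>Q\<close> contains the section; if \<open>Q\<close> also has a point \<open>q'\<close> off
  the hyperplane, prolongations that leave the half are pulled back towards
  \<open>q'\<close>.\<close>

lemma face_of_halfspace_meets_rel_interior:
  fixes f :: "'v::real_normed_vector \<Rightarrow> real"
  assumes P: "convex P" and lin: "linear f" and Q: "Q face_of P \<inter> {x. f x \<le> c}"
    and q: "q \<in> Q" "q \<in> rel_interior P"
  shows "Q = P \<inter> {x. f x \<le> c} \<or> Q = P \<inter> {x. f x = c}"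
proof -
  let ?A = "P \<inter> {x. f x \<le> c}"
  have QA: "Q \<subseteq> ?A" using Q by (rule face_of_imp_subset)
  have move: "f (q + d *\<^sub>R (q - p)) = f q + d * (f q - f p)" for d p
    using lin by (simp add: linear_add linear_cmul linear_diff)
  have step: "p \<in> Q" if p: "p \<in> ?A" and d: "d > 0" "q + d *\<^sub>R (q - p) \<in> ?A" for p d
  proof (cases "p = q")
    case False
    have "q = (1 - 1 / (1 + d)) *\<^sub>R p + (1 / (1 + d)) *\<^sub>R (q + d *\<^sub>R (q - p))"
    proof -
      have "1 / (1 + d) * d = 1 - 1 / (1 + d)" using d by (simp add: field_simps)
      moreover have "(1 - 1 / (1 + d)) *\<^sub>R p + (1 / (1 + d)) *\<^sub>R (q + d *\<^sub>R (q - p))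
        = (1 - 1 / (1 + d)) *\<^sub>R p + (1 / (1 + d)) *\<^sub>R q + (1 / (1 + d) * d) *\<^sub>R (q - p)"
        by (simp only: scaleR_add_right scaleR_scaleR add.assoc)
      ultimately have "(1 - 1 / (1 + d)) *\<^sub>R p + (1 / (1 + d)) *\<^sub>R (q + d *\<^sub>R (q - p))
        = (1 - 1 / (1 + d)) *\<^sub>R p + (1 / (1 + d)) *\<^sub>R q + (1 - 1 / (1 + d)) *\<^sub>R (q - p)"
        by simp
      also have "\<dots> = q" by (simp add: scaleR_diff_right scaleR_diff_left)
      finally show ?thesis by simp
    qed
    moreover have "p \<noteq> q + d *\<^sub>R (q - p)"
    proof
      assume "p = q + d *\<^sub>R (q - p)"
      then have "(1 + d) *\<^sub>R (q - p) = 0" by (simp add: algebra_simps)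
      then show False using d False by simp
    qed
    ultimately have "q \<in> open_segment p (q + d *\<^sub>R (q - p))"
      using d unfolding in_segment by (auto intro!: exI[of _ "1 / (1 + d)"])
    then show ?thesis using face_ofD[OF Q] p d q(1) by blast
  qed (use q in simp)
  show ?thesis
  proof (cases "f q < c")
    case True
    have "p \<in> Q" if p: "p \<in> ?A" for p
    proof -
      obtain e where e: "e > 0" "\<And>d. 0 \<le> d \<Longrightarrow> d \<le> e \<Longrightarrow> q + d *\<^sub>R (q - p) \<in> P"
        using rel_interior_prolong[OF q(2)] p by blast
      define d where "d = min e ((c - f q) / (\<bar>f q - f p\<bar> + 1))"
      have d: "d > 0" using e True by (auto simp: d_def)
      have "d * (f q - f p) \<le> d * (\<bar>f q - f p\<bar> + 1)" using d by (intro mult_left_mono) auto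
      also have "\<dots> \<le> c - f q" by (simp add: d_def pos_le_divide_eq[symmetric] add_nonneg_pos)
      finally have "f (q + d *\<^sub>R (q - p)) \<le> c" by (simp add: move)
      then show ?thesis using step[OF p d] e(2)[of d] d by (simp add: d_def)
    qed
    then show ?thesis using QA by blast
  next
    case False
    then have fq: "f q = c" using q(1) QA by force
    have sub: "P \<inter> {x. f x = c} \<subseteq> Q"
    proof
      fix p assume p: "p \<in> P \<inter> {x. f x = c}"
      obtain e where e: "e > 0" "\<And>d. 0 \<le> d \<Longrightarrow> d \<le> e \<Longrightarrow> q + d *\<^sub>R (q - p) \<in> P"
        using rel_interior_prolong[OF q(2)] p by blast
      have "f (q + e *\<^sub>R (q - p)) = c" using move[of e p] p fq by simp
      then show "p \<in> Q" using step[of p e] e p by simp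
    qed
    show ?thesis
    proof (cases "Q \<subseteq> {x. f x = c}")
      case True
      then show ?thesis using sub QA by blast
    next
      case False
      then obtain q' where q': "q' \<in> Q" "f q' < c" using QA by force
      have "p \<in> Q" if p: "p \<in> ?A" for p
      proof -
        obtain e where e: "e > 0" "\<And>d. 0 \<le> d \<Longrightarrow> d \<le> e \<Longrightarrow> q + d *\<^sub>R (q - p) \<in> P"
          using rel_interior_prolong[OF q(2)] p by blast
        define z where "z = q + e *\<^sub>R (q - p)"
        have zP: "z \<in> P" using e by (simp add: z_def)
        \<comment> \<open>Small enough to pull \<open>z\<close> back to \<open>f w \<le> c\<close>.
          The absolute value and the 1 keep the denominator positive and \<open>s\<close> below
          1.\<close>
        define s where "s = (c - f q') / (c - f q' + \<bar>f z - c\<bar> + 1)"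
        have s: "0 < s" "s < 1" using q' by (auto simp: s_def divide_less_eq_1)
        define w where "w = (1 - s) *\<^sub>R q' + s *\<^sub>R z"
        have "w \<in> P" using zP q' QA P s unfolding w_def by (intro convexD) auto
        moreover have "f w \<le> c"
        proof -
          have den: "c - f q' + \<bar>f z - c\<bar> + 1 > 0" using q' by simp
          have "s * (f z - f q') \<le> s * (c - f q' + \<bar>f z - c\<bar> + 1)" using s by (intro mult_left_mono) auto
          also have "\<dots> = c - f q'" using den by (simp add: s_def)
          finally show ?thesis
            unfolding w_def linear_convex_combination[OF lin] by (simp add: algebra_simps)
        qed
        ultimately have wA: "w \<in> ?A" by simp
        text \<open>The segments from \<open>p\<close> to \<open>w\<close> and from \<open>q\<close> to \<open>q'\<close> cross in the point \<open>m\<close>.\<close>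
        define a where "a = (1 - s) / (1 + s * e)"
        define m where "m = (1 - a) *\<^sub>R q + a *\<^sub>R q'"
        have se: "1 + s * e > 0" using s e by (simp add: add_pos_pos)
        have "s * e > 0" using s e by simp
        then have a: "0 < a" "a < 1" using s se by (auto simp: a_def divide_less_eq_1)
        have "m \<in> Q" unfolding m_def using q(1) q'(1) a Q by (intro convexD) (auto simp: face_of_imp_convex)
        \<comment> \<open>In \<open>(1 - b) *\<^sub>R p + b *\<^sub>R w\<close> the point
          \<open>p\<close> has the coefficient 1 - b - bse, which has to vanish; then
          \<open>q'\<close> has the coefficient b(1 - s), which is \<open>a\<close>.\<close>
        define b where "b = 1 / (1 + s * e)"
        have b: "0 < b" "b < 1" using se s e by (auto simp: b_def)
        have "m = (1 - b) *\<^sub>R p + b *\<^sub>R w"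
        proof -
          have c1: "b * (1 - s) = a" "b * (s * (1 + e)) = 1 - a" "b * (s * e) = 1 - b"
            using se by (auto simp: a_def b_def field_simps)
          have "(1 - b) *\<^sub>R p + b *\<^sub>R w
            = (1 - b) *\<^sub>R p + (b * (1 - s)) *\<^sub>R q' + (b * (s * (1 + e))) *\<^sub>R q - (b * (s * e)) *\<^sub>R p"
            by (simp add: w_def z_def algebra_simps)
          then show ?thesis unfolding c1 m_def by (simp add: algebra_simps)
        qed
        show ?thesis
        proof (cases "p = w")
          case True
          then have "m = p" using \<open>m = (1 - b) *\<^sub>R p + b *\<^sub>R w\<close> by (simp add: algebra_simps)
          then show ?thesis using \<open>m \<in> Q\<close> by simp
        next
          case False
          then have "m \<in> open_segment p w"
            using b \<open>m = (1 - b) *\<^sub>R p + b *\<^sub>R w\<close> unfolding in_segment by blast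
          then show ?thesis using face_ofD[OF Q] p wA \<open>m \<in> Q\<close> by blast
        qed
      qed
      then show ?thesis using QA by blast
    qed
  qed
qed

text \<open>Writing the halves as hulls of finite sets gives finiteness and makes all faces
  polytopes. Faces of different halves fit together because the common section is a face of both
  halves.\<close>

lemma halfspace_subdivision:
  fixes f :: "'v::real_vector \<Rightarrow> real"
  assumes P: "convex P" and lin: "linear f" and fin: "finite S" "finite T"
    and S: "P \<inter> {x. f x \<le> c} = convex hull S" and T: "P \<inter> {x. c \<le> f x} = convex hull T"
  shows "polytope_subdivision
    {Q. Q \<noteq> {} \<and> (Q face_of P \<inter> {x. f x \<le> c} \<or> Q face_of P \<inter> {x. c \<le> f x})} P"
  (is "polytope_subdivision ?C P")
proof -
  let ?A = "P \<inter> {x. f x \<le> c}" and ?B = "P \<inter> {x. c \<le> f x}"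
  have *: "\<exists>U\<subseteq>S. Q = convex hull U" if "Q face_of ?A" for Q
    using face_of_convex_hull_finite[OF fin(1), of Q] that S by auto
  have **: "\<exists>U\<subseteq>T. Q = convex hull U" if "Q face_of ?B" for Q
    using face_of_convex_hull_finite[OF fin(2), of Q] that T by auto
  have 1: "finite ?C"
  proof (rule finite_subset)
    show "?C \<subseteq> (\<lambda>U. convex hull U) ` (Pow S \<union> Pow T)" using * ** by blast
  qed (use fin in simp)
  have 2: "polytope Q \<and> Q \<noteq> {}" if "Q \<in> ?C" for Q
    unfolding polytope_def using that * ** fin by (metis (mono_tags, lifting) finite_subset mem_Collect_eq)
  have 3: "F \<in> ?C" if "Q \<in> ?C" "F face_of Q" "F \<noteq> {}" for Q F
    using that face_of_trans by blast
  have H: "?A \<inter> ?B = P \<inter> {x. f x = c}" by auto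
  have AB1: "?A \<inter> ?B face_of ?A" unfolding H using P lin by (rule hyperplane_face_of_le)
  have AB2: "?A \<inter> ?B face_of ?B"
    using hyperplane_face_of_le[OF P linear_compose_neg[OF lin], of "-c"] unfolding H by simp
  have 4: "Q \<inter> R face_of Q \<and> Q \<inter> R face_of R" if "Q \<in> ?C" "R \<in> ?C" for Q R
  proof -
    have same: "Q \<inter> R face_of Q \<and> Q \<inter> R face_of R" if "Q face_of X" "R face_of X" for X
      using that by (meson face_of_Int face_of_face inf_le1 inf_le2)
    have mixed: "U \<inter> V face_of U \<and> U \<inter> V face_of V" if "U face_of ?A" "V face_of ?B" for U V
      using face_of_Int_subface[OF AB1 AB2 that] .
    show ?thesis
    proof -
      have "Q face_of ?A \<or> Q face_of ?B" "R face_of ?A \<or> R face_of ?B" using that by simp_all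
      then show ?thesis using same mixed[of Q R] mixed[of R Q] unfolding Int_commute[of R Q] by metis
    qed
  qed
  have 5: "\<Union>?C = P"
  proof
    show "\<Union>?C \<subseteq> P" using face_of_imp_subset by blast
    have sub: "X = {} \<or> X \<in> D \<Longrightarrow> X \<subseteq> \<Union>D" for X :: "'v set" and D by blast
    have un: "X \<subseteq> Z \<Longrightarrow> Y \<subseteq> Z \<Longrightarrow> W \<subseteq> X \<union> Y \<Longrightarrow> W \<subseteq> Z" for W X Y Z :: "'v set"
      by blast
    have "?A face_of ?A" "?B face_of ?B" using S T by (simp_all add: face_of_refl)
    then have e: "?A = {} \<or> ?A \<in> ?C" "?B = {} \<or> ?B \<in> ?C" by simp_all
    have "P \<subseteq> ?A \<union> ?B" by (simp add: subset_iff linear)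
    then show "P \<subseteq> \<Union>?C" by (rule un[OF sub[OF e(1)] sub[OF e(2)]])
  qed
  show ?thesis
    unfolding polytope_subdivision_def
  proof (intro conjI ballI allI impI)
    fix Q R assume QR: "Q \<in> ?C" "R \<in> ?C"
    show "polytope Q" "Q \<noteq> {}" "Q \<inter> R face_of Q" "Q \<inter> R face_of R"
      using 2[OF QR(1)] 4[OF QR] by simp_all
  next
    fix Q F assume "Q \<in> ?C" "F face_of Q \<and> F \<noteq> {}"
    then show "F \<in> ?C" using 3[of Q F] by simp
  qed (rule 1, rule 5)
qed

section \<open>Matroids and the faces of their base polytopes\<close>

context
  fixes M :: "'a matroid"
  assumes M: "is_matroid M"
begin

lemma finite_ground: "finite (ground M)"
  using M by (simp add: is_matroid_def)

lemma indep_subset_ground: "I \<in> indep M \<Longrightarrow> I \<subseteq> ground M"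
  using M by (simp add: is_matroid_def)

lemma finite_indep: "I \<in> indep M \<Longrightarrow> finite I"
  using finite_ground indep_subset_ground finite_subset by blast

lemma indep_empty: "{} \<in> indep M"
  using M by (simp add: is_matroid_def)

lemma indep_mono: "I \<in> indep M \<Longrightarrow> J \<subseteq> I \<Longrightarrow> J \<in> indep M"
  using M unfolding is_matroid_def by blast

lemma indep_augment:
  "I \<in> indep M \<Longrightarrow> J \<in> indep M \<Longrightarrow> card I < card J \<Longrightarrow> \<exists>x\<in>J - I. insert x I \<in> indep M"
  using M unfolding is_matroid_def by blast

lemma finite_indep_family: "finite (indep M)"
  using finite_ground indep_subset_ground by (intro finite_subset[of "indep M" "Pow (ground M)"]) auto

lemma card_indep_le_rank: "I \<in> indep M \<Longrightarrow> card I \<le> matroid_rank M"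
  unfolding matroid_rank_def using finite_indep_family by (intro Max_ge) auto

lemma indep_extend:
  assumes "I \<in> indep M" "J \<in> indep M" "card I \<le> card J"
  shows "\<exists>K\<in>indep M. I \<subseteq> K \<and> K \<subseteq> I \<union> J \<and> card K = card J"
  using assms(1,3)
proof (induction "card J - card I" arbitrary: I)
  case 0
  then show ?case by (intro bexI[of _ I]) auto
next
  case (Suc n)
  then have lt: "card I < card J" by simp
  then obtain x where x: "x \<in> J - I" "insert x I \<in> indep M"
    using indep_augment Suc.prems assms(2) by blast
  then have c: "card (insert x I) = Suc (card I)" using finite_indep Suc.prems by simp
  have "\<exists>K\<in>indep M. insert x I \<subseteq> K \<and> K \<subseteq> insert x I \<union> J \<and> card K = card J"
    using Suc.hyps(2) x(2) lt c by (intro Suc.hyps(1)) auto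
  then show ?case using x(1) by blast
qed

lemma bases_iff: "B \<in> bases M \<longleftrightarrow> B \<in> indep M \<and> card B = matroid_rank M"
proof
  assume B: "B \<in> bases M"
  have "matroid_rank M \<in> card ` indep M"
    unfolding matroid_rank_def using finite_indep_family indep_empty by (intro Max_in) auto
  then obtain I where I: "I \<in> indep M" "card I = matroid_rank M" by auto
  have "\<not> card B < card I"
  proof
    assume "card B < card I"
    then obtain x where "x \<in> I - B" "insert x B \<in> indep M"
      using indep_augment[of B I] B I by (auto simp: bases_def)
    then show False using B by (auto simp: bases_def)
  qed
  then show "B \<in> indep M \<and> card B = matroid_rank M"
    using B I card_indep_le_rank[of B] by (auto simp: bases_def)
next
  assume B: "B \<in> indep M \<and> card B = matroid_rank M"
  have "I = B" if I: "I \<in> indep M" "B \<subseteq> I" for I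
    using card_indep_le_rank[OF I(1)] B I card_seteq[OF finite_indep[OF I(1)] I(2)] by simp
  then show "B \<in> bases M" using B by (auto simp: bases_def)
qed

lemma finite_bases: "finite (bases M)"
  using finite_indep_family by (rule finite_subset[rotated]) (auto simp: bases_def)

lemma finite_base: "B \<in> bases M \<Longrightarrow> finite B"
  by (simp add: bases_iff finite_indep)

lemma base_subset_ground: "B \<in> bases M \<Longrightarrow> B \<subseteq> ground M"
  by (simp add: bases_iff indep_subset_ground)

lemma bases_nonempty: "bases M \<noteq> {}"
proof -
  have "matroid_rank M \<in> card ` indep M"
    unfolding matroid_rank_def using finite_indep_family indep_empty by (intro Max_in) auto
  then show ?thesis by (auto simp: bases_iff)
qed

lemma indep_iff_subset_base: "I \<in> indep M \<longleftrightarrow> (\<exists>B\<in>bases M. I \<subseteq> B)"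
proof
  assume I: "I \<in> indep M"
  obtain B where B: "B \<in> bases M" using bases_nonempty by blast
  then have "B \<in> indep M" "card I \<le> card B"
    using card_indep_le_rank[OF I] by (auto simp: bases_iff)
  from indep_extend[OF I this] obtain K where "K \<in> indep M" "I \<subseteq> K" "card K = card B" by blast
  then show "\<exists>B\<in>bases M. I \<subseteq> B" using B by (auto simp: bases_iff)
qed (auto simp: bases_iff intro: indep_mono)

text \<open>\<open>Y\<close> consists of the elements of \<open>B2\<close> that \<open>x\<close> can
  replace, that is, the fundamental circuit of \<open>x\<close> over \<open>B2\<close> without
  \<open>x\<close>. If none of them could replace \<open>x\<close> in \<open>B1\<close>, then
  \<open>(B1 - {x}) \<union> Y\<close> would have rank \<open>?k - 1\<close>. Extending
  \<open>Y\<close> within this set and then from \<open>B1\<close> shows that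
  \<open>insert x Y\<close> is independent. Completing it from \<open>B2\<close> to a base leaves
  out a single \<open>y\<close> of \<open>B2\<close>; this \<open>y\<close> is then in
  \<open>Y\<close>, a contradiction.\<close>

lemma symmetric_exchange:
  assumes B: "B1 \<in> bases M" "B2 \<in> bases M" and x: "x \<in> B1 - B2"
  obtains y where "y \<in> B2 - B1" "insert y (B1 - {x}) \<in> bases M" "insert x (B2 - {y}) \<in> bases M"
proof -
  let ?k = "matroid_rank M"
  have B1: "B1 \<in> indep M" "card B1 = ?k" "finite B1" and B2: "B2 \<in> indep M" "card B2 = ?k" "finite B2"
    using B by (auto simp: bases_iff finite_indep)
  define Y where "Y = {y\<in>B2. insert x (B2 - {y}) \<in> indep M}"
  have pos: "?k > 0" using x B1 by (metis DiffD1 card_gt_0_iff empty_iff)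
  have c1: "card (B1 - {x}) = ?k - 1" using x B1 by simp
  have "\<exists>y\<in>Y. insert y (B1 - {x}) \<in> indep M \<and> y \<notin> B1 - {x}"
  proof (rule ccontr)
    assume no: "\<not> ?thesis"
    have Yi: "Y \<in> indep M" by (rule indep_mono[OF B2(1)]) (auto simp: Y_def)
    have small: "card J \<le> ?k - 1" if J: "J \<in> indep M" "J \<subseteq> (B1 - {x}) \<union> Y" for J
    proof (rule ccontr)
      assume "\<not> card J \<le> ?k - 1"
      then obtain y where y: "y \<in> J - (B1 - {x})" "insert y (B1 - {x}) \<in> indep M"
        using indep_augment[OF indep_mono[OF B1(1), of "B1 - {x}"] J(1)] c1 pos by auto
      then show False using no J by blast
    qed
    have "card Y \<le> card (B1 - {x})" using small[OF Yi] c1 by simp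
    then obtain J where J: "J \<in> indep M" "Y \<subseteq> J" "J \<subseteq> Y \<union> (B1 - {x})" "card J = card (B1 - {x})"
      using indep_extend[OF Yi indep_mono[OF B1(1), of "B1 - {x}"]] by blast
    obtain z where z: "z \<in> B1 - J" "insert z J \<in> indep M"
      using indep_augment[OF J(1) B1(1)] J(4) c1 B1(2) pos by auto
    have "z = x"
    proof (rule ccontr)
      assume "z \<noteq> x"
      then have "insert z J \<subseteq> (B1 - {x}) \<union> Y" using z J by blast
      from small[OF z(2) this] show False using J(1,4) c1 pos z(1) by (simp add: finite_indep)
    qed
    then have xY: "insert x Y \<in> indep M" using z J by (auto intro: indep_mono[of "insert z J"])
    then obtain K where K: "K \<in> indep M" "insert x Y \<subseteq> K" "K \<subseteq> insert x Y \<union> B2" "card K = ?k"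
      using indep_extend[OF xY B2(1)] card_indep_le_rank[OF xY] B2(2) by auto
    have "\<not> B2 \<subseteq> K"
    proof
      assume "B2 \<subseteq> K"
      then have "insert x B2 \<subseteq> K" using K by blast
      then have "card (insert x B2) \<le> ?k" using K finite_indep card_mono by metis
      then show False using x B2 by simp
    qed
    then obtain y where y: "y \<in> B2" "y \<notin> K" by blast
    have "K \<subseteq> insert x (B2 - {y})" using K y by (auto simp: Y_def)
    moreover have "card (insert x (B2 - {y})) = ?k" using B2 x y pos by simp
    ultimately have "K = insert x (B2 - {y})" using K(4) B2 by (intro card_subset_eq) auto
    then have "y \<in> Y" using K y by (simp add: Y_def)
    then show False using K y by blast
  qed
  then obtain y where y: "y \<in> Y" "insert y (B1 - {x}) \<in> indep M" "y \<notin> B1 - {x}" by blast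
  then have "y \<in> B2 - B1" using x by (auto simp: Y_def)
  moreover have "insert y (B1 - {x}) \<in> bases M"
    using y c1 B1 pos by (simp add: bases_iff)
  moreover have "insert x (B2 - {y}) \<in> bases M"
    using y x B2 pos by (simp add: bases_iff Y_def)
  ultimately show ?thesis using that by blast
qed

end

text \<open>For augmentation, take a base \<open>B1\<close> containing \<open>I\<close> whose
  intersection with \<open>B2\<close> is largest. Exchange forces
  \<open>B1 \<subseteq> I \<union> B2\<close>. If no element of \<open>J\<close> extended
  \<open>I\<close>, then \<open>B1 - I\<close> would lie in \<open>B2 - J\<close>, against
  \<open>card I < card J\<close>.\<close>

lemma is_matroid_of_bases:
  assumes fin: "finite E" and sub: "\<And>B. B \<in> \<B> \<Longrightarrow> B \<subseteq> E" and ne: "\<B> \<noteq> {}"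
    and card: "\<And>B. B \<in> \<B> \<Longrightarrow> card B = k"
    and exch: "\<And>B1 B2 x. B1 \<in> \<B> \<Longrightarrow> B2 \<in> \<B> \<Longrightarrow> x \<in> B1 - B2 \<Longrightarrow> \<exists>y\<in>B2 - B1. insert y (B1 - {x}) \<in> \<B>"
  shows "is_matroid (Matroid E {I. \<exists>B\<in>\<B>. I \<subseteq> B})" (is "is_matroid ?M")
    and "bases (Matroid E {I. \<exists>B\<in>\<B>. I \<subseteq> B}) = \<B>"
proof -
  have finB: "finite B" if "B \<in> \<B>" for B using sub[OF that] fin finite_subset by blast
  have fin\<B>: "finite \<B>" using sub fin by (intro finite_subset[of \<B> "Pow E"]) auto
  have aug: "\<exists>x\<in>J - I. \<exists>B\<in>\<B>. insert x I \<subseteq> B"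
    if I: "I \<subseteq> B0" "B0 \<in> \<B>" and J: "J \<subseteq> B2" "B2 \<in> \<B>" and lt: "card I < card J" for I J B0 B2
  proof (rule ccontr)
    assume no: "\<not> ?thesis"
    let ?S = "{B\<in>\<B>. I \<subseteq> B}"
    have "finite ?S" "?S \<noteq> {}" using fin\<B> I by auto
    then have "Max ((\<lambda>B. card (B \<inter> B2)) ` ?S) \<in> (\<lambda>B. card (B \<inter> B2)) ` ?S"
      by (intro Max_in) auto
    then obtain B1 where "B1 \<in> ?S" "card (B1 \<inter> B2) = Max ((\<lambda>B. card (B \<inter> B2)) ` ?S)" by force
    then have B1: "B1 \<in> ?S" "\<And>B. B \<in> ?S \<Longrightarrow> card (B \<inter> B2) \<le> card (B1 \<inter> B2)"
      using \<open>finite ?S\<close> by auto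
    have JB: "J \<inter> B1 \<subseteq> I" using no B1(1) by blast
    have "B1 \<subseteq> I \<union> B2"
    proof (rule ccontr)
      assume "\<not> B1 \<subseteq> I \<union> B2"
      then obtain b where b: "b \<in> B1" "b \<notin> I" "b \<notin> B2" by blast
      then obtain y where y: "y \<in> B2 - B1" "insert y (B1 - {b}) \<in> \<B>" using exch[of B1 B2 b] B1 J by blast
      have "insert y (B1 - {b}) \<inter> B2 = insert y (B1 \<inter> B2)" using b y by blast
      then have "card (insert y (B1 - {b}) \<inter> B2) = Suc (card (B1 \<inter> B2))" using y finB B1 by simp
      then show False using B1(2)[of "insert y (B1 - {b})"] y b B1(1) by auto
    qed
    then have "B1 - I \<subseteq> B2 - J" using JB by blast
    then have "card (B1 - I) \<le> card (B2 - J)" using finB J by (intro card_mono) auto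
    moreover have "card (B1 - I) = k - card I" "card (B2 - J) = k - card J"
      using B1 J finB card by (auto simp: card_Diff_subset finite_subset)
    moreover have "card J \<le> k" using card_mono[OF finB[OF J(2)] J(1)] card[OF J(2)] by simp
    ultimately show False using lt by simp
  qed
  show "is_matroid ?M"
    unfolding is_matroid_def
  proof (intro conjI ballI allI impI)
    fix I J assume "I \<in> indep ?M" "J \<in> indep ?M" "card I < card J"
    then show "\<exists>x\<in>J - I. insert x I \<in> indep ?M" using aug by fastforce
  next
    fix I J assume "I \<in> indep ?M" "J \<subseteq> I"
    then show "J \<in> indep ?M" by (simp, meson order_trans)
  qed (use fin sub ne in auto)
  have eq: "B = B'" if "B \<in> \<B>" "B' \<in> \<B>" "B \<subseteq> B'" for B B'
    using that card finB by (metis card_subset_eq)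
  show "bases ?M = \<B>"
  proof
    show "bases ?M \<subseteq> \<B>" by (auto simp: bases_def)
    show "\<B> \<subseteq> bases ?M"
    proof
      fix B assume B: "B \<in> \<B>"
      have "I = B" if "B' \<in> \<B>" "I \<subseteq> B'" "B \<subseteq> I" for I B'
        using eq[OF B that(1)] that by blast
      then show "B \<in> bases ?M" using B by (auto simp: bases_def)
    qed
  qed
qed

lemma matroid_eqI:
  assumes "is_matroid M" "is_matroid N" "ground M = ground N" "bases M = bases N"
  shows "M = N"
proof -
  have "indep M = indep N" using assms by (auto simp: indep_iff_subset_base)
  then show ?thesis using assms(3) by (simp add: matroid.expand)
qed

section \<open>Indicator vectors and linear functionals on them\<close>

lemma lookup_scaleR [simp]: "Poly_Mapping.lookup (c *\<^sub>R x) i = c *\<^sub>R Poly_Mapping.lookup x i"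
proof -
  have "finite {i. c *\<^sub>R Poly_Mapping.lookup x i \<noteq> 0}"
    by (rule finite_subset[of _ "Poly_Mapping.keys x"]) (auto simp: in_keys_iff)
  then show ?thesis by (simp add: scaleR_poly_mapping_def Abs_poly_mapping_inverse)
qed

lemma lookup_indicator_vector:
  "finite B \<Longrightarrow> Poly_Mapping.lookup (indicator_vector B) i = (if i \<in> B then 1 else 0)"
  by (simp add: indicator_vector_def lookup_sum lookup_single when_def)

definition coord_sum :: "'a set \<Rightarrow> ('a \<Rightarrow>\<^sub>0 real) \<Rightarrow> real" where
  "coord_sum A x = (\<Sum>i\<in>A. Poly_Mapping.lookup x i)"

lemma linear_coord_sum: "linear (coord_sum A)"
  by (rule linearI) (simp_all add: coord_sum_def lookup_add sum.distrib sum_distrib_left)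

lemma coord_sum_indicator_vector:
  "finite A \<Longrightarrow> finite B \<Longrightarrow> coord_sum A (indicator_vector B) = card (A \<inter> B)"
  by (simp add: coord_sum_def lookup_indicator_vector sum.If_cases)

lemma indicator_vector_exchange:
  assumes "finite A" "finite B" "x \<in> A - B" "y \<in> B - A"
  shows "indicator_vector A + indicator_vector B
    = indicator_vector (insert y (A - {x})) + indicator_vector (insert x (B - {y}))"
  using assms by (intro poly_mapping_eqI) (auto simp: lookup_add lookup_indicator_vector)

text \<open>Vertices of the cube are in convex position: x(E - A) - x(A) has the value -|A| at the
  indicator vector of \<open>A\<close> and at least 1 - |A| at that of every other subset of
  \<open>E\<close>.\<close>

lemma indicator_vector_in_convex_hull:
  assumes "finite E" "\<And>B. B \<in> \<B> \<Longrightarrow> B \<subseteq> E" "A \<subseteq> E"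
    and "indicator_vector A \<in> convex hull (indicator_vector ` \<B>)"
  shows "A \<in> \<B>"
proof (rule ccontr)
  assume "A \<notin> \<B>"
  let ?f = "\<lambda>x. coord_sum (E - A) x - coord_sum A x"
  have finA: "finite A" and finB: "\<And>B. B \<in> \<B> \<Longrightarrow> finite B" using assms finite_subset by metis+
  have lin: "linear ?f" by (intro linear_compose_sub linear_coord_sum)
  have "convex {x. 1 - real (card A) \<le> ?f x}"
    using convex_linear_vimage[OF lin, of "{1 - real (card A)..}"] by (simp add: vimage_def)
  moreover have "indicator_vector B \<in> {x. 1 - real (card A) \<le> ?f x}" if B: "B \<in> \<B>" for B
  proof -
    have "card ((E - A) \<inter> B) + card A \<ge> 1 + card (A \<inter> B)"
    proof (cases "A \<subseteq> B")
      case True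
      then have "A \<noteq> B" using \<open>A \<notin> \<B>\<close> B by blast
      then have "(E - A) \<inter> B \<noteq> {}" using True assms(2)[OF B] by blast
      then have "card ((E - A) \<inter> B) > 0" using finB[OF B] by (simp add: card_gt_0_iff)
      then show ?thesis using card_mono[OF finA, of "A \<inter> B"] by simp
    next
      case False
      then have "A \<inter> B \<subset> A" by blast
      then show ?thesis using psubset_card_mono[OF finA, of "A \<inter> B"] by simp
    qed
    then have "1 + real (card (A \<inter> B)) \<le> real (card ((E - A) \<inter> B)) + real (card A)"
      by linarith
    then show ?thesis using finA finB[OF B] assms(1) by (simp add: coord_sum_indicator_vector)
  qed
  ultimately have "convex hull (indicator_vector ` \<B>) \<subseteq> {x. 1 - real (card A) \<le> ?f x}"
    by (intro hull_minimal) auto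
  then have "1 - real (card A) \<le> ?f (indicator_vector A)" using assms(4) by blast
  moreover have "(E - A) \<inter> A = {}" by blast
  ultimately show False using assms(1) finA by (simp add: coord_sum_indicator_vector)
qed

text \<open>Interior cells are indexed by matroids, while the geometry classifies polytopes;
  injectivity translates between the two.\<close>

lemma base_polytope_inject:
  assumes "is_matroid M" "is_matroid N" "ground M = ground N" "base_polytope M = base_polytope N"
  shows "M = N"
proof (rule matroid_eqI[OF assms(1-3)])
  have "bases M \<subseteq> bases N" if "is_matroid M" "is_matroid N" "ground M = ground N"
    "base_polytope M = base_polytope N" for M N :: "'a matroid"
  proof
    fix B assume B: "B \<in> bases M"
    then have "indicator_vector B \<in> convex hull (indicator_vector ` bases N)"
      using that(4) by (metis base_polytope_def hull_inc imageI)
    then show "B \<in> bases N"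
      using B that by (intro indicator_vector_in_convex_hull[of "ground N"])
        (auto dest: finite_ground base_subset_ground)
  qed
  from this[OF assms] this[OF assms(2,1) assms(3,4)[symmetric]] show "bases M = bases N" by blast
qed

text \<open>If two vertices of a face are exchanged symmetrically, the midpoint does not change, so the two
  new bases lie in the face as well.\<close>

lemma face_of_base_polytope:
  assumes M: "is_matroid M" and F: "F face_of base_polytope M" "F \<noteq> {}"
  obtains N where "is_matroid N" "ground N = ground M" "bases N = {B \<in> bases M. indicator_vector B \<in> F}"
    "base_polytope N = F"
proof -
  let ?B = "{B \<in> bases M. indicator_vector B \<in> F}"
  let ?N = "Matroid (ground M) {I. \<exists>B\<in>?B. I \<subseteq> B}"
  have eF: "F = convex hull (indicator_vector ` ?B)"
  proof -
    have "F = convex hull (indicator_vector ` bases M \<inter> F)"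
      using F finite_bases[OF M] by (intro face_of_convex_hull_finite) (auto simp: base_polytope_def)
    moreover have "indicator_vector ` bases M \<inter> F = indicator_vector ` ?B" by blast
    ultimately show ?thesis by simp
  qed
  have exch: "\<exists>y\<in>B2 - B1. insert y (B1 - {x}) \<in> ?B" if B: "B1 \<in> ?B" "B2 \<in> ?B" "x \<in> B1 - B2" for B1 B2 x
  proof -
    obtain y where y: "y \<in> B2 - B1" "insert y (B1 - {x}) \<in> bases M" "insert x (B2 - {y}) \<in> bases M"
      using symmetric_exchange[OF M, of B1 B2 x] B by blast
    have fin: "finite B1" "finite B2" using B finite_base[OF M] by auto
    let ?u = "indicator_vector (insert y (B1 - {x}))" and ?v = "indicator_vector (insert x (B2 - {y}))"
    have uv: "?u \<in> base_polytope M" "?v \<in> base_polytope M"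
      using y by (auto simp: base_polytope_def intro: hull_inc)
    have "indicator_vector B1 + indicator_vector B2 = ?u + ?v"
      using indicator_vector_exchange[OF fin B(3) y(1)] .
    then have mid: "midpoint ?u ?v = midpoint (indicator_vector B1) (indicator_vector B2)"
      by (simp add: midpoint_def)
    moreover have "midpoint (indicator_vector B1) (indicator_vector B2) \<in> F"
    proof -
      have "(1/2) *\<^sub>R indicator_vector B1 + (1/2) *\<^sub>R indicator_vector B2 \<in> F"
        using B F(1) by (intro convexD[OF face_of_imp_convex]) auto
      then show ?thesis by (simp add: midpoint_def scaleR_add_right)
    qed
    ultimately have "midpoint ?u ?v \<in> F" by simp
    then have "?u \<in> F"
    proof (cases "?u = ?v")
      case True
      then show ?thesis using \<open>midpoint ?u ?v \<in> F\<close> by simp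
    next
      case False
      then have "midpoint ?u ?v \<in> open_segment ?u ?v" by simp
      then show ?thesis using face_ofD[OF F(1)] uv \<open>midpoint ?u ?v \<in> F\<close> by blast
    qed
    then show ?thesis using y by blast
  qed
  have ne: "?B \<noteq> {}" using eF F(2) by (metis convex_hull_empty image_empty)
  have sub: "\<And>B. B \<in> ?B \<Longrightarrow> B \<subseteq> ground M" "\<And>B. B \<in> ?B \<Longrightarrow> card B = matroid_rank M"
    using M by (auto simp: bases_iff dest: base_subset_ground indep_subset_ground[OF M])
  note N = is_matroid_of_bases[OF finite_ground[OF M] sub(1) ne sub(2) exch]
  show ?thesis
  proof (rule that)
    show "is_matroid ?N" by (rule N(1))
    show b: "bases ?N = ?B" by (rule N(2))
    show "base_polytope ?N = F" unfolding base_polytope_def b using eF by simp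
  qed simp
qed

text \<open>The norm is the sum of the absolute values of the coordinates, so the functional is
  bounded with constant 1.\<close>

lemma continuous_on_coord_sum:
  assumes "finite A"
  shows "continuous_on UNIV (coord_sum A)"
proof -
  have "norm (coord_sum A x) \<le> norm x * 1" for x
  proof -
    have "norm (coord_sum A x) \<le> (\<Sum>i\<in>A. \<bar>Poly_Mapping.lookup x i\<bar>)"
      unfolding coord_sum_def real_norm_def by (rule sum_abs)
    also have "\<dots> \<le> (\<Sum>i\<in>A \<union> Poly_Mapping.keys x. \<bar>Poly_Mapping.lookup x i\<bar>)"
      using assms by (intro sum_mono2) auto
    also have "\<dots> = (\<Sum>i\<in>Poly_Mapping.keys x. \<bar>Poly_Mapping.lookup x i\<bar>)"
      using assms by (intro sum.mono_neutral_right) (auto simp: in_keys_iff)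
    also have "\<dots> = norm x * 1" by (simp add: norm_poly_mapping_def dist_poly_mapping_def)
    finally show ?thesis .
  qed
  then have "bounded_linear (coord_sum A)"
    using linear_coord_sum[of A] by (intro bounded_linear_intro[where K = 1]) (simp_all add: linear_add linear_cmul)
  then show ?thesis by (rule linear_continuous_on)
qed

section \<open>Hypersimplices\<close>

text \<open>Induction on the number of fractional coordinates: such a coordinate may be replaced by
  0 and by 1, and \<open>x\<close> lies on the segment between the two results.\<close>

lemma cube_subset_convex_hull:
  assumes "finite E" "Poly_Mapping.keys x \<subseteq> E"
    and "\<And>i. i \<in> E \<Longrightarrow> 0 \<le> Poly_Mapping.lookup x i \<and> Poly_Mapping.lookup x i \<le> 1"
  shows "x \<in> convex hull (indicator_vector ` Pow E)"
  using assms(2,3)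
proof (induction "card {i\<in>E. Poly_Mapping.lookup x i \<noteq> 0 \<and> Poly_Mapping.lookup x i \<noteq> 1}"
    arbitrary: x rule: less_induct)
  case less
  let ?F = "\<lambda>x. {i\<in>E. Poly_Mapping.lookup x i \<noteq> 0 \<and> Poly_Mapping.lookup x i \<noteq> 1}"
  show ?case
  proof (cases "?F x = {}")
    case True
    have "x = indicator_vector {i\<in>E. Poly_Mapping.lookup x i = 1}"
      using True less.prems(1) assms(1)
      by (intro poly_mapping_eqI) (auto simp: lookup_indicator_vector in_keys_iff)
    then show ?thesis by (auto intro!: hull_inc)
  next
    case False
    then obtain i where i: "i \<in> ?F x" by blast
    let ?t = "Poly_Mapping.lookup x i"
    let ?u = "\<lambda>v. Poly_Mapping.update i v x"
    have u: "?u v \<in> convex hull (indicator_vector ` Pow E)" if v: "v = 0 \<or> v = 1" for v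
    proof (rule less.hyps)
      have "?F (?u v) \<subseteq> ?F x - {i}" using v by (auto simp: lookup_update split: if_splits)
      then have "?F (?u v) \<subset> ?F x" using i by blast
      then show "card (?F (?u v)) < card (?F x)" using assms(1) by (intro psubset_card_mono) auto
      show "Poly_Mapping.keys (?u v) \<subseteq> E"
        using less.prems(1) i by (auto simp: in_keys_iff lookup_update split: if_splits)
      show "0 \<le> Poly_Mapping.lookup (?u v) j \<and> Poly_Mapping.lookup (?u v) j \<le> 1" if "j \<in> E" for j
        using less.prems(2)[OF that] v by (auto simp: lookup_update)
    qed
    have "x = (1 - ?t) *\<^sub>R ?u 0 + ?t *\<^sub>R ?u 1"
      by (intro poly_mapping_eqI, simp only: lookup_add lookup_scaleR lookup_update)
        (simp add: algebra_simps)
    also have "\<dots> \<in> convex hull (indicator_vector ` Pow E)"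
      using u less.prems(2)[of i] i by (intro convexD[OF convex_convex_hull]) auto
    finally show ?thesis .
  qed
qed

text \<open>The cube is cut by x(E) \<le> k and then by x(E) \<ge> k. For the first cut, an element
  of the larger set missing from the smaller one is moved there; for the second cut nothing lies
  beyond the hyperplane, so the exchange condition is vacuous.\<close>

lemma hypersimplex:
  assumes "finite E"
  shows "convex hull (indicator_vector ` {B. B \<subseteq> E \<and> card B = k}) =
    {x. Poly_Mapping.keys x \<subseteq> E \<and> (\<forall>i\<in>E. 0 \<le> Poly_Mapping.lookup x i \<and> Poly_Mapping.lookup x i \<le> 1)
      \<and> coord_sum E x = real k}" (is "?L = ?R")
proof
  have fin: "finite B" if "B \<subseteq> E" for B using that assms finite_subset by blast
  have "convex ?R"
    unfolding convex_alt
  proof (intro ballI allI impI)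
    fix x y and u :: real assume xy: "x \<in> ?R" "y \<in> ?R" "0 \<le> u \<and> u \<le> 1"
    let ?z = "(1 - u) *\<^sub>R x + u *\<^sub>R y"
    have "Poly_Mapping.lookup ?z i = 0" if "i \<notin> E" for i
    proof -
      have "i \<notin> Poly_Mapping.keys x" "i \<notin> Poly_Mapping.keys y" using xy that by auto
      then show ?thesis by (simp add: in_keys_iff lookup_add)
    qed
    then have "Poly_Mapping.keys ?z \<subseteq> E" by (auto simp: in_keys_iff)
    moreover have "0 \<le> Poly_Mapping.lookup ?z i \<and> Poly_Mapping.lookup ?z i \<le> 1" if "i \<in> E" for i
    proof -
      have *: "Poly_Mapping.lookup x i \<in> {0..1}" "Poly_Mapping.lookup y i \<in> {0..1}" using xy that by auto
      have "(1 - u) *\<^sub>R Poly_Mapping.lookup x i + u *\<^sub>R Poly_Mapping.lookup y i \<in> {0..1::real}"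
        using xy(3) by (intro convexD[OF _ *]) auto
      then show ?thesis by (simp add: lookup_add)
    qed
    moreover have "coord_sum E ?z = real k"
      unfolding linear_convex_combination[OF linear_coord_sum] using xy by (simp add: algebra_simps)
    ultimately show "?z \<in> ?R" by simp
  qed
  moreover have "indicator_vector ` {B. B \<subseteq> E \<and> card B = k} \<subseteq> ?R"
    using fin assms
    by (auto simp: lookup_indicator_vector in_keys_iff coord_sum_indicator_vector Int_absorb1 split: if_splits)
  ultimately show "?L \<subseteq> ?R" by (intro hull_minimal)
  let ?T = "indicator_vector ` Pow E" and ?f = "coord_sum E"
  have f: "?f (indicator_vector B) = real (card B)" if "B \<subseteq> E" for B
    using that fin assms by (simp add: coord_sum_indicator_vector Int_absorb1)
  have exch: "\<exists>t\<in>?T. \<exists>t'\<in>?T. s + s' = t + t' \<and> ?f s' < ?f t \<and> ?f t < ?f s"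
    if s: "s \<in> ?T" "s' \<in> ?T" "?f s' < real k" "real k < ?f s" for s s'
  proof -
    obtain B B' where B: "B \<subseteq> E" "s = indicator_vector B" "B' \<subseteq> E" "s' = indicator_vector B'"
      using s by auto
    then have c: "card B' < k" "k < card B" using s(3,4) f[OF B(1)] f[OF B(3)] by auto
    have "\<not> B \<subseteq> B'" using c card_mono[OF fin[OF B(3)], of B] by linarith
    then obtain x where x: "x \<in> B" "x \<notin> B'" by blast
    have "s + s' = indicator_vector (B - {x}) + indicator_vector (insert x B')"
      using B fin[of B] fin[of B'] x
      by (intro poly_mapping_eqI) (auto simp: lookup_add lookup_indicator_vector)
    moreover have "?f (indicator_vector (B - {x})) = real (card B) - 1"
      using f[of "B - {x}"] B x c fin[of B] by (auto simp: of_nat_diff)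
    moreover have "?f s' < real (card B) - 1" "real (card B) - 1 < ?f s"
      using c f B by auto
    ultimately show ?thesis
      using B x by (intro bexI[of _ "indicator_vector (B - {x})"] bexI[of _ "indicator_vector (insert x B')"]) auto
  qed
  have finT: "finite ?T" using assms by simp
  have le: "convex hull ?T \<inter> {x. ?f x \<le> real k} = convex hull (?T \<inter> {x. ?f x \<le> real k})"
    by (rule convex_hull_Int_halfspace_le[OF finT linear_coord_sum exch])
  have ge: "convex hull (?T \<inter> {x. ?f x \<le> real k}) \<inter> {x. real k \<le> ?f x}
      = convex hull (?T \<inter> {x. ?f x \<le> real k} \<inter> {x. real k \<le> ?f x})"
    using finT by (intro convex_hull_Int_halfspace_ge linear_coord_sum) auto
  have eq: "?T \<inter> {x. ?f x \<le> real k} \<inter> {x. real k \<le> ?f x} = indicator_vector ` {B. B \<subseteq> E \<and> card B = k}"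
    using f by (auto simp: image_iff)
  show "?R \<subseteq> ?L"
  proof
    fix x assume x: "x \<in> ?R"
    then have "x \<in> convex hull ?T" using cube_subset_convex_hull[OF assms, of x] by blast
    then have "x \<in> convex hull ?T \<inter> {x. ?f x \<le> real k} \<inter> {x. real k \<le> ?f x}" using x by simp
    then show "x \<in> ?L" unfolding le ge eq .
  qed
qed

section \<open>Relaxing a hyperplane\<close>

text \<open>The blocks \<open>\<H>\<close> are the hyperplanes with at least \<open>k\<close> elements. Their sizes are bounded so as to
  exclude coloops, and two of them covering \<open>E\<close> would make a matroid of rank 2 disconnected.\<close>

definition paving_family :: "nat \<Rightarrow> 'a set \<Rightarrow> 'a set set \<Rightarrow> bool" where
  "paving_family k E \<H> \<longleftrightarrow> finite E \<and> 2 \<le> k \<and> k + 1 \<le> card E \<and>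
     (\<forall>H\<in>\<H>. H \<subseteq> E \<and> k \<le> card H \<and> card H + 2 \<le> card E) \<and>
     (\<forall>H\<in>\<H>. \<forall>H'\<in>\<H>. H \<noteq> H' \<longrightarrow> card (H \<inter> H') + 2 \<le> k) \<and>
     (k = 2 \<longrightarrow> (\<forall>H\<in>\<H>. \<forall>H'\<in>\<H>. H \<union> H' \<noteq> E))"

definition paving_matroid :: "nat \<Rightarrow> 'a set \<Rightarrow> 'a set set \<Rightarrow> 'a matroid" where
  "paving_matroid k E \<H> =
     Matroid E {I. I \<subseteq> E \<and> card I \<le> k \<and> (card I = k \<longrightarrow> (\<forall>H\<in>\<H>. \<not> I \<subseteq> H))}"

text \<open>For \<open>k \<le> card H\<close> and \<open>H \<subset> E\<close>, this is the uniform
  matroid of rank \<open>k\<close> on \<open>H\<close> and one further point, with that point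
  replaced by the parallel class \<open>E - H\<close>.\<close>

definition parallel_complement :: "nat \<Rightarrow> 'a set \<Rightarrow> 'a set \<Rightarrow> 'a matroid" where
  "parallel_complement k E H = Matroid E {I. I \<subseteq> E \<and> card I \<le> k \<and> card (I - H) \<le> 1}"

lemma matroid_rank_eqI:
  assumes "is_matroid M" "B \<in> indep M" "\<And>I. I \<in> indep M \<Longrightarrow> card I \<le> card B"
  shows "matroid_rank M = card B"
  unfolding matroid_rank_def using assms finite_indep_family by (intro Max_eqI) auto

lemma paving_familyD:
  assumes "paving_family k E \<H>"
  shows "finite E" "2 \<le> k" "k + 1 \<le> card E" "\<And>H. H \<in> \<H> \<Longrightarrow> H \<subseteq> E" "\<And>H. H \<in> \<H> \<Longrightarrow> finite H"
    "\<And>H. H \<in> \<H> \<Longrightarrow> k \<le> card H" "\<And>H. H \<in> \<H> \<Longrightarrow> card H + 2 \<le> card E"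
    "\<And>H H'. H \<in> \<H> \<Longrightarrow> H' \<in> \<H> \<Longrightarrow> H \<noteq> H' \<Longrightarrow> card (H \<inter> H') + 2 \<le> k"
    "\<And>H H'. k = 2 \<Longrightarrow> H \<in> \<H> \<Longrightarrow> H' \<in> \<H> \<Longrightarrow> H \<union> H' \<noteq> E"
  using assms unfolding paving_family_def by (auto dest: finite_subset)

lemma paving_family_mono:
  assumes "paving_family k E \<H>" "\<H>' \<subseteq> \<H>"
  shows "paving_family k E \<H>'"
  unfolding paving_family_def
proof (intro conjI ballI impI)
  note D = paving_familyD[OF assms(1)]
  show "finite E" "2 \<le> k" "k + 1 \<le> card E" by (rule D)+
  fix H assume "H \<in> \<H>'"
  then have H: "H \<in> \<H>" using assms(2) by blast
  show "H \<subseteq> E" "k \<le> card H" "card H + 2 \<le> card E" using D(4,6,7)[OF H] .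
  fix H' assume "H' \<in> \<H>'"
  then have H': "H' \<in> \<H>" using assms(2) by blast
  show "card (H \<inter> H') + 2 \<le> k" if "H \<noteq> H'" using D(8)[OF H H' that] .
  show "H \<union> H' \<noteq> E" if "k = 2" using D(9)[OF that H H'] .
qed

lemma paving_family_unique:
  assumes "paving_family k E \<H>" "H \<in> \<H>" "H' \<in> \<H>" "S \<subseteq> H" "S \<subseteq> H'" "k \<le> card S + 1"
  shows "H = H'"
proof (rule ccontr)
  assume "H \<noteq> H'"
  then have "card (H \<inter> H') + 2 \<le> k" using paving_familyD(8)[OF assms(1)] assms by blast
  moreover have "card S \<le> card (H \<inter> H')"
    using assms paving_familyD(5)[OF assms(1)] by (intro card_mono) auto
  ultimately show False using assms(6) by simp
qed

context
  fixes k :: nat and E :: "'a set" and \<H> :: "'a set set"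
  assumes fam: "paving_family k E \<H>"
begin

text \<open>Augmentation by an arbitrary element of \<open>J - I\<close> is only in danger if
  \<open>I\<close> has \<open>k - 1\<close> elements and lies in a block \<open>H\<close>. Then
  \<open>J\<close> has \<open>k\<close> elements, hence one outside \<open>H\<close>, and no other
  block contains \<open>I\<close>.\<close>

lemma is_matroid_paving: "is_matroid (paving_matroid k E \<H>)"
proof -
  note [simp] = paving_matroid_def
  have finE: "finite E" and k: "2 \<le> k" using paving_familyD[OF fam] by auto
  have fin: "finite I" if "I \<subseteq> E" for I using that finE finite_subset by blast
  show ?thesis unfolding is_matroid_def
  proof (intro conjI ballI allI impI)
    fix I J assume I: "I \<in> indep (paving_matroid k E \<H>)" and J: "J \<subseteq> I"
    have "card J \<le> card I" using I J fin[of I] by (intro card_mono) auto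
    moreover have "J = I" if "card J = k" using that I J fin[of I] by (intro card_seteq) auto
    ultimately show "J \<in> indep (paving_matroid k E \<H>)" using I J by auto
  next
    fix I J assume I: "I \<in> indep (paving_matroid k E \<H>)" and J: "J \<in> indep (paving_matroid k E \<H>)"
      and lt: "card I < card J"
    have "\<not> J \<subseteq> I" using lt card_mono[of I J] I fin[of I] by auto
    then obtain x where x: "x \<in> J - I" by blast
    have ins: "insert x I \<subseteq> E \<and> card (insert x I) = card I + 1" if "x \<in> J - I" for x
      using I J that fin[of I] by auto
    show "\<exists>x\<in>J - I. insert x I \<in> indep (paving_matroid k E \<H>)"
    proof (cases "\<exists>H\<in>\<H>. I \<subseteq> H \<and> card I + 1 = k")
      case True
      then obtain H where H: "H \<in> \<H>" "I \<subseteq> H" "card I + 1 = k" by blast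
      then have "card J = k" using lt J by simp
      then obtain y where y: "y \<in> J" "y \<notin> H" using J H(1) by auto
      have "\<not> insert y I \<subseteq> H'" if "H' \<in> \<H>" for H'
        using paving_family_unique[OF fam H(1) that H(2)] H(3) y by auto
      moreover have "y \<notin> I" using y H(2) by blast
      ultimately show ?thesis using y H ins[of y] by (intro bexI[of _ y]) auto
    next
      case False
      then show ?thesis using x ins[OF x] lt J by (intro bexI[of _ x]) auto
    qed
  qed (use finE k in auto)
qed

lemma bases_paving: "bases (paving_matroid k E \<H>) = {B. B \<subseteq> E \<and> card B = k \<and> (\<forall>H\<in>\<H>. \<not> B \<subseteq> H)}"
proof -
  have finE: "finite E" and k: "2 \<le> k" "k + 1 \<le> card E" using paving_familyD[OF fam] by auto
  have "\<exists>B. B \<subseteq> E \<and> card B = k \<and> (\<forall>H\<in>\<H>. \<not> B \<subseteq> H)"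
  proof (cases "\<H> = {}")
    case True
    then show ?thesis using obtain_subset_with_card_n[of k E] k by auto
  next
    case False
    then obtain H where H: "H \<in> \<H>" by blast
    note HD = paving_familyD(4-7)[OF fam H]
    obtain S where S: "S \<subseteq> H" "card S = k - 1" "finite S"
      using obtain_subset_with_card_n[of "k - 1" H] HD(3) by (metis diff_le_self le_trans)
    have "\<not> E \<subseteq> H" using HD card_mono[of H E] by auto
    then obtain y where y: "y \<in> E" "y \<notin> H" by blast
    have "\<not> insert y S \<subseteq> H'" if "H' \<in> \<H>" for H'
      using paving_family_unique[OF fam H that S(1)] S y by auto
    moreover have "card (insert y S) = k" using S y k by (auto simp: card_insert_if)
    ultimately show ?thesis using S y HD by (intro exI[of _ "insert y S"]) auto
  qed
  then obtain B where B: "B \<subseteq> E" "card B = k" "\<forall>H\<in>\<H>. \<not> B \<subseteq> H" by blast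
  then have "matroid_rank (paving_matroid k E \<H>) = card B"
    by (intro matroid_rank_eqI is_matroid_paving) (auto simp: paving_matroid_def)
  then have r: "matroid_rank (paving_matroid k E \<H>) = k" using B(2) by simp
  show ?thesis
    unfolding set_eq_iff bases_iff[OF is_matroid_paving] r by (auto simp: paving_matroid_def)
qed

end

lemma is_matroid_parallel_complement:
  assumes "finite E"
  shows "is_matroid (parallel_complement k E H)"
proof -
  note [simp] = parallel_complement_def
  have fin: "finite I" if "I \<subseteq> E" for I using that assms finite_subset by blast
  show ?thesis unfolding is_matroid_def
  proof (intro conjI ballI allI impI)
    fix I J assume I: "I \<in> indep (parallel_complement k E H)" and J: "J \<subseteq> I"
    have "card J \<le> card I" "card (J - H) \<le> card (I - H)"
      using I J fin[of I] by (auto intro!: card_mono)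
    then show "J \<in> indep (parallel_complement k E H)" using I J by auto
  next
    fix I J assume I: "I \<in> indep (parallel_complement k E H)"
      and J: "J \<in> indep (parallel_complement k E H)" and lt: "card I < card J"
    have fins: "finite I" "finite J" using I J fin by auto
    show "\<exists>x\<in>J - I. insert x I \<in> indep (parallel_complement k E H)"
    proof (cases "J \<inter> H \<subseteq> I")
      case True
      then have "card (J \<inter> H) \<le> card (I \<inter> H)" using fins by (intro card_mono) auto
      then have "card (I - H) < card (J - H)"
        using lt card_Int_Diff[of I H] card_Int_Diff[of J H] fins by linarith
      moreover have "card (J - H) \<le> 1" using J by simp
      ultimately have "card (I - H) = 0" "card (J - H) = 1" by linarith+
      then have "I - H = {}" "card (J - H) = 1" using fins by simp_all
      then obtain x where "J - H = {x}" by (meson card_1_singletonE)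
      moreover from this have "insert x I - H = {x}" "x \<notin> I" using \<open>I - H = {}\<close> by auto
      ultimately show ?thesis using I J lt fins by (intro bexI[of _ x]) auto
    next
      case False
      then obtain x where "x \<in> J" "x \<in> H" "x \<notin> I" by blast
      then show ?thesis using I J lt fins by (intro bexI[of _ x]) (auto simp: insert_Diff_if)
    qed
  qed (use assms in auto)
qed

lemma bases_parallel_complement:
  assumes "finite E" "H \<subseteq> E" "k \<le> card H"
  shows "bases (parallel_complement k E H) = {B. B \<subseteq> E \<and> card B = k \<and> card (B - H) \<le> 1}"
proof -
  obtain B where "B \<subseteq> H" "card B = k" using obtain_subset_with_card_n[of k H] assms by auto
  then have "matroid_rank (parallel_complement k E H) = card B"
    using assms by (intro matroid_rank_eqI is_matroid_parallel_complement)
      (auto simp: parallel_complement_def Diff_eq_empty_iff[THEN iffD2])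
  then have r: "matroid_rank (parallel_complement k E H) = k" using \<open>card B = k\<close> by simp
  show ?thesis
    unfolding set_eq_iff bases_iff[OF is_matroid_parallel_complement[OF assms(1)]] r
    by (auto simp: parallel_complement_def)
qed

lemma card_Int_block_le:
  assumes fam: "paving_family k E (insert H \<H>)" and "H \<notin> \<H>" "H' \<in> \<H>" "B \<subseteq> H'"
  shows "card (B \<inter> H) + 2 \<le> k"
proof -
  have "H' \<noteq> H" using assms by blast
  then have "card (H' \<inter> H) + 2 \<le> k" using paving_familyD(8)[OF fam, of H' H] assms(3) by blast
  moreover have "card (B \<inter> H) \<le> card (H' \<inter> H)"
    using paving_familyD(5)[OF fam, of H] assms by (intro card_mono) auto
  ultimately show ?thesis by simp
qed

text \<open>Being contained in \<open>H\<close> is expressed through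
  \<open>card (B \<inter> H)\<close>, the value of x(H) at the indicator vector, to match a
  half-space.\<close>

lemma bases_paving_insert:
  assumes fam: "paving_family k E (insert H \<H>)"
  shows "bases (paving_matroid k E (insert H \<H>)) = {B \<in> bases (paving_matroid k E \<H>). card (B \<inter> H) \<le> k - 1}"
proof -
  have fam': "paving_family k E \<H>" using paving_family_mono[OF fam] by blast
  have finH: "finite H" and k: "2 \<le> k" and finE: "finite E" using paving_familyD[OF fam] by auto
  have "\<not> B \<subseteq> H \<longleftrightarrow> card (B \<inter> H) \<le> k - 1" if B: "B \<subseteq> E" "card B = k" for B
  proof
    assume "\<not> B \<subseteq> H"
    then have "B \<inter> H \<subset> B" by blast
    then have "card (B \<inter> H) < k"
      using psubset_card_mono[of B "B \<inter> H"] B finE finite_subset by metis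
    then show "card (B \<inter> H) \<le> k - 1" by simp
  next
    assume "card (B \<inter> H) \<le> k - 1"
    then show "\<not> B \<subseteq> H" using B(2) k by (metis Int_absorb2 diff_le_self le_antisym not_less_eq_eq One_nat_def Suc_pred zero_less_numeral less_le_trans)
  qed
  then show ?thesis unfolding bases_paving[OF fam] bases_paving[OF fam'] by auto
qed

text \<open>The remaining blocks impose nothing on this side: a set with \<open>k - 1\<close>
  elements in \<open>H\<close> cannot lie in another block, which meets \<open>H\<close> in at most
  \<open>k - 2\<close> elements.\<close>

lemma bases_parallel_complement_paving:
  assumes fam: "paving_family k E (insert H \<H>)" and "H \<notin> \<H>"
  shows "bases (parallel_complement k E H) = {B \<in> bases (paving_matroid k E \<H>). k - 1 \<le> card (B \<inter> H)}"
proof -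
  have fam': "paving_family k E \<H>" using paving_family_mono[OF fam] by blast
  have H: "finite E" "H \<subseteq> E" "k \<le> card H" "2 \<le> k" using paving_familyD[OF fam] by auto
  have "(\<forall>H'\<in>\<H>. \<not> B \<subseteq> H') \<and> k - 1 \<le> card (B \<inter> H) \<longleftrightarrow> card (B - H) \<le> 1"
    if B: "B \<subseteq> E" "card B = k" for B
  proof -
    have "finite B" using B H finite_subset by blast
    then have "card (B \<inter> H) + card (B - H) = k" using card_Int_Diff[of B H] B by simp
    moreover have "card (B \<inter> H) + 2 \<le> k" if "H' \<in> \<H>" "B \<subseteq> H'" for H'
      using card_Int_block_le[OF fam assms(2) that] .
    ultimately show ?thesis by fastforce
  qed
  then show ?thesis unfolding bases_paving[OF fam'] bases_parallel_complement[OF H(1-3)] by auto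
qed

text \<open>Any \<open>y\<close> of \<open>B'\<close> outside \<open>H\<close> will do. Then
  \<open>insert y (B - {x})\<close> has \<open>k - 1\<close> elements in \<open>H\<close> and so
  avoids all other blocks. For the second base, at most one block \<open>H'\<close> contains
  \<open>B' - {y}\<close>; since \<open>B \<subseteq> H\<close> is not contained in
  \<open>H'\<close>, some \<open>x\<close> of \<open>B\<close> lies outside it.\<close>

lemma paving_exchange:
  assumes fam: "paving_family k E (insert H \<H>)"
    and B: "B \<in> bases (paving_matroid k E \<H>)" "B \<subseteq> H"
    and B': "B' \<in> bases (paving_matroid k E \<H>)" "card (B' \<inter> H) + 2 \<le> k"
  obtains x y where "x \<in> B - B'" "y \<in> B' - B" "y \<notin> H"
    "insert y (B - {x}) \<in> bases (paving_matroid k E \<H>)" "insert x (B' - {y}) \<in> bases (paving_matroid k E \<H>)"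
proof (cases "H \<in> \<H>")
  case True
  have "paving_family k E \<H>" using paving_family_mono[OF fam] by blast
  from bases_paving[OF this] show ?thesis using B True by blast
next
  case HN: False
  have fam': "paving_family k E \<H>" using paving_family_mono[OF fam] by blast
  note bs = bases_paving[OF fam']
  have b: "B \<subseteq> E" "card B = k" "B' \<subseteq> E" "card B' = k" "finite B" "finite B'" and k: "2 \<le> k"
    using B B' paving_familyD(1,2)[OF fam] unfolding bs by (auto intro: finite_subset)
  have "\<not> B' \<subseteq> H" using B'(2) b(4) by (auto simp: Int_absorb2)
  then obtain y where y: "y \<in> B'" "y \<notin> H" by blast
  have cy: "card (B' - {y}) = k - 1" using y b by simp
  obtain x where x: "x \<in> B" "x \<notin> B'" and ok: "\<forall>H'\<in>\<H>. \<not> insert x (B' - {y}) \<subseteq> H'"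
  proof (cases "\<exists>H'\<in>\<H>. B' - {y} \<subseteq> H'")
    case True
    then obtain H' where H': "H' \<in> \<H>" "B' - {y} \<subseteq> H'" by blast
    have "\<not> B \<subseteq> H'" using card_Int_block_le[OF fam HN H'(1), of B] B(2) b by (auto simp: Int_absorb2)
    then obtain x where x: "x \<in> B" "x \<notin> H'" by blast
    have "x \<notin> B'" using x H'(2) B(2) y by blast
    moreover have "\<not> insert x (B' - {y}) \<subseteq> H''" if "H'' \<in> \<H>" for H''
    proof
      assume "insert x (B' - {y}) \<subseteq> H''"
      then have "H' = H''" using paving_family_unique[OF fam' H'(1) that H'(2)] cy by simp
      then show False using x \<open>insert x (B' - {y}) \<subseteq> H''\<close> by blast
    qed
    ultimately show ?thesis using that x by blast
  next
    case False
    have "\<not> B \<subseteq> B'"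
    proof
      assume "B \<subseteq> B'"
      then have "B = B'" using b by (metis card_subset_eq)
      then show False using B(2) \<open>\<not> B' \<subseteq> H\<close> by blast
    qed
    then show ?thesis using that False by blast
  qed
  have "\<not> insert y (B - {x}) \<subseteq> H'" if "H' \<in> \<H>" for H'
  proof
    assume "insert y (B - {x}) \<subseteq> H'"
    then have "card (insert y (B - {x}) \<inter> H) + 2 \<le> k" using card_Int_block_le[OF fam HN that] by blast
    moreover have "card (B - {x}) \<le> card (insert y (B - {x}) \<inter> H)"
      using b B(2) by (intro card_mono) auto
    ultimately show False using x b by simp
  qed
  moreover have "card (insert y (B - {x})) = k" "card (insert x (B' - {y})) = k"
    using x y b B(2) k by (auto simp: card_insert_if)
  ultimately have "insert y (B - {x}) \<in> bases (paving_matroid k E \<H>)"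
    "insert x (B' - {y}) \<in> bases (paving_matroid k E \<H>)"
    unfolding bs using x y b ok by auto
  then show ?thesis using that x y B(2) by blast
qed

lemma base_polytope_relax:
  assumes fam: "paving_family k E (insert H \<H>)" and HN: "H \<notin> \<H>"
  defines "P \<equiv> base_polytope (paving_matroid k E \<H>)"
  shows "P \<inter> {x. coord_sum H x \<le> real (k - 1)} = base_polytope (paving_matroid k E (insert H \<H>))"
    and "P \<inter> {x. real (k - 1) \<le> coord_sum H x} = base_polytope (parallel_complement k E H)"
proof -
  have fam': "paving_family k E \<H>" using paving_family_mono[OF fam] by blast
  note bs = bases_paving[OF fam']
  have finH: "finite H" and k: "2 \<le> k" and finE: "finite E" using paving_familyD[OF fam] by auto
  let ?S = "indicator_vector ` bases (paving_matroid k E \<H>)"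
  let ?f = "coord_sum H" and ?c = "real (k - 1)"
  have finB: "finite B" if "B \<in> bases (paving_matroid k E \<H>)" for B
    using that finE unfolding bs by (auto intro: finite_subset)
  have f: "?f (indicator_vector B) = real (card (B \<inter> H))" if "B \<in> bases (paving_matroid k E \<H>)" for B
    using finB[OF that] finH by (simp add: coord_sum_indicator_vector Int_commute)
  have finS: "finite ?S" using finite_bases[OF is_matroid_paving[OF fam']] by simp
  have exch: "\<exists>t\<in>?S. \<exists>t'\<in>?S. s + s' = t + t' \<and> ?f s' < ?f t \<and> ?f t < ?f s"
    if s: "s \<in> ?S" "s' \<in> ?S" "?f s' < ?c" "?c < ?f s" for s s'
  proof -
    obtain B B' where B: "B \<in> bases (paving_matroid k E \<H>)" "s = indicator_vector B"
      and B': "B' \<in> bases (paving_matroid k E \<H>)" "s' = indicator_vector B'"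
      using s by auto
    have c: "card (B' \<inter> H) < k - 1" "k - 1 < card (B \<inter> H)" using s(3,4) f B B' by auto
    have "card B = k" using B unfolding bs by simp
    then have "B \<inter> H = B" using c finB[OF B(1)] by (intro card_seteq) auto
    then have BH: "B \<subseteq> H" by blast
    have "card (B' \<inter> H) + 2 \<le> k" using c by simp
    from paving_exchange[OF fam B(1) BH B'(1) this]
    obtain x y where xy: "x \<in> B - B'" "y \<in> B' - B" "y \<notin> H"
      and new: "insert y (B - {x}) \<in> bases (paving_matroid k E \<H>)" "insert x (B' - {y}) \<in> bases (paving_matroid k E \<H>)"
      by blast
    have "insert y (B - {x}) \<inter> H = B - {x}" using xy BH by blast
    then have "card (insert y (B - {x}) \<inter> H) = k - 1" using xy \<open>card B = k\<close> finB[OF B(1)] by simp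
    then have "?f (indicator_vector (insert y (B - {x}))) = ?c" using f[OF new(1)] by simp
    moreover have "s + s' = indicator_vector (insert y (B - {x})) + indicator_vector (insert x (B' - {y}))"
      unfolding B(2) B'(2) using finB B B' xy by (intro indicator_vector_exchange) auto
    ultimately show ?thesis using s new
      by (intro bexI[of _ "indicator_vector (insert y (B - {x}))"] bexI[of _ "indicator_vector (insert x (B' - {y}))"]) auto
  qed
  have "?S \<inter> {x. ?f x \<le> ?c} = indicator_vector ` bases (paving_matroid k E (insert H \<H>))"
    unfolding bases_paving_insert[OF fam] using f by auto
  then show "P \<inter> {x. ?f x \<le> ?c} = base_polytope (paving_matroid k E (insert H \<H>))"
    unfolding P_def base_polytope_def using convex_hull_Int_halfspace_le[OF finS linear_coord_sum exch] by simp
  have "?S \<inter> {x. ?c \<le> ?f x} = indicator_vector ` bases (parallel_complement k E H)"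
    unfolding bases_parallel_complement_paving[OF fam HN] using f by auto
  then show "P \<inter> {x. ?c \<le> ?f x} = base_polytope (parallel_complement k E H)"
    unfolding P_def base_polytope_def using convex_hull_Int_halfspace_ge[OF finS linear_coord_sum exch] by simp
qed

text \<open>The hypersimplex is cut by one block at a time. The explicit inequalities are what
  exhibits relative interior points.\<close>

lemma base_polytope_paving:
  assumes fam: "paving_family k E \<H>" and fin: "finite \<H>"
  shows "base_polytope (paving_matroid k E \<H>) =
    {x. Poly_Mapping.keys x \<subseteq> E \<and> (\<forall>i\<in>E. 0 \<le> Poly_Mapping.lookup x i \<and> Poly_Mapping.lookup x i \<le> 1)
      \<and> coord_sum E x = real k \<and> (\<forall>H\<in>\<H>. coord_sum H x \<le> real (k - 1))}"
  using fin fam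
proof (induction \<H>)
  case empty
  then show ?case
    using hypersimplex[of E k] paving_familyD(1)[OF empty]
    by (simp add: base_polytope_def bases_paving)
next
  case (insert H \<H>)
  have "paving_family k E \<H>" using paving_family_mono[OF insert.prems] by blast
  then show ?case
    unfolding base_polytope_relax(1)[OF insert.prems insert.hyps(2), symmetric]
    using insert.IH by auto
qed

text \<open>The witness is the barycentre of the bases that meet \<open>H\<close> in exactly \<open>k - 1\<close> elements.\<close>

lemma rel_interior_base_polytope_paving:
  assumes fam: "paving_family k E (insert H \<H>)" and HN: "H \<notin> \<H>" and fin: "finite \<H>"
  obtains b where "b \<in> rel_interior (base_polytope (paving_matroid k E \<H>))" "coord_sum H b = real (k - 1)"
proof -
  let ?P = "base_polytope (paving_matroid k E \<H>)"
  have fam': "paving_family k E \<H>" using paving_family_mono[OF fam] by blast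
  have finE: "finite E" and k: "2 \<le> k" using paving_familyD[OF fam] by auto
  have H: "H \<subseteq> E" "finite H" "k \<le> card H" "card H + 2 \<le> card E"
    using paving_familyD(4-7)[OF fam, of H] by auto
  define h m where "h = card H" and "m = card (E - H)"
  have hm: "h \<ge> k" "m \<ge> 2" using H finE by (auto simp: h_def m_def card_Diff_subset)
  define b where "b = (\<Sum>i\<in>H. Poly_Mapping.single i (real (k - 1) / h)) + (\<Sum>i\<in>E - H. Poly_Mapping.single i (1 / real m))"
  have lb: "Poly_Mapping.lookup b i = (if i \<in> H then real (k - 1) / h else if i \<in> E then 1 / real m else 0)" for i
    using finE H by (auto simp: b_def lookup_add lookup_sum lookup_single when_def)
  have sb: "coord_sum A b = card (A \<inter> H) * (real (k - 1) / h) + card (A - H) * (1 / real m)" if "A \<subseteq> E" for A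
  proof -
    have finA: "finite A" using that finE finite_subset by blast
    have "coord_sum A b = (\<Sum>i\<in>A. if i \<in> H then real (k - 1) / h else 1 / real m)"
      unfolding coord_sum_def lb using that by (intro sum.cong) auto
    also have "\<dots> = (\<Sum>i\<in>A \<inter> H. real (k - 1) / h) + (\<Sum>i\<in>A - H. 1 / real m)"
      using finA by (simp add: sum.If_cases Diff_eq)
    finally show ?thesis by simp
  qed
  have bH: "coord_sum H b = real (k - 1)" using sb[OF H(1)] hm k by (simp add: h_def)
  have bE: "coord_sum E b = real k"
  proof -
    have "E \<inter> H = H" using H by blast
    then show ?thesis using sb[OF order_refl] hm k by (simp add: h_def m_def of_nat_diff)
  qed
  have lt: "coord_sum H' b < real (k - 1)" if H': "H' \<in> \<H>" for H'
  proof -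
    have "H' \<noteq> H" using HN H' by blast
    have D: "H' \<subseteq> E" "card (H' \<inter> H) + 2 \<le> k"
      using paving_familyD(4)[OF fam', of H'] paving_familyD(8)[OF fam, of H' H] H' \<open>H' \<noteq> H\<close> by auto
    have le: "card (H' - H) \<le> m" unfolding m_def using D finE by (intro card_mono) auto
    show ?thesis
    \<comment> \<open>The part of \<open>H'\<close> in \<open>H\<close> has weight at most (k - 2)(k
      - 1)/k and the part outside at most 1. For \<open>k \<ge> 3\<close> the former is below k - 2.
      For \<open>k = 2\<close> it is 0, and strictness comes from a point of \<open>E\<close> that
      \<open>H\<close> and \<open>H'\<close> both miss.\<close>
    proof (cases "k = 2")
      case True
      then have "H' \<inter> H = {}" using D H by simp
      have "H' \<union> H \<noteq> E" using paving_familyD(9)[OF fam True, of H' H] H' by blast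
      then have "H' - H \<subset> E - H" using D H by blast
      then have "card (H' - H) < m" unfolding m_def using finE by (intro psubset_card_mono) auto
      then show ?thesis using sb[OF D(1)] \<open>H' \<inter> H = {}\<close> True hm by simp
    next
      case False
      have "card (H' \<inter> H) * (real (k - 1) / h) \<le> real (k - 2) * (real (k - 1) / k)"
        using D hm k by (intro mult_mono divide_left_mono) auto
      also have "\<dots> < real (k - 2)"
      proof -
        have "real (k - 1) / k < 1" "real (k - 2) > 0" using k False by auto
        then show ?thesis by (metis mult.right_neutral mult_strict_left_mono)
      qed
      finally have "card (H' \<inter> H) * (real (k - 1) / h) < real (k - 2)" .
      moreover have "card (H' - H) * (1 / real m) \<le> 1" using le hm by simp
      moreover have "real (k - 2) + 1 = real (k - 1)" using k by simp
      ultimately show ?thesis using sb[OF D(1)] by linarith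
    qed
  qed
  have b01: "0 < Poly_Mapping.lookup b i \<and> Poly_Mapping.lookup b i < 1" if "i \<in> E" for i
    using that hm k by (auto simp: lb)
  have kb: "Poly_Mapping.keys b \<subseteq> E" using H by (auto simp: in_keys_iff lb split: if_splits)
  \<comment> \<open>The strict forms of all inequalities define an open set. Coordinates are written
    as sums over singletons so that the same continuity lemma covers all three families.\<close>
  let ?T = "(\<Inter>i\<in>E. {x. 0 < coord_sum {i} x}) \<inter> (\<Inter>i\<in>E. {x. coord_sum {i} x < 1})
    \<inter> (\<Inter>H'\<in>\<H>. {x. coord_sum H' x < real (k - 1)})"
  have s1: "coord_sum {i} x = Poly_Mapping.lookup x i" for i and x :: "'a \<Rightarrow>\<^sub>0 real" by (simp add: coord_sum_def)
  have "open ?T"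
    using finE fin paving_familyD(5)[OF fam']
    by (intro open_Int open_INT ballI open_Collect_less continuous_on_const continuous_on_coord_sum) auto
  moreover have "b \<in> ?P"
    unfolding base_polytope_paving[OF fam' fin] using kb b01 bE lt by (auto simp: less_imp_le)
  moreover have "b \<in> ?T" using b01 lt by (auto simp: s1)
  moreover have "?T \<inter> affine hull ?P \<subseteq> ?P"
  proof -
    let ?A = "{x. Poly_Mapping.keys x \<subseteq> E \<and> coord_sum E x = real k}"
    have "affine ?A"
      unfolding affine_def
    proof (intro ballI allI impI)
      fix x y and u v :: real assume xy: "x \<in> ?A" "y \<in> ?A" "u + v = 1"
      have "Poly_Mapping.lookup (u *\<^sub>R x + v *\<^sub>R y) i = 0" if "i \<notin> E" for i
      proof -
        have "i \<notin> Poly_Mapping.keys x" "i \<notin> Poly_Mapping.keys y" using xy that by auto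
        then show ?thesis by (simp add: in_keys_iff lookup_add)
      qed
      then have "Poly_Mapping.keys (u *\<^sub>R x + v *\<^sub>R y) \<subseteq> E" by (auto simp: in_keys_iff)
      moreover have "coord_sum E (u *\<^sub>R x + v *\<^sub>R y) = (u + v) * real k"
        using xy by (simp add: linear_add[OF linear_coord_sum] linear_cmul[OF linear_coord_sum] distrib_right[symmetric])
      ultimately show "u *\<^sub>R x + v *\<^sub>R y \<in> ?A" using xy by simp
    qed
    moreover have "?P \<subseteq> ?A" unfolding base_polytope_paving[OF fam' fin] by blast
    ultimately have "affine hull ?P \<subseteq> ?A" by (intro hull_minimal)
    then have "?T \<inter> affine hull ?P \<subseteq> ?T \<inter> ?A" by blast
    also have "\<dots> \<subseteq> ?P" unfolding base_polytope_paving[OF fam' fin] s1 by (auto simp: less_imp_le)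
    finally show ?thesis .
  qed
  ultimately have "b \<in> rel_interior ?P" unfolding mem_rel_interior by blast
  then show ?thesis using that bH by blast
qed

section \<open>Values of the g-polynomial\<close>

lemma uniform_eq_parallel_complement: "finite E \<Longrightarrow> uniform_matroid k E = parallel_complement k E E"
  by (auto simp: uniform_matroid_def parallel_complement_def Diff_eq_empty_iff[THEN iffD2])

lemma is_matroid_uniform: "finite E \<Longrightarrow> is_matroid (uniform_matroid k E)"
  by (simp add: uniform_eq_parallel_complement is_matroid_parallel_complement)

lemma bases_uniform: "finite E \<Longrightarrow> k \<le> card E \<Longrightarrow> bases (uniform_matroid k E) = {B. B \<subseteq> E \<and> card B = k}"
  by (auto simp: uniform_eq_parallel_complement bases_parallel_complement Diff_eq_empty_iff[THEN iffD2])

lemma uniform_eq_paving: "uniform_matroid k E = paving_matroid k E {}"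
  by (simp add: uniform_matroid_def paving_matroid_def)

text \<open>The section is a face of the polytope with block \<open>H\<close>, so it is the base
  polytope of some matroid, whose bases have \<open>k - 1\<close> elements in \<open>H\<close> and
  one outside. Comparing independent sets identifies it with the direct sum, which thereby is a
  matroid too.\<close>

lemma base_polytope_direct_sum_uniform:
  assumes fam: "paving_family k E (insert H \<H>)" and HN: "H \<notin> \<H>"
  defines "N \<equiv> direct_sum (uniform_matroid (k - 1) H) (uniform_matroid 1 (E - H))"
  shows "is_matroid N" "ground N = E"
    "base_polytope N = base_polytope (paving_matroid k E \<H>) \<inter> {x. coord_sum H x = real (k - 1)}"
proof -
  let ?M = "paving_matroid k E (insert H \<H>)"
  let ?F = "base_polytope (paving_matroid k E \<H>) \<inter> {x. coord_sum H x = real (k - 1)}"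
  have fam': "paving_family k E \<H>" using paving_family_mono[OF fam] by blast
  have finE: "finite E" and k: "2 \<le> k" using paving_familyD[OF fam] by auto
  have H: "H \<subseteq> E" "finite H" "k \<le> card H" "card H + 2 \<le> card E"
    using paving_familyD(4-7)[OF fam, of H] by auto
  have M: "is_matroid ?M" by (rule is_matroid_paving[OF fam])
  have face: "?F face_of base_polytope ?M"
    unfolding base_polytope_relax(1)[OF fam HN, symmetric]
    by (rule hyperplane_face_of_le[OF _ linear_coord_sum]) (simp add: base_polytope_def)
  have f: "coord_sum H (indicator_vector B) = real (card (B \<inter> H))" if "B \<in> bases ?M" for B
    using finite_base[OF M that] H by (simp add: coord_sum_indicator_vector Int_commute)
  have bF: "{B \<in> bases ?M. indicator_vector B \<in> ?F} = {B. B \<subseteq> E \<and> card (B \<inter> H) = k - 1 \<and> card (B - H) = 1}"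
    (is "?L = ?R")
  proof -
    have "B \<in> ?L \<longleftrightarrow> B \<in> bases ?M \<and> card (B \<inter> H) = k - 1" for B
    proof -
      have "indicator_vector B \<in> base_polytope (paving_matroid k E \<H>)" if "B \<in> bases ?M"
        using that unfolding bases_paving_insert[OF fam] base_polytope_def by (auto intro: hull_inc)
      then show ?thesis using f by auto
    qed
    moreover have "B \<in> bases ?M \<and> card (B \<inter> H) = k - 1 \<longleftrightarrow> B \<in> ?R" for B
    proof -
      have "(card B = k \<and> (\<forall>H'\<in>\<H>. \<not> B \<subseteq> H') \<and> card (B \<inter> H) = k - 1) = (card (B \<inter> H) = k - 1 \<and> card (B - H) = 1)"
        if "B \<subseteq> E"
      proof -
        have "finite B" using that finE finite_subset by blast
        then have "card (B \<inter> H) + card (B - H) = card B" using card_Int_Diff[of B H] by simp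
        moreover have "card (B \<inter> H) + 2 \<le> k" if "H' \<in> \<H>" "B \<subseteq> H'" for H'
          using card_Int_block_le[OF fam HN that] .
        ultimately show ?thesis using k by fastforce
      qed
      then show ?thesis unfolding bases_paving_insert[OF fam] bases_paving[OF fam'] by auto
    qed
    ultimately show ?thesis by blast
  qed
  obtain B where "B \<in> ?R"
  proof -
    obtain S where S: "S \<subseteq> H" "card S = k - 1" "finite S"
      using obtain_subset_with_card_n[of "k - 1" H] H(3) by (metis diff_le_self le_trans)
    have "\<not> E \<subseteq> H" using H card_mono[of H E] by auto
    then obtain y where y: "y \<in> E" "y \<notin> H" by blast
    have "insert y S \<inter> H = S" "insert y S - H = {y}" using S y by auto
    then show ?thesis using that[of "insert y S"] S y H by auto
  qed
  then have "?F \<noteq> {}" using bF by blast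
  then obtain N' where N': "is_matroid N'" "ground N' = E" "bases N' = ?R" "base_polytope N' = ?F"
    using face_of_base_polytope[OF M face] unfolding bF by (auto simp: paving_matroid_def)
  have "indep N = indep N'"
  proof (intro set_eqI iffI)
    fix I assume "I \<in> indep N"
    then obtain I1 I2 where I: "I = I1 \<union> I2" "I1 \<subseteq> H" "card I1 \<le> k - 1" "I2 \<subseteq> E - H" "card I2 \<le> 1"
      by (auto simp: N_def direct_sum_def uniform_matroid_def)
    obtain J1 where J1: "I1 \<subseteq> J1" "J1 \<subseteq> H" "card J1 = k - 1"
      using exists_subset_between[of I1 "k - 1" H] I H by (metis diff_le_self le_trans)
    have "1 \<le> card (E - H)" using H finE by (simp add: card_Diff_subset)
    then obtain J2 where J2: "I2 \<subseteq> J2" "J2 \<subseteq> E - H" "card J2 = 1"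
      using exists_subset_between[of I2 1 "E - H"] I finE by (metis finite_Diff)
    have "(J1 \<union> J2) \<inter> H = J1" "(J1 \<union> J2) - H = J2" using J1 J2 by auto
    then have "J1 \<union> J2 \<in> bases N'" unfolding N'(3) using J1 J2 H by auto
    moreover have "I \<subseteq> J1 \<union> J2" using I J1 J2 by blast
    ultimately show "I \<in> indep N'" unfolding indep_iff_subset_base[OF N'(1)] by (rule bexI[rotated])
  next
    fix I assume "I \<in> indep N'"
    then obtain B where B: "B \<in> ?R" "I \<subseteq> B" unfolding indep_iff_subset_base[OF N'(1)] N'(3) by blast
    have "finite B" using B finE finite_subset by blast
    then have "card (I \<inter> H) \<le> card (B \<inter> H)" "card (I - H) \<le> card (B - H)"
      using B(2) card_mono[of "B \<inter> H" "I \<inter> H"] card_mono[of "B - H" "I - H"] by blast+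
    then have "I = (I \<inter> H) \<union> (I - H)" "I \<inter> H \<in> indep (uniform_matroid (k - 1) H)"
      "I - H \<in> indep (uniform_matroid 1 (E - H))"
      using B by (auto simp: uniform_matroid_def)
    then show "I \<in> indep N" unfolding N_def direct_sum_def by auto
  qed
  moreover have "ground N = E" using H by (auto simp: N_def direct_sum_def uniform_matroid_def)
  ultimately have "N = N'" using N'(2) by (simp add: matroid.expand)
  then show "is_matroid N" "ground N = E" "base_polytope N = ?F" using N' by auto
qed

text \<open>Adding \<open>y\<close> to the complement of \<open>B1\<close> and removing
  \<open>x\<close> from it means exchanging \<open>y\<close> for \<open>x\<close> in
  \<open>B1\<close>, where \<open>x\<close> is given. This is the second conclusion of
  \<open>symmetric_exchange\<close>.\<close>

lemma is_matroid_dual: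
  assumes M: "is_matroid M"
  shows "is_matroid (dual M)" "bases (dual M) = (\<lambda>B. ground M - B) ` bases M" "dual (dual M) = M"
proof -
  let ?B = "(\<lambda>B. ground M - B) ` bases M"
  have eq: "dual M = Matroid (ground M) {I. \<exists>B\<in>?B. I \<subseteq> B}" by (simp add: dual_def)
  have sub: "B \<subseteq> ground M" if "B \<in> ?B" for B using that by blast
  have card: "card B = card (ground M) - matroid_rank M" if "B \<in> ?B" for B
    using that finite_base[OF M] base_subset_ground[OF M]
    by (auto simp: card_Diff_subset bases_iff[OF M] finite_indep[OF M] indep_subset_ground[OF M])
  have exch: "\<exists>y\<in>C2 - C1. insert y (C1 - {x}) \<in> ?B" if C: "C1 \<in> ?B" "C2 \<in> ?B" "x \<in> C1 - C2" for C1 C2 x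
  proof -
    obtain B1 B2 where B: "B1 \<in> bases M" "C1 = ground M - B1" "B2 \<in> bases M" "C2 = ground M - B2"
      using C by blast
    note sub = base_subset_ground[OF M B(1)] base_subset_ground[OF M B(3)]
    have x: "x \<in> B2 - B1" using C B by blast
    from symmetric_exchange[OF M B(3,1) this] obtain y where y: "y \<in> B1 - B2" "insert x (B1 - {y}) \<in> bases M"
      by blast
    have "insert y (C1 - {x}) = ground M - insert x (B1 - {y})" using x y sub B by auto
    then have "insert y (C1 - {x}) \<in> ?B" using y(2) by simp
    moreover have "y \<in> C2 - C1" using y(1) B sub by blast
    ultimately show ?thesis by blast
  qed
  have ne: "?B \<noteq> {}" using bases_nonempty[OF M] by blast
  note * = is_matroid_of_bases[OF finite_ground[OF M] sub ne card exch]
  show D: "is_matroid (dual M)" unfolding eq by (rule *(1))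
  show b: "bases (dual M) = ?B" unfolding eq by (rule *(2))
  have "indep (dual (dual M)) = indep M"
  proof (intro set_eqI)
    fix I
    have gd: "ground (dual M) = ground M" by (simp add: dual_def)
    have "I \<in> indep (dual (dual M)) \<longleftrightarrow> (\<exists>B\<in>bases M. I \<subseteq> ground M - (ground M - B))"
      unfolding dual_def[of "dual M"] b gd by auto
    also have "\<dots> \<longleftrightarrow> (\<exists>B\<in>bases M. I \<subseteq> B)"
      using base_subset_ground[OF M] by (intro bex_cong) (auto simp: double_diff)
    finally show "I \<in> indep (dual (dual M)) \<longleftrightarrow> I \<in> indep M" by (simp add: indep_iff_subset_base[OF M])
  qed
  then show "dual (dual M) = M" by (simp add: dual_def matroid.expand)
qed

lemma ground_dual [simp]: "ground (dual M) = ground M"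
  by (simp add: dual_def)

lemma not_loop: "{e} \<in> indep M \<Longrightarrow> \<not> is_loop M e"
  by (simp add: is_loop_def circuits_def)

lemma not_coloop: "B \<in> bases M \<Longrightarrow> e \<in> ground M \<Longrightarrow> e \<notin> B \<Longrightarrow> \<not> is_coloop M e"
  unfolding is_coloop_def by (rule not_loop) (auto simp: dual_def)

lemma dual_uniform:
  assumes "finite E" "k \<le> card E"
  shows "dual (uniform_matroid k E) = uniform_matroid (card E - k) E"
proof (rule matroid_eqI)
  have M: "is_matroid (uniform_matroid k E)" by (rule is_matroid_uniform[OF assms(1)])
  show "is_matroid (dual (uniform_matroid k E))" by (rule is_matroid_dual(1)[OF M])
  show "is_matroid (uniform_matroid (card E - k) E)" by (rule is_matroid_uniform[OF assms(1)])
  have "C \<in> (\<lambda>B. E - B) ` {B. B \<subseteq> E \<and> card B = k}" if "C \<subseteq> E" "card C = card E - k" for C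
    using that assms finite_subset[OF that(1)]
    by (intro image_eqI[of _ _ "E - C"]) (auto simp: card_Diff_subset double_diff)
  moreover have "card (E - B) = card E - k" if "B \<subseteq> E" "card B = k" for B
    using that assms by (simp add: card_Diff_subset finite_subset)
  moreover have "ground (uniform_matroid k E) = E" by (simp add: uniform_matroid_def)
  ultimately show "bases (dual (uniform_matroid k E)) = bases (uniform_matroid (card E - k) E)"
    unfolding is_matroid_dual(2)[OF M] bases_uniform[OF assms]
      bases_uniform[OF assms(1) diff_le_self] by auto
qed (simp add: uniform_matroid_def)

lemma deletion_parallel_complement:
  assumes "f \<notin> E"
  shows "deletion (parallel_complement k (insert f E) H) f = parallel_complement k E H"
  using assms by (auto simp: deletion_def parallel_complement_def)

lemma circuit_parallel_complement:
  assumes "k \<ge> 1" "e \<in> E - H" "f \<in> E - H" "e \<noteq> f"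
  shows "{e, f} \<in> circuits (parallel_complement k E H)"
proof -
  have "D = {} \<or> D = {e} \<or> D = {f}" if "D \<subset> {e, f}" for D using that by blast
  then have D: "card D \<le> 1 \<and> card (D - H) \<le> 1" if "D \<subset> {e, f}" for D
    using that[THEN \<open>\<And>D. D \<subset> {e, f} \<Longrightarrow> D = {} \<or> D = {e} \<or> D = {f}\<close>] by (elim disjE) (simp_all add: insert_Diff_if)
  have "{e, f} - H = {e, f}" using assms by blast
  then have "{e, f} \<notin> indep (parallel_complement k E H)"
    using assms(4) by (simp add: parallel_complement_def)
  moreover have "D \<in> indep (parallel_complement k E H)" if "D \<subset> {e, f}" for D
  proof -
    have "D \<subseteq> E" using that assms by blast
    then show ?thesis using D[OF that] assms(1) by (simp add: parallel_complement_def)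
  qed
  moreover have "ground (parallel_complement k E H) = E" by (simp add: parallel_complement_def)
  ultimately show ?thesis using assms unfolding circuits_def by blast
qed

section \<open>The covaluative identity for relaxing one block\<close>

context g_polynomial
begin

text \<open>A cell outside the relative frontier meets the relative interior, so it is one of the
  halves or their section. Conversely, the relative interior point \<open>b\<close> on the
  hyperplane belongs to all three.\<close>

lemma g_relax:
  assumes fam: "paving_family k E (insert H \<H>)" and HN: "H \<notin> \<H>" and fin: "finite \<H>"
  shows "g (paving_matroid k E \<H>) = g (paving_matroid k E (insert H \<H>)) + g (parallel_complement k E H)
    + g (direct_sum (uniform_matroid (k - 1) H) (uniform_matroid 1 (E - H)))"
proof -
  let ?N = "paving_matroid k E \<H>" and ?M = "paving_matroid k E (insert H \<H>)"
    and ?L = "parallel_complement k E H" and ?D = "direct_sum (uniform_matroid (k - 1) H) (uniform_matroid 1 (E - H))"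
  define P where "P = base_polytope ?N"
  let ?f = "coord_sum H" and ?c = "real (k - 1)"
  have fam': "paving_family k E \<H>" using paving_family_mono[OF fam] by blast
  have finE: "finite E" and k: "2 \<le> k" using paving_familyD[OF fam] by auto
  have H: "H \<subseteq> E" "finite H" "k \<le> card H" using paving_familyD(4-7)[OF fam, of H] by auto
  have mN: "is_matroid ?N" by (rule is_matroid_paving[OF fam'])
  have mM: "is_matroid ?M" by (rule is_matroid_paving[OF fam])
  have mL: "is_matroid ?L" by (rule is_matroid_parallel_complement[OF finE])
  have gr: "ground ?N = E" "ground ?M = E" "ground ?L = E" by (simp_all add: paving_matroid_def parallel_complement_def)
  note M0 = base_polytope_direct_sum_uniform[OF fam HN]
  have PM: "P \<inter> {x. ?f x \<le> ?c} = base_polytope ?M" and PL: "P \<inter> {x. ?c \<le> ?f x} = base_polytope ?L"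
    and P0: "base_polytope ?D = P \<inter> {x. ?f x = ?c}"
    using base_polytope_relax[OF fam HN] M0(3) by (simp_all add: P_def)
  have conv: "convex P" by (simp add: P_def base_polytope_def)
  define C where "C = {Q. Q \<noteq> {} \<and> (Q face_of P \<inter> {x. ?f x \<le> ?c} \<or> Q face_of P \<inter> {x. ?c \<le> ?f x})}"
  have sub: "polytope_subdivision C P"
    unfolding C_def
    by (rule halfspace_subdivision[OF conv linear_coord_sum _ _ PM[unfolded base_polytope_def] PL[unfolded base_polytope_def]])
      (simp_all add: finite_bases mM mL)
  have "\<exists>K. is_matroid K \<and> ground K = ground ?N \<and> Q = base_polytope K" if "Q \<in> C" for Q
  proof -
    have "Q \<noteq> {}" "Q face_of base_polytope ?M \<or> Q face_of base_polytope ?L"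
      using that unfolding C_def PM PL by blast+
    then show ?thesis using face_of_base_polytope[OF mM] face_of_base_polytope[OF mL] unfolding gr by metis
  qed
  then have subd: "matroid_subdivision C ?N"
    using sub unfolding matroid_subdivision_def P_def by blast
  obtain b where b: "b \<in> rel_interior P" "?f b = ?c"
    using rel_interior_base_polytope_paving[OF fam HN fin] unfolding P_def by blast
  have bP: "b \<in> P" using b(1) rel_interior_subset by blast
  have front: "\<not> Q \<subseteq> rel_frontier P" if "b \<in> Q" for Q
    using that b(1) by (auto simp: rel_frontier_def)
  have bin: "b \<in> base_polytope ?M" "b \<in> base_polytope ?L" "b \<in> base_polytope ?D"
    unfolding PM[symmetric] PL[symmetric] P0 using bP b(2) by auto
  have face0: "base_polytope ?D face_of P \<inter> {x. ?f x \<le> ?c}"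
    unfolding P0 by (rule hyperplane_face_of_le[OF conv linear_coord_sum])
  have inC: "base_polytope ?M \<in> C" "base_polytope ?L \<in> C" "base_polytope ?D \<in> C"
    using bin face0 unfolding C_def PM PL by (auto simp: base_polytope_def face_of_refl)
  have cells: "Q = base_polytope ?M \<or> Q = base_polytope ?L \<or> Q = base_polytope ?D"
    if Q: "Q \<in> C" "\<not> Q \<subseteq> rel_frontier P" for Q
  proof -
    have "Q \<subseteq> P" using Q(1) face_of_imp_subset unfolding C_def by blast
    then obtain q where q: "q \<in> Q" "q \<in> rel_interior P"
      using Q(2) closure_subset unfolding rel_frontier_def by blast
    have "Q face_of P \<inter> {x. ?f x \<le> ?c} \<or> Q face_of P \<inter> {x. - ?f x \<le> - ?c}"
      using Q(1) unfolding C_def by simp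
    then show ?thesis
    proof
      assume "Q face_of P \<inter> {x. ?f x \<le> ?c}"
      from face_of_halfspace_meets_rel_interior[OF conv linear_coord_sum this q]
      show ?thesis unfolding PM P0[symmetric] by blast
    next
      assume "Q face_of P \<inter> {x. - ?f x \<le> - ?c}"
      from face_of_halfspace_meets_rel_interior[OF conv linear_compose_neg[OF linear_coord_sum] this q]
      show ?thesis unfolding PL[symmetric] P0 by auto
    qed
  qed
  have int: "interior_cells C ?N = {?M, ?L, ?D}"
  proof
    show "interior_cells C ?N \<subseteq> {?M, ?L, ?D}"
    proof
      fix K assume "K \<in> interior_cells C ?N"
      then have K: "is_matroid K" "ground K = E" "base_polytope K \<in> C" "\<not> base_polytope K \<subseteq> rel_frontier P"
        unfolding interior_cells_def P_def gr by auto
      from cells[OF K(3,4)] show "K \<in> {?M, ?L, ?D}"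
        using base_polytope_inject[OF K(1) mM] base_polytope_inject[OF K(1) mL] base_polytope_inject[OF K(1) M0(1)]
          K(2) gr M0(2) by auto
    qed
    show "{?M, ?L, ?D} \<subseteq> interior_cells C ?N"
      using mM mL M0(1,2) gr inC front[OF bin(1)] front[OF bin(2)] front[OF bin(3)]
      unfolding interior_cells_def P_def by auto
  qed
  \<comment> \<open>The sum over the set of interior cells has three summands only if the three
    matroids differ. A base inside \<open>H\<close> gives a point \<open>p\<close> strictly beyond
    the hyperplane, and prolonging the segment from \<open>p\<close> past \<open>b\<close> gives a
    point strictly on the other side.\<close>
  obtain B where B: "B \<subseteq> H" "card B = k" "finite B"
    using obtain_subset_with_card_n[OF H(3)] by blast
  then have BL: "B \<in> bases ?L" using H unfolding bases_parallel_complement[OF finE H(1,3)]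
    by (auto simp: Diff_eq_empty_iff[THEN iffD2])
  define p where "p = indicator_vector B"
  have p: "p \<in> base_polytope ?L" unfolding p_def base_polytope_def using BL by (auto intro: hull_inc)
  have fp: "?f p > ?c" using B H k by (simp add: p_def coord_sum_indicator_vector Int_absorb1)
  obtain e where e: "e > 0" "b + e *\<^sub>R (b - p) \<in> P"
    using rel_interior_prolong[OF b(1), of p] p unfolding PL[symmetric] by (metis IntD1 order_refl less_imp_le)
  have "?f (b + e *\<^sub>R (b - p)) = ?c + e * (?c - ?f p)"
    using b(2) by (simp add: linear_add[OF linear_coord_sum] linear_cmul[OF linear_coord_sum] linear_diff[OF linear_coord_sum])
  then have lt: "?f (b + e *\<^sub>R (b - p)) < ?c" using e(1) fp by (simp add: mult_pos_neg)
  have "b + e *\<^sub>R (b - p) \<in> base_polytope ?M" "b + e *\<^sub>R (b - p) \<notin> base_polytope ?D"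
    using e(2) lt unfolding PM[symmetric] P0 by simp_all
  then have "base_polytope ?M \<noteq> base_polytope ?D" by metis
  moreover have "base_polytope ?L \<noteq> base_polytope ?D" "base_polytope ?L \<noteq> base_polytope ?M"
    using p fp unfolding PM[symmetric] P0 by auto
  ultimately have "?M \<noteq> ?L" "?M \<noteq> ?D" "?L \<noteq> ?D" by metis+
  then have "(\<Sum>K\<in>{?M, ?L, ?D}. g K) = g ?M + g ?L + g ?D" by simp
  then show ?thesis using covaluative[OF mN subd] unfolding int by simp
qed

text \<open>The new point \<open>f\<close> is parallel to \<open>e\<close>, and the base
  \<open>B\<close> shows that \<open>e\<close> is not a coloop. As contraction is defined by
  dualising deletion, the dual is a series extension of the dual.\<close>

lemma g_parallel_complement_insert:
  assumes "finite E" "k \<ge> 1" "e \<in> E - H" "f \<notin> E" "f \<notin> H"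
    and B: "B \<in> bases (parallel_complement k E H)" "e \<notin> B"
  shows "g (parallel_complement k (insert f E) H) = g (parallel_complement k E H)"
    and "g (dual (parallel_complement k (insert f E) H)) = g (dual (parallel_complement k E H))"
proof -
  let ?M = "parallel_complement k E H" and ?N = "parallel_complement k (insert f E) H"
  have M: "is_matroid ?M" "is_matroid ?N" using assms(1) by (simp_all add: is_matroid_parallel_complement)
  have gM: "ground ?M = E" by (simp add: parallel_complement_def)
  have nl: "\<not> is_loop ?M e"
    using assms by (intro not_loop) (auto simp: parallel_complement_def insert_Diff_if)
  have nc: "\<not> is_coloop ?M e" using not_coloop[OF B(1) _ B(2)] assms gM by simp
  have del: "deletion ?N f = ?M" using assms(4) by (rule deletion_parallel_complement)
  have circ: "{e, f} \<in> circuits ?N" using assms by (intro circuit_parallel_complement) auto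
  have "parallel_extension ?M e ?N"
    unfolding parallel_extension_def using M nl del circ assms gM by auto
  then show "g ?N = g ?M" using nc by (rule parallel)
  have D: "is_matroid (dual ?M)" "is_matroid (dual ?N)" "dual (dual ?M) = ?M" "dual (dual ?N) = ?N"
    using is_matroid_dual[OF M(1)] is_matroid_dual[OF M(2)] by auto
  have "series_extension (dual ?M) e (dual ?N)"
    unfolding series_extension_def is_coloop_def cocircuits_def contraction_def D
    using D nl del circ assms gM by auto
  moreover have "\<not> is_loop (dual ?M) e" using nc by (simp add: is_coloop_def)
  ultimately show "g (dual ?N) = g (dual ?M)" by (rule series)
qed

text \<open>The points of \<open>E - H\<close> other than \<open>e\<close> are added one by one,
  each parallel to \<open>e\<close>. A base inside \<open>H\<close>, which exists by
  \<open>k \<le> card H\<close>, avoids \<open>e\<close>.\<close>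

lemma g_parallel_complement:
  assumes "finite E" "k \<ge> 1" "H \<subseteq> E" "e \<in> E - H" "k \<le> card H"
  shows "g (parallel_complement k E H) = g (uniform_matroid k (insert e H))"
proof -
  have finH: "finite H" using assms finite_subset by blast
  have "g (parallel_complement k (insert e H \<union> F) H) = g (uniform_matroid k (insert e H))"
    if "finite F" "F \<inter> insert e H = {}" for F
    using that
  proof (induction F)
    case empty
    have "card (I - H) \<le> 1" if "I \<subseteq> insert e H" for I
    proof -
      have "I - H \<subseteq> {e}" using that by blast
      then show ?thesis using card_mono[of "{e}" "I - H"] by simp
    qed
    then have "parallel_complement k (insert e H) H = uniform_matroid k (insert e H)"
      unfolding parallel_complement_def uniform_matroid_def by auto
    then show ?case by simp
  next
    case (insert f F)
    obtain B where B: "B \<subseteq> H" "card B = k" using obtain_subset_with_card_n[OF assms(5)] by blast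
    have "finite (insert e H \<union> F)" "H \<subseteq> insert e H \<union> F" using finH insert by auto
    from bases_parallel_complement[OF this assms(5)] B
    have "B \<in> bases (parallel_complement k (insert e H \<union> F) H)"
      by (auto simp: Diff_eq_empty_iff[THEN iffD2])
    then have "g (parallel_complement k (insert f (insert e H \<union> F)) H) = g (parallel_complement k (insert e H \<union> F) H)"
      using insert assms finH B by (intro g_parallel_complement_insert(1)[of _ _ e _ _ B]) auto
    moreover have "insert e H \<union> insert f F = insert f (insert e H \<union> F)" by blast
    ultimately show ?case using insert by simp
  qed
  moreover have "insert e H \<union> (E - insert e H) = E" using assms by blast
  ultimately show ?thesis using assms(1) by (metis Diff_disjoint Int_commute finite_Diff)
qed

lemma g_uniform_rank_1:
  assumes "finite E" "card E \<ge> 2"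
  shows "g (uniform_matroid 1 E) = [:0, 1:]"
proof -
  obtain A where A: "A \<subseteq> E" "card A = 2" "finite A" using obtain_subset_with_card_n[OF assms(2)] by blast
  then obtain a b where ab: "A = {a, b}" "a \<noteq> b" by (meson card_2_iff)
  have eq: "uniform_matroid 1 F = parallel_complement 1 F {}" for F :: "'a set"
    by (simp add: uniform_matroid_def parallel_complement_def)
  have "g (uniform_matroid 1 (A \<union> F)) = [:0, 1:]" if "finite F" "F \<inter> A = {}" for F
    using that
  proof (induction F)
    case empty
    then show ?case using uniform_1_2 A by simp
  next
    case (insert f F)
    have "finite (A \<union> F)" "1 \<le> card (A \<union> F)"
      using A insert by (auto intro: le_trans[OF _ card_mono[of _ A]])
    then have "{b} \<in> bases (parallel_complement 1 (A \<union> F) {})"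
      using ab unfolding eq[symmetric] by (simp add: bases_uniform)
    then have "g (parallel_complement 1 (insert f (A \<union> F)) {}) = g (parallel_complement 1 (A \<union> F) {})"
      using insert A ab by (intro g_parallel_complement_insert(1)[of _ _ a _ _ "{b}"]) auto
    then show ?case unfolding eq Un_insert_right using insert by (simp add: eq[symmetric] del: One_nat_def)
  qed
  moreover have "A \<union> (E - A) = E" using A by blast
  ultimately show ?thesis using assms(1) by (metis Diff_disjoint Int_commute finite_Diff)
qed

text \<open>Before \<open>b\<close> is added in parallel to \<open>a\<close>, the matroid is uniform
  of rank \<open>card E - k\<close> on \<open>card E - 1\<close> points, with a uniform dual of rank
  \<open>k - 1\<close>. Dually, \<open>b\<close> is added in series.\<close>

lemma g_dual_parallel_complement:
  assumes "finite E" "2 \<le> k" "k + 1 \<le> card E" "a \<in> E" "b \<in> E" "a \<noteq> b"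
  shows "g (dual (parallel_complement (card E - k) E (E - {a, b}))) = g (uniform_matroid (k - 1) (E - {b}))"
proof -
  let ?m = "card E - k" and ?H = "E - {a, b}" and ?E = "E - {b}"
  have cH: "card ?H = card E - 2" using assms by (simp add: card_Diff_subset)
  have mH: "?m \<le> card ?H" using cH assms by simp
  obtain B where B: "B \<subseteq> ?H" "card B = ?m"
    using obtain_subset_with_card_n[OF mH] by blast
  have "B \<in> bases (parallel_complement ?m ?E ?H)"
  proof -
    have "finite ?E" "?H \<subseteq> ?E" "B \<subseteq> ?E" "B - ?H = {}" using assms B by auto
    moreover have "card (B - ?H) \<le> 1" using B(1) by (simp add: Diff_eq_empty_iff[THEN iffD2])
    ultimately show ?thesis using bases_parallel_complement[OF _ _ mH] B(2) by blast
  qed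
  then have "g (dual (parallel_complement ?m (insert b ?E) ?H)) = g (dual (parallel_complement ?m ?E ?H))"
    using assms B by (intro g_parallel_complement_insert(2)[of _ _ a _ _ B]) auto
  moreover have "insert b ?E = E" using assms by blast
  moreover have "parallel_complement ?m ?E ?H = uniform_matroid ?m ?E"
  proof -
    have "card (I - ?H) \<le> 1" if "I \<subseteq> ?E" for I
    proof -
      have "I - ?H \<subseteq> {a}" using that by blast
      then show ?thesis using card_mono[of "{a}" "I - ?H"] by simp
    qed
    then show ?thesis unfolding parallel_complement_def uniform_matroid_def by auto
  qed
  moreover have "dual (uniform_matroid ?m ?E) = uniform_matroid (k - 1) ?E"
    using dual_uniform[of ?E ?m] assms by simp
  ultimately show ?thesis by simp
qed

end

text \<open>These are also the bases of the paving matroid with the single block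
  \<open>E - {a, b}\<close>, which is thus recognised as a series extension of a uniform
  matroid.\<close>

lemma bases_dual_parallel_complement:
  assumes "finite E" "2 \<le> k" "k + 1 \<le> card E" "a \<in> E" "b \<in> E" "a \<noteq> b"
  shows "bases (dual (parallel_complement (card E - k) E (E - {a, b})))
    = {B. B \<subseteq> E \<and> card B = k \<and> \<not> B \<subseteq> E - {a, b}}" (is "_ = ?R")
proof -
  let ?m = "card E - k" and ?H = "E - {a, b}"
  have mH: "?m \<le> card ?H" using assms by (simp add: card_Diff_subset)
  have gr: "ground (parallel_complement ?m E ?H) = E" by (simp add: parallel_complement_def)
  have c: "card (B - ?H) \<le> 1 \<longleftrightarrow> \<not> {a, b} \<subseteq> B" if B: "B \<subseteq> E" for B
  proof -
    have eq: "B - ?H = B \<inter> {a, b}" using B by blast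
    show ?thesis
    proof
      assume "card (B - ?H) \<le> 1"
      then show "\<not> {a, b} \<subseteq> B" using assms(6) unfolding eq by (auto simp: Int_absorb1)
    next
      assume "\<not> {a, b} \<subseteq> B"
      then have "B \<inter> {a, b} \<subset> {a, b}" by blast
      then have "card (B \<inter> {a, b}) < card {a, b}" by (intro psubset_card_mono) auto
      then show "card (B - ?H) \<le> 1" unfolding eq using assms(6) by simp
    qed
  qed
  have bs: "bases (parallel_complement ?m E ?H) = {B. B \<subseteq> E \<and> card B = ?m \<and> \<not> {a, b} \<subseteq> B}"
    unfolding bases_parallel_complement[OF assms(1) Diff_subset mH] using c by blast
  have "bases (dual (parallel_complement ?m E ?H)) = (\<lambda>B. E - B) ` {B. B \<subseteq> E \<and> card B = ?m \<and> \<not> {a, b} \<subseteq> B}"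
    unfolding is_matroid_dual(2)[OF is_matroid_parallel_complement[OF assms(1)]] bs gr ..
  also have "\<dots> = ?R"
  proof (intro set_eqI iffI)
    fix C assume "C \<in> (\<lambda>B. E - B) ` {B. B \<subseteq> E \<and> card B = ?m \<and> \<not> {a, b} \<subseteq> B}"
    then obtain B where B: "C = E - B" "B \<subseteq> E" "card B = ?m" "\<not> {a, b} \<subseteq> B" by blast
    then have "card C = k" using assms(1,3) finite_subset[OF B(2)] by (simp add: card_Diff_subset)
    moreover have "\<not> C \<subseteq> ?H" using B(1,4) assms(4,5) by blast
    ultimately show "C \<in> ?R" using B by blast
  next
    fix C assume C: "C \<in> ?R"
    then have "card (E - C) = ?m" using assms(1) finite_subset[of C E] by (simp add: card_Diff_subset)
    moreover have "\<not> {a, b} \<subseteq> E - C" "C = E - (E - C)" using C by blast+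
    ultimately show "C \<in> (\<lambda>B. E - B) ` {B. B \<subseteq> E \<and> card B = ?m \<and> \<not> {a, b} \<subseteq> B}" by blast
  qed
  finally show ?thesis .
qed

section \<open>Coefficients of g for uniform and paving matroids\<close>

context g_polynomial
begin

lemma g_relax_terms:
  assumes fam: "paving_family k E (insert H \<H>)" and e: "e \<in> E - H"
  shows "g (parallel_complement k E H) = g (uniform_matroid k (insert e H))"
    and "g (direct_sum (uniform_matroid (k - 1) H) (uniform_matroid 1 (E - H))) = g (uniform_matroid (k - 1) H) * [:0, 1:]"
proof -
  have finE: "finite E" and k: "2 \<le> k" using paving_familyD[OF fam] by auto
  have H: "H \<subseteq> E" "finite H" "k \<le> card H" "card H + 2 \<le> card E"
    using paving_familyD(4-7)[OF fam, of H] by auto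
  show "g (parallel_complement k E H) = g (uniform_matroid k (insert e H))"
    using k by (intro g_parallel_complement finE H e) simp
  have "card (E - H) \<ge> 2" using H by (simp add: card_Diff_subset)
  then have "g (uniform_matroid 1 (E - H)) = [:0, 1:]" using finE by (intro g_uniform_rank_1) auto
  moreover have "ground (uniform_matroid (k - 1) H) \<inter> ground (uniform_matroid 1 (E - H)) = {}"
    by (auto simp: uniform_matroid_def)
  ultimately show "g (direct_sum (uniform_matroid (k - 1) H) (uniform_matroid 1 (E - H)))
      = g (uniform_matroid (k - 1) H) * [:0, 1:]"
    using direct_sum[OF is_matroid_uniform is_matroid_uniform] finE H(2) by (metis finite_Diff)
qed

lemma coeff_g_uniform:
  assumes "finite E" "1 \<le> k" "k + 1 \<le> card E"
  shows "coeff (g (uniform_matroid k E)) i = int (uniform_coeff k (card E) i)"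
  using assms
proof (induction "card E" arbitrary: k E i rule: less_induct)
  case less
  note finE = less.prems(1)
  consider "k = 1" | "2 \<le> k" using less.prems by linarith
  then show ?case
  proof cases
    case 1
    have "g (uniform_matroid k E) = [:0, 1:]"
      unfolding 1 using less.prems 1 by (intro g_uniform_rank_1) auto
    moreover have "coeff [:0, 1:: int:] i = int (uniform_coeff k (card E) i)"
      unfolding 1 uniform_coeff_def by (cases i; cases "i - 1") (auto simp: coeff_pCons split: nat.splits)
    ultimately show ?thesis by simp
  next
    case 2
    obtain A where A: "A \<subseteq> E" "card A = 2"
      using obtain_subset_with_card_n[of 2 E] less.prems 2 by auto
    then obtain a b where "A = {a, b}" and ab: "a \<noteq> b" by (meson card_2_iff)
    then have abE: "a \<in> E" "b \<in> E" using A by auto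
    let ?H = "E - {a, b}"
    let ?S = "dual (parallel_complement (card E - k) E ?H)"
    have cH: "card ?H = card E - 2" using abE ab finE by (simp add: card_Diff_subset)
    have S: "is_matroid ?S" by (rule is_matroid_dual(1)[OF is_matroid_parallel_complement[OF finE]])
    have grS: "ground ?S = E" by (simp add: parallel_complement_def)
    have bS: "bases ?S = {B. B \<subseteq> E \<and> card B = k \<and> \<not> B \<subseteq> ?H}"
      using finE 2 less.prems(3) abE ab by (intro bases_dual_parallel_complement)
    have gS: "g ?S = g (uniform_matroid (k - 1) (E - {b}))"
      using finE 2 less.prems(3) abE ab by (intro g_dual_parallel_complement)
    have cb: "card (E - {b}) = card E - 1" using abE finE by simp
    have IH1: "coeff (g (uniform_matroid (k - 1) (E - {b}))) i = int (uniform_coeff (k - 1) (card E - 1) i)" for i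
      using less.hyps[of "E - {b}" "k - 1" i] less.prems 2 cb by auto
    consider "card E = k + 1" | "k + 2 \<le> card E" using less.prems by linarith
    then show ?thesis
    proof cases
      \<comment> \<open>Now \<open>?H\<close> has only \<open>k - 1\<close> elements and is not a
        block. Every \<open>k\<close>-set meets the two remaining points, so the uniform matroid
        itself is the series extension.\<close>
      case 1
      have "uniform_matroid k E = ?S"
      proof (rule matroid_eqI[OF is_matroid_uniform[OF finE] S])
        show "ground (uniform_matroid k E) = ground ?S" unfolding grS by (simp add: uniform_matroid_def)
        have "\<not> B \<subseteq> ?H" if "card B = k" for B
        proof
          assume "B \<subseteq> ?H"
          then have "card B \<le> card ?H" using finE by (intro card_mono) auto
          then show False using that cH 1 2 by simp
        qed
        then show "bases (uniform_matroid k E) = bases ?S"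
          unfolding bS using 1 by (auto simp: bases_uniform[OF finE])
      qed
      then have "coeff (g (uniform_matroid k E)) i = int (uniform_coeff (k - 1) k i)"
        using gS IH1 1 by simp
      moreover have "uniform_coeff (k - 1) k i = uniform_coeff k (k + 1) i"
      proof (cases "i \<ge> 2")
        case True
        have h1: "(k + 1 - i - 1) choose (k - 1) = 0" using True 2 by (intro binomial_eq_0) auto
        \<comment> \<open>For \<open>k = 2\<close> the second factor is \<open>0 choose 0\<close> by
          truncation, and it is the first factor that vanishes.\<close>
        have h2: "((k - 1 - 1) choose (i - 1)) * ((k - i - 1) choose (k - 1 - 1)) = 0"
        proof (cases "k = 2")
          case False
          then have "(k - i - 1) choose (k - 1 - 1) = 0" using True 2 by (intro binomial_eq_0) auto
          then show ?thesis by (simp only: mult_0_right)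
        qed (use True in \<open>simp add: binomial_eq_0\<close>)
        show ?thesis by (simp only: uniform_coeff_def h1 h2 mult_0_right if_cancel)
      next
        case False
        then have "i = 0 \<or> i = 1" by linarith
        then show ?thesis using 2 by (auto simp: uniform_coeff_def numeral_2_eq_2)
      qed
      ultimately show ?thesis using 1 by simp
    next
      case big: 2
      have fam: "paving_family k E {?H}"
        unfolding paving_family_def using finE 2 big cH abE by auto
      have "paving_matroid k E {?H} = ?S"
      proof (rule matroid_eqI[OF is_matroid_paving[OF fam] S])
        show "ground (paving_matroid k E {?H}) = ground ?S" unfolding grS by (simp add: paving_matroid_def)
        show "bases (paving_matroid k E {?H}) = bases ?S" unfolding bS bases_paving[OF fam] by simp
      qed
      then have eq: "g (uniform_matroid k E) = g (uniform_matroid (k - 1) (E - {b}))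
          + g (uniform_matroid k (insert a ?H)) + g (uniform_matroid (k - 1) ?H) * [:0, 1:]"
        using g_relax[OF fam] g_relax_terms[OF fam, of a] gS abE by (simp add: uniform_eq_paving)
      have ca: "insert a ?H = E - {b}" using abE ab by blast
      have IH2: "coeff (g (uniform_matroid k (insert a ?H))) i = int (uniform_coeff k (card E - 1) i)"
        unfolding ca using less.hyps[of "E - {b}" k i] less.prems big cb by auto
      have IH3: "coeff (g (uniform_matroid (k - 1) ?H)) i = int (uniform_coeff (k - 1) (card E - 2) i)" for i
        using less.hyps[of ?H "k - 1" i] less.prems 2 big cH by auto
      \<comment> \<open>Multiplication by t shifts the index. At \<open>i = 0\<close> the truncated
        \<open>i - 1\<close> is 0, where \<open>uniform_coeff\<close> is 0 like the constant
        coefficient of the product.\<close>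
      have "coeff (g (uniform_matroid (k - 1) ?H) * [:0, 1:]) i = int (uniform_coeff (k - 1) (card E - 2) (i - 1))"
        using IH3 by (cases i) (simp_all add: uniform_coeff_def)
      then have "coeff (g (uniform_matroid k E)) i = int (uniform_coeff (k - 1) (card E - 1) i
          + uniform_coeff k (card E - 1) i + uniform_coeff (k - 1) (card E - 2) (i - 1))"
        unfolding eq using IH1 IH2 by simp
      moreover have "uniform_coeff (k - 1) (card E - 1) i + uniform_coeff k (card E - 1) i
          + uniform_coeff (k - 1) (card E - 2) (i - 1) = uniform_coeff k (card E) i"
        using uniform_coeff_recursion[OF 2, of "card E" i] big by (cases "i = 0") (auto simp: uniform_coeff_def)
      ultimately show ?thesis by simp
    qed
  qed
qed

text \<open>Each inserted block moves its two contributions, from the half cut off and from the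
  facet, to the left. With the sum on the left, nonnegativity becomes a comparison of natural
  numbers.\<close>

lemma coeff_g_paving:
  assumes "paving_family k E \<H>" "finite \<H>"
  shows "coeff (g (paving_matroid k E \<H>)) i
    + int (\<Sum>H\<in>\<H>. uniform_coeff k (card H + 1) i + uniform_coeff (k - 1) (card H) (i - 1))
    = int (uniform_coeff k (card E) i)"
  using assms(2,1)
proof (induction \<H>)
  case empty
  then show ?case
    using coeff_g_uniform[of E k i] paving_familyD(1-3)[OF empty] by (simp add: uniform_eq_paving)
next
  case (insert H \<H>)
  note fam = insert.prems
  have fam': "paving_family k E \<H>" using paving_family_mono[OF fam] by blast
  have finE: "finite E" and k: "2 \<le> k" using paving_familyD[OF fam] by auto
  have H: "H \<subseteq> E" "finite H" "k \<le> card H" "card H + 2 \<le> card E"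
    using paving_familyD(4-7)[OF fam, of H] by auto
  have "\<not> E \<subseteq> H" using H card_mono[of H E] by auto
  then obtain e where e: "e \<in> E - H" by blast
  have "coeff (g (uniform_matroid (k - 1) H) * [:0, 1:]) i = int (uniform_coeff (k - 1) (card H) (i - 1))"
    using coeff_g_uniform[of H "k - 1"] H k by (cases i) (simp_all add: uniform_coeff_def)
  moreover have "coeff (g (uniform_matroid k (insert e H))) i = int (uniform_coeff k (card H + 1) i)"
    using coeff_g_uniform[of "insert e H" k i] H k e by simp
  ultimately show ?case
    using insert.IH[OF fam'] g_relax[OF fam insert.hyps(2,1)] g_relax_terms[OF fam e] insert.hyps by simp
qed

lemma coeff_g_paving_nonneg:
  assumes fam: "paving_family k E \<H>"
  shows "coeff (g (paving_matroid k E \<H>)) i \<ge> 0"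
proof -
  have finE: "finite E" and k: "2 \<le> k" using paving_familyD[OF fam] by auto
  have "\<H> \<subseteq> Pow E" using paving_familyD(4)[OF fam] by blast
  then have fin: "finite \<H>" using finE finite_subset by blast
  have "(\<Sum>H\<in>\<H>. uniform_coeff k (card H + 1) i + uniform_coeff (k - 1) (card H) (i - 1))
      \<le> uniform_coeff k (card E) i"
  proof (cases "i = 0")
    case False
    then show ?thesis
      using finE fin k paving_familyD(4-)[OF fam] by (intro sum_uniform_coeff_le) auto
  qed (simp add: uniform_coeff_def)
  then show ?thesis using coeff_g_paving[OF fam fin, of i] by linarith
qed

end

section \<open>Connected paving matroids\<close>

lemma dependent_contains_circuit:
  assumes "finite S" "S \<subseteq> ground M" "S \<notin> indep M"
  obtains C where "C \<in> circuits M" "C \<subseteq> S"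
proof -
  have "\<exists>C\<in>circuits M. C \<subseteq> S" using assms
  proof (induction S rule: finite_psubset_induct)
    case (psubset S)
    show ?case
    proof (cases "\<exists>D. D \<subset> S \<and> D \<notin> indep M")
      case True
      then obtain D where "D \<subset> S" "D \<notin> indep M" by blast
      then show ?thesis using psubset.IH[of D] psubset.prems by blast
    next
      case False
      then show ?thesis using psubset.prems by (auto simp: circuits_def)
    qed
  qed
  then show ?thesis using that by blast
qed

text \<open>The blocks are the maximal sets that have at least \<open>k\<close> elements and contain
  no base. Since all sets with fewer than \<open>k\<close> elements are independent, the blocks
  determine the matroid.\<close>

lemma paving_matroid_structure:
  assumes M: "is_matroid M" and pav: "paving M" and conn: "connected_matroid M"
    and rank: "2 \<le> matroid_rank M"
    and nc: "\<And>e. e \<in> ground M \<Longrightarrow> \<exists>B\<in>bases M. e \<notin> B"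
  obtains \<H> where "paving_family (matroid_rank M) (ground M) \<H>"
    "M = paving_matroid (matroid_rank M) (ground M) \<H>"
proof -
  define k E where "k = matroid_rank M" and "E = ground M"
  have finE: "finite E" using finite_ground[OF M] by (simp add: E_def)
  have fin: "finite S" if "S \<subseteq> E" for S using that finE finite_subset by blast
  have small: "S \<in> indep M" if S: "S \<subseteq> E" "card S < k" for S
  proof (rule ccontr)
    assume "S \<notin> indep M"
    then obtain C where C: "C \<in> circuits M" "C \<subseteq> S"
      using dependent_contains_circuit[of S M] S fin unfolding E_def by blast
    then have "k \<le> card C" using pav by (simp add: paving_def k_def)
    moreover have "card C \<le> card S" using C fin[OF S(1)] by (intro card_mono)
    ultimately show False using S by simp
  qed
  have base: "B \<in> bases M \<longleftrightarrow> B \<in> indep M \<and> card B = k" for B by (simp add: bases_iff[OF M] k_def)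
  have baseE: "B \<subseteq> E" if "B \<in> bases M" for B using base_subset_ground[OF M that] by (simp add: E_def)
  define Q where "Q S \<longleftrightarrow> S \<subseteq> E \<and> k \<le> card S \<and> (\<forall>B\<in>bases M. \<not> B \<subseteq> S)" for S
  define \<H> where "\<H> = {H. Q H \<and> (\<forall>S. Q S \<longrightarrow> H \<subseteq> S \<longrightarrow> S = H)}"
  have ext: "\<exists>H\<in>\<H>. S \<subseteq> H" if "Q S" for S
    using that
  proof (induction "card E - card S" arbitrary: S rule: less_induct)
    case less
    show ?case
    proof (cases "\<exists>T. Q T \<and> S \<subset> T")
      case True
      then obtain T where T: "Q T" "S \<subset> T" by blast
      then have "card S < card T" "card T \<le> card E"
        using fin[of T] finE by (auto intro: psubset_card_mono card_mono simp: Q_def)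
      then have "card E - card T < card E - card S" by linarith
      then show ?thesis using less.hyps[of T] T by blast
    next
      case False
      then show ?thesis using less.prems by (auto simp: \<H>_def)
    qed
  qed
  have HD: "H \<subseteq> E" "k \<le> card H" "\<And>B. B \<in> bases M \<Longrightarrow> \<not> B \<subseteq> H" if "H \<in> \<H>" for H
    using that by (auto simp: \<H>_def Q_def)
  have pw: "card (H \<inter> H') + 2 \<le> k" if H: "H \<in> \<H>" "H' \<in> \<H>" "H \<noteq> H'" for H H'
  proof (rule ccontr)
    assume "\<not> card (H \<inter> H') + 2 \<le> k"
    then have "k - 1 \<le> card (H \<inter> H')" by simp
    then obtain S where S: "S \<subseteq> H \<inter> H'" "card S = k - 1" "finite S"
      using obtain_subset_with_card_n by metis
    then have Si: "S \<in> indep M" using HD[OF H(1)] rank by (intro small) (auto simp: k_def)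
    \<comment> \<open>A base in the union would extend \<open>S\<close> by a single element to
      another base; as \<open>S\<close> lies in both blocks, that base would lie in one of them. So
      the union contains no base, against maximality.\<close>
    have "\<not> B \<subseteq> H \<union> H'" if B: "B \<in> bases M" for B
    proof
      assume BH: "B \<subseteq> H \<union> H'"
      have "card S < card B" using S B base rank by (auto simp: k_def)
      then obtain x where x: "x \<in> B - S" "insert x S \<in> indep M"
        using indep_augment[OF M Si, of B] B base by blast
      then have "insert x S \<in> bases M" using S rank by (simp add: base k_def)
      then show False using HD(3)[OF H(1)] HD(3)[OF H(2)] x BH S by blast
    qed
    moreover have "k \<le> card (H \<union> H')"
      using HD[OF H(1)] HD(1)[OF H(2)] fin[of "H \<union> H'"] card_mono[of "H \<union> H'" H] by auto
    ultimately have "Q (H \<union> H')" using HD(1)[OF H(1)] HD(1)[OF H(2)] by (simp add: Q_def)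
    then have "H \<union> H' = H" "H \<union> H' = H'" using H by (auto simp: \<H>_def)
    then show False using H(3) by blast
  qed
  have ind: "indep M = {I. I \<subseteq> E \<and> card I \<le> k \<and> (card I = k \<longrightarrow> (\<forall>H\<in>\<H>. \<not> I \<subseteq> H))}" (is "_ = ?R")
  proof (intro set_eqI iffI)
    fix I assume I: "I \<in> indep M"
    then have "I \<subseteq> E" "card I \<le> k"
      using indep_subset_ground[OF M] card_indep_le_rank[OF M] by (auto simp: E_def k_def)
    moreover have "\<not> I \<subseteq> H" if "card I = k" "H \<in> \<H>" for H
      using HD(3)[OF that(2), of I] I that(1) base by blast
    ultimately show "I \<in> ?R" by blast
  next
    fix I assume I: "I \<in> ?R"
    show "I \<in> indep M"
    proof (cases "card I = k")
      case True
      show ?thesis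
      proof (rule ccontr)
        assume no: "I \<notin> indep M"
        have "\<not> B \<subseteq> I" if "B \<in> bases M" for B
        proof
          assume "B \<subseteq> I"
          then have "B = I" using that True I fin by (intro card_subset_eq) (auto simp: base)
          then show False using no that base by blast
        qed
        then have "Q I" using I True by (auto simp: Q_def)
        then show False using ext I True by blast
      qed
    next
      case False
      then show ?thesis using I by (intro small) auto
    qed
  qed
  have eq: "M = paving_matroid k E \<H>"
    unfolding paving_matroid_def ind[symmetric] by (simp add: E_def)
  have notE: "H \<noteq> E" if "H \<in> \<H>" for H
    using HD(3)[OF that] baseE bases_nonempty[OF M] by blast
  have "paving_family k E \<H>"
    unfolding paving_family_def
  proof (intro conjI ballI impI)
    show "finite E" "2 \<le> k" using finE rank by (auto simp: k_def)
    obtain B where B: "B \<in> bases M" using bases_nonempty[OF M] by blast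
    then have "card B = k" "finite B" "B \<subseteq> E" using base baseE fin by auto
    then obtain e where "e \<in> B" using rank unfolding k_def by fastforce
    then obtain B' where "B' \<in> bases M" "e \<notin> B'" using nc[of e] \<open>B \<subseteq> E\<close> E_def by blast
    then have "insert e B' \<subseteq> E" "card (insert e B') = k + 1" using baseE base fin[of B'] \<open>e \<in> B\<close> \<open>B \<subseteq> E\<close> by auto
    then show "k + 1 \<le> card E" using card_mono[OF finE] by metis
  next
    fix H assume H: "H \<in> \<H>"
    show "H \<subseteq> E" "k \<le> card H" using HD[OF H] by auto
    have "H \<subset> E" using HD(1)[OF H] notE[OF H] by blast
    then obtain e where e: "e \<in> E" "e \<notin> H" by blast
    \<comment> \<open>The point \<open>e\<close> outside \<open>H\<close> is not a coloop: a base
      avoiding \<open>e\<close> supplies a second point outside \<open>H\<close>.\<close>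
    then obtain B where B: "B \<in> bases M" "e \<notin> B" using nc unfolding E_def by blast
    then obtain y where y: "y \<in> B" "y \<notin> H" using HD(3)[OF H B(1)] by blast
    then have "e \<noteq> y" using B(2) by blast
    then have "insert e (insert y H) \<subseteq> E" "card (insert e (insert y H)) = card H + 2"
      using e y B baseE[OF B(1)] HD(1)[OF H] fin[of H] by auto
    then show "card H + 2 \<le> card E" using card_mono[OF finE] by metis
  next
    fix H H' assume "H \<in> \<H>" "H' \<in> \<H>" "H \<noteq> H'"
    then show "card (H \<inter> H') + 2 \<le> k" by (rule pw)
  next
    fix H H' assume k2: "k = 2" and H: "H \<in> \<H>" "H' \<in> \<H>"
    \<comment> \<open>Two such blocks would be disjoint and the only ones, so they would be the
      parallel classes and \<open>M\<close> the direct sum of two uniform matroids of rank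
      1.\<close>
    show "H \<union> H' \<noteq> E"
    proof
      assume U: "H \<union> H' = E"
      have ne: "H \<noteq> H'" using U notE[OF H(1)] by auto
      have disj: "H \<inter> H' = {}" using pw[OF H ne] k2 fin[OF HD(1)[OF H(1)]] by simp
      have hne: "H \<noteq> {}" "H' \<noteq> {}" using HD(2)[OF H(1)] HD(2)[OF H(2)] k2 by auto
      have only: "K = H \<or> K = H'" if K: "K \<in> \<H>" for K
      proof (rule ccontr)
        assume no: "\<not> (K = H \<or> K = H')"
        then have "K \<inter> H = {}" "K \<inter> H' = {}"
          using pw[OF K H(1)] pw[OF K H(2)] k2 fin[OF HD(1)[OF K]] by auto
        then have "K = {}" using HD(1)[OF K] U by blast
        then show False using HD(2)[OF K] k2 by simp
      qed
      let ?M1 = "uniform_matroid 1 H" and ?M2 = "uniform_matroid 1 H'"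
      have "indep M = indep (direct_sum ?M1 ?M2)"
      proof (intro set_eqI iffI)
        fix I assume "I \<in> indep M"
        then have I: "I \<subseteq> E" "card I \<le> 2" "card I = 2 \<Longrightarrow> \<not> I \<subseteq> H \<and> \<not> I \<subseteq> H'"
          unfolding ind using k2 H by auto
        have "card (I \<inter> H) \<le> 1" if "H \<in> \<H>" for H
        proof (rule ccontr)
          assume "\<not> card (I \<inter> H) \<le> 1"
          moreover have "card (I \<inter> H) \<le> card I" using fin[OF I(1)] by (intro card_mono) auto
          ultimately have "card (I \<inter> H) = card I" "card I = 2" using I(2) by auto
          then have "I \<inter> H = I" using fin[OF I(1)] by (intro card_subset_eq) auto
          then show False using I(3) \<open>card I = 2\<close> only[OF that] by blast
        qed
        then have "card (I \<inter> H) \<le> 1" "card (I \<inter> H') \<le> 1" using H by auto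
        moreover have "I = (I \<inter> H) \<union> (I \<inter> H')" using I(1) U by blast
        ultimately have "\<exists>I1 I2. I = I1 \<union> I2 \<and> I1 \<in> indep ?M1 \<and> I2 \<in> indep ?M2"
          by (intro exI[of _ "I \<inter> H"] exI[of _ "I \<inter> H'"]) (simp add: uniform_matroid_def)
        then show "I \<in> indep (direct_sum ?M1 ?M2)" by (simp add: direct_sum_def)
      next
        fix I assume "I \<in> indep (direct_sum ?M1 ?M2)"
        then obtain I1 I2 where I: "I = I1 \<union> I2" "I1 \<subseteq> H" "card I1 \<le> 1" "I2 \<subseteq> H'" "card I2 \<le> 1"
          by (auto simp: direct_sum_def uniform_matroid_def)
        have sub: "I \<subseteq> E" using I U by blast
        have "card I \<le> card I1 + card I2" using I(1) card_Un_le by blast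
        moreover have "\<not> I \<subseteq> K" if "card I = 2" "K \<in> \<H>" for K
        proof
          assume "I \<subseteq> K"
          then have "I \<subseteq> H \<or> I \<subseteq> H'" using only[OF that(2)] by blast
          then have "I = I1 \<or> I = I2" using I disj by blast
          then show False using that(1) I by auto
        qed
        ultimately show "I \<in> indep M" unfolding ind using sub I k2 by auto
      qed
      moreover have "ground M = ground (direct_sum ?M1 ?M2)"
        using U by (simp add: direct_sum_def uniform_matroid_def E_def)
      ultimately have "M = direct_sum ?M1 ?M2" by (simp add: matroid.expand)
      moreover have "is_matroid ?M1" "is_matroid ?M2"
        using fin[OF HD(1)[OF H(1)]] fin[OF HD(1)[OF H(2)]] by (simp_all add: is_matroid_uniform)
      moreover have "ground ?M1 = H" "ground ?M2 = H'" by (simp_all add: uniform_matroid_def)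
      ultimately show False using conn hne disj unfolding connected_matroid_def by metis
    qed
  qed
  then show ?thesis using that eq unfolding k_def E_def by blast
qed

theorem theorem1p4:
  fixes g :: "'a::infinite matroid \<Rightarrow> int poly" and M :: "'a matroid"
  assumes "g_polynomial g"
    and "is_matroid M" and "connected_matroid M" and "paving M"
  shows "\<forall>i. coeff (g M) i \<ge> 0"
proof -
  interpret g_polynomial g by fact
  note M = \<open>is_matroid M\<close>
  consider "\<exists>e. is_loop M e \<or> is_coloop M e" | "ground M = {}"
    | "ground M \<noteq> {}" "\<And>e. \<not> is_loop M e" "\<And>e. \<not> is_coloop M e" by blast
  then show ?thesis
  proof cases
    case 1
    then have "g M = 0" using loop_coloop[OF M] by blast
    then show ?thesis by simp
  next
    case 2
    \<comment> \<open>The value on the empty matroid follows from multiplicativity: adding it to a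
      uniform matroid of rank 1 changes nothing, and its factor t can be cancelled.\<close>
    obtain U :: "'a set" where U: "finite U" "card U = 2"
      using arb_finite_subset[of "{} :: 'a set" 2] obtain_subset_with_card_n by (metis finite.emptyI)
    have "indep M = {{}}" using 2 indep_subset_ground[OF M] indep_empty[OF M] by auto
    then have "direct_sum (uniform_matroid 1 U) M = uniform_matroid 1 U"
      using 2 by (simp add: direct_sum_def uniform_matroid_def)
    then have "g (uniform_matroid 1 U) * g M = g (uniform_matroid 1 U)"
      using direct_sum[OF is_matroid_uniform[OF U(1)] M, of 1] 2 by simp
    then have "g M = 1" using uniform_1_2[OF U(2)] by simp
    then show ?thesis by (simp add: coeff_1)
  next
    case 3
    have nl: "{e} \<in> indep M" if "e \<in> ground M" for e
    proof (rule ccontr)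
      assume "{e} \<notin> indep M"
      then have "is_loop M e"
        unfolding is_loop_def circuits_def using that indep_empty[OF M] by (auto simp: psubset_eq subset_singleton_iff)
      then show False using 3(2) by blast
    qed
    have nc: "\<exists>B\<in>bases M. e \<notin> B" if e: "e \<in> ground M" for e
    proof (rule ccontr)
      assume no: "\<not> ?thesis"
      then have "{e} \<notin> indep (dual M)" by (auto simp: dual_def)
      then have "is_coloop M e"
        unfolding is_coloop_def is_loop_def circuits_def using e indep_empty[OF is_matroid_dual(1)[OF M]]
        by (auto simp: psubset_eq subset_singleton_iff)
      then show False using 3(3) by blast
    qed
    obtain e where e: "e \<in> ground M" using 3(1) by blast
    have "matroid_rank M \<ge> 1" using card_indep_le_rank[OF M nl[OF e]] by simp
    then consider "matroid_rank M = 1" | "matroid_rank M \<ge> 2" by linarith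
    then show ?thesis
    proof cases
      \<comment> \<open>Paving families have rank at least 2. In rank 1 without loops the matroid is
        uniform, and the absence of coloops provides a second element.\<close>
      case 1
      have "indep M = {I. I \<subseteq> ground M \<and> card I \<le> 1}"
      proof (intro set_eqI iffI)
        fix I assume "I \<in> indep M"
        then show "I \<in> {I. I \<subseteq> ground M \<and> card I \<le> 1}"
          using indep_subset_ground[OF M] card_indep_le_rank[OF M] 1 by auto
      next
        fix I assume I: "I \<in> {I. I \<subseteq> ground M \<and> card I \<le> 1}"
        then have "finite I" using finite_ground[OF M] finite_subset by blast
        then have "I = {} \<or> (\<exists>x. I = {x})" using I by (metis card_0_eq card_1_singletonE le_Suc_eq le_zero_eq mem_Collect_eq One_nat_def)
        then show "I \<in> indep M" using I nl indep_empty[OF M] by auto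
      qed
      then have "M = uniform_matroid 1 (ground M)" by (simp add: uniform_matroid_def matroid.expand)
      moreover obtain B where B: "B \<in> bases M" "e \<notin> B" using nc[OF e] by blast
      then have "card (insert e B) = 2" "insert e B \<subseteq> ground M"
        using 1 e finite_base[OF M B(1)] base_subset_ground[OF M B(1)] by (auto simp: bases_iff[OF M])
      then have "2 \<le> card (ground M)" using card_mono[OF finite_ground[OF M]] by metis
      ultimately have "g M = [:0, 1:]" using g_uniform_rank_1[OF finite_ground[OF M]] by metis
      then show ?thesis by (simp add: coeff_pCons split: nat.split)
    next
      case 2
      obtain \<H> where "paving_family (matroid_rank M) (ground M) \<H>"
        "M = paving_matroid (matroid_rank M) (ground M) \<H>"
        using paving_matroid_structure[OF M assms(4,3) 2 nc] by blast
      then show ?thesis using coeff_g_paving_nonneg by metis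
    qed
  qed
qed

end
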